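(* Let $\Gamma\subset\partial B$ be a Jordan curve of class $C^2$ and let $g\in C^0(\Gamma)$ satisfy $\int_\Gamma g\,\nu\,ds=0$. Then the classical solution $(v,q,u,p)$ (in the sense defined in the context) to the problem $$\begin{cases}-\Delta v+\nabla q=0,\quad\nabla\cdot v=0 & \text{in }B,\\ v_3=0,\quad v_\parallel=u & \text{in }\partial B\setminus\Gamma,\\ \nabla p=-\partial_{x_3}v_\parallel,\quad\nabla\cdot u=0 & \text{in }\partial B\setminus\Gamma,\\ \llbracket u\cdot\nu\rrbracket=0,\quad\llbracket p\rrbracket=g & \text{on }\Gamma\end{cases}$$ is unique, i.e. any two classical solutions coincide.
   Context: $B=\mathbb{R}^2\times(-\infty,0)$, $\partial B\simeq\mathbb{R}^2$; $\Omega_-$ is the bounded interior of $\Gamma$ in $\partial B$, $\Omega_+$ the unbounded exterior, $\nu$ the unit normal to $\Gamma$ pointing from $\Omega_-$ to $\Omega_+$. $\llbracket f\rrbracket=f_--f_+$ with $f_\pm$ the traces on $\Gamma$ from $\Omega_\pm$. $v=(v_1,v_2,v_3)^\top$, $v_\parallel=(v_1,v_2)^\top$. A quadruplet $(v,q,u,p)$ is a classical solution if: (i) $v\in C^2(B;\mathbb{R}^3)\cap C^1(\overline B\setminus\Gamma;\mathbb{R}^3)$, $q\in C^1(B)\cap C^0(\overline B\setminus\Gamma)$, $u\in C^1(\overline{\Omega_-};\mathbb{R}^2)\cap C^1(\overline{\Omega_+};\mathbb{R}^2)$, $p\in C^1(\overline{\Omega_-})\cap C^1(\overline{\Omega_+})$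 (i.e. $u,p$ are $C^1$ up to $\Gamma$ from each side, possibly discontinuous across $\Gamma$); (ii) as $|x|\to\infty$, uniformly, $|v|=\mathcal O(|x|^{-2})$, $|\nabla v|=\mathcal O(|x|^{-3})$, $|q|=\mathcal O(|x|^{-3})$, $|\nabla q|=\mathcal O(|x|^{-4})$ in $B$, and $|u|=\mathcal O(|x|^{-2})$, $|p|=\mathcal O(|x|^{-2})$ on $\partial B$; (iii) $\int_B|\nabla v|^2dx<\infty$ and $\int_B|\nabla q|^2dx<\infty$; (iv) the equations in $B$ and in $\partial B\setminus\Gamma$ hold pointwise and the jump conditions on $\Gamma$ hold in the sense of one-sided limits. *)

theory Defs
  imports "HOL-Analysis.Analysis" "HOL-Library.Landau_Symbols"
begin

section \<open>Function classes\<close>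

text \<open>For sets that are not open, derivatives are taken relative to the set. On the sets used below
  (relatively open subsets of a closed half-space, closures of planar domains bounded by a regular
  \<open>C\<^sup>2\<close> Jordan curve) this agrees with requiring that the derivatives in the interior extend
  continuously to the whole set.\<close>

definition C1_on :: "'a::real_normed_vector set \<Rightarrow> ('a \<Rightarrow> 'b::real_normed_vector) \<Rightarrow> bool" where
  "C1_on S f \<longleftrightarrow> (\<exists>D :: 'a \<Rightarrow> 'a \<Rightarrow>\<^sub>L 'b.
     (\<forall>x\<in>S. (f has_derivative blinfun_apply (D x)) (at x within S)) \<and> continuous_on S D)"

definition C2_on :: "'a::real_normed_vector set \<Rightarrow> ('a \<Rightarrow> 'b::real_normed_vector) \<Rightarrow> bool" where
  "C2_on S f \<longleftrightarrow> (\<exists>D :: 'a \<Rightarrow> 'a \<Rightarrow>\<^sub>L 'b.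
     (\<forall>x\<in>S. (f has_derivative blinfun_apply (D x)) (at x within S)) \<and> C1_on S D)"

text \<open>Membership of the restriction of \<open>f\<close> to the open set \<open>U\<close> in \<open>C\<^sup>1\<close> of the closure of \<open>U\<close>; the
  values of \<open>f\<close> itself on the boundary of \<open>U\<close> are irrelevant, so a function may have this property
  on both sides of a curve and still be discontinuous across it.\<close>

definition C1_up_to_boundary ::
  "'a::real_normed_vector set \<Rightarrow> ('a \<Rightarrow> 'b::real_normed_vector) \<Rightarrow> bool" where
  "C1_up_to_boundary U f \<longleftrightarrow> (\<exists>F. (\<forall>x\<in>U. F x = f x) \<and> C1_on (closure U) F)"

definition decays_on :: "'a::real_normed_vector set \<Rightarrow> nat \<Rightarrow> ('a \<Rightarrow> 'b::real_normed_vector) \<Rightarrow> bool" where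
  "decays_on S k f \<longleftrightarrow>
     (\<lambda>x. norm (f x)) \<in> O[inf at_infinity (principal S)](\<lambda>x. 1 / norm x ^ k)"

section \<open>Differential operators\<close>

definition pd :: "'n::finite \<Rightarrow> (real^'n \<Rightarrow> 'b::real_normed_vector) \<Rightarrow> real^'n \<Rightarrow> 'b" where
  "pd i f x = frechet_derivative f (at x) (axis i 1)"

definition grad :: "(real^'n::finite \<Rightarrow> real) \<Rightarrow> real^'n \<Rightarrow> real^'n" where
  "grad f x = (\<chi> i. pd i f x)"

definition divergence :: "(real^'n::finite \<Rightarrow> real^'n) \<Rightarrow> real^'n \<Rightarrow> real" where
  "divergence f x = (\<Sum>i\<in>UNIV. pd i f x $ i)"

definition laplacian :: "(real^'n::finite \<Rightarrow> 'b::real_normed_vector) \<Rightarrow> real^'n \<Rightarrow> 'b" where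
  "laplacian f x = (\<Sum>i\<in>UNIV. pd i (pd i f) x)"

text \<open>Euclidean (Frobenius) norm of the full gradient of a scalar or vector field.\<close>

definition grad_norm :: "(real^'n::finite \<Rightarrow> 'b::real_normed_vector) \<Rightarrow> real^'n \<Rightarrow> real" where
  "grad_norm f x = sqrt (\<Sum>i\<in>UNIV. (norm (pd i f x))\<^sup>2)"

section \<open>The half-space and its boundary plane\<close>

definition lower_half :: "(real^3) set" where
  "lower_half = {x. x $ 3 < 0}"

text \<open>The boundary plane is identified with \<open>real^2\<close>.\<close>

definition emb :: "real^2 \<Rightarrow> real^3" where
  "emb x = vector [x $ 1, x $ 2, 0]"

definition par :: "real^3 \<Rightarrow> real^2" where
  "par w = vector [w $ 1, w $ 2]"

text \<open>The derivative in the third coordinate at a boundary point, taken from within the half-space.\<close>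

definition pd3_bdry :: "(real^3 \<Rightarrow> real^3) \<Rightarrow> real^2 \<Rightarrow> real^3" where
  "pd3_bdry v x = vector_derivative (\<lambda>s. v (emb x + s *\<^sub>R axis 3 1)) (at_left 0)"

section \<open>Jordan curves of class \<open>C\<^sup>2\<close>\<close>

text \<open>\<open>\<gamma>\<close> is a regular \<open>C\<^sup>2\<close> parametrisation of \<open>\<Gamma>\<close>, extended 1-periodically to the real line;
  one period is a simple closed path.\<close>

definition C2_Jordan_param :: "(real \<Rightarrow> real^2) \<Rightarrow> (real^2) set \<Rightarrow> bool" where
  "C2_Jordan_param \<gamma> \<Gamma> \<longleftrightarrow>
     C2_on UNIV \<gamma> \<and> (\<forall>t. \<gamma> (t + 1) = \<gamma> t) \<and> (\<forall>t. vector_derivative \<gamma> (at t) \<noteq> 0) \<and>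
     simple_path \<gamma> \<and> \<Gamma> = path_image \<gamma>"

text \<open>The bounded interior and the unbounded exterior of \<open>\<Gamma>\<close> are \<open>inside \<Gamma>\<close> and \<open>outside \<Gamma>\<close>.\<close>

definition outward_unit_normal :: "(real \<Rightarrow> real^2) \<Rightarrow> (real^2) set \<Rightarrow> (real^2 \<Rightarrow> real^2) \<Rightarrow> bool" where
  "outward_unit_normal \<gamma> \<Gamma> \<nu> \<longleftrightarrow>
     (\<forall>t. norm (\<nu> (\<gamma> t)) = 1 \<and> \<nu> (\<gamma> t) \<bullet> vector_derivative \<gamma> (at t) = 0) \<and>
     (\<forall>x\<in>\<Gamma>. \<forall>\<^sub>F s in at_right 0. x - s *\<^sub>R \<nu> x \<in> inside \<Gamma> \<and> x + s *\<^sub>R \<nu> x \<in> outside \<Gamma>)"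

definition has_curve_integral ::
  "(real^2 \<Rightarrow> 'b::real_normed_vector) \<Rightarrow> 'b \<Rightarrow> (real \<Rightarrow> real^2) \<Rightarrow> bool" where
  "has_curve_integral f I \<gamma> \<longleftrightarrow>
     ((\<lambda>t. norm (vector_derivative \<gamma> (at t)) *\<^sub>R f (\<gamma> t)) has_integral I) {0..1}"

definition jump :: "(real^2) set \<Rightarrow> (real^2 \<Rightarrow> 'b::real_normed_vector) \<Rightarrow> real^2 \<Rightarrow> 'b" where
  "jump \<Gamma> f x = Lim (at x within inside \<Gamma>) f - Lim (at x within outside \<Gamma>) f"

section \<open>Classical solutions\<close>

text \<open>\<open>v\<close> and \<open>q\<close> are functions on the closed half-space minus \<open>\<Gamma>\<close>, and \<open>u\<close> and \<open>p\<close> are functions on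
  the boundary plane minus \<open>\<Gamma>\<close>; values elsewhere are junk. In the jump conditions \<open>jump \<Gamma> u x \<bullet> \<nu> x\<close>
  is the jump of the normal component, since \<open>\<nu> x\<close> is the same for both traces.\<close>

definition classical_regularity ::
  "(real^2) set \<Rightarrow> (real^3 \<Rightarrow> real^3) \<Rightarrow> (real^3 \<Rightarrow> real) \<Rightarrow> (real^2 \<Rightarrow> real^2) \<Rightarrow> (real^2 \<Rightarrow> real) \<Rightarrow> bool" where
  "classical_regularity \<Gamma> v q u p \<longleftrightarrow>
     C2_on lower_half v \<and> C1_on (closure lower_half - emb ` \<Gamma>) v \<and>
     C1_on lower_half q \<and> continuous_on (closure lower_half - emb ` \<Gamma>) q \<and>
     C1_up_to_boundary (inside \<Gamma>) u \<and> C1_up_to_boundary (outside \<Gamma>) u \<and>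
     C1_up_to_boundary (inside \<Gamma>) p \<and> C1_up_to_boundary (outside \<Gamma>) p"

definition classical_decay ::
  "(real^2) set \<Rightarrow> (real^3 \<Rightarrow> real^3) \<Rightarrow> (real^3 \<Rightarrow> real) \<Rightarrow> (real^2 \<Rightarrow> real^2) \<Rightarrow> (real^2 \<Rightarrow> real) \<Rightarrow> bool" where
  "classical_decay \<Gamma> v q u p \<longleftrightarrow>
     decays_on lower_half 2 v \<and> decays_on lower_half 3 (grad_norm v) \<and>
     decays_on lower_half 3 q \<and> decays_on lower_half 4 (grad_norm q) \<and>
     decays_on (- \<Gamma>) 2 u \<and> decays_on (- \<Gamma>) 2 p"

definition finite_energy :: "(real^3 \<Rightarrow> 'b::real_normed_vector) \<Rightarrow> bool" where
  "finite_energy f \<longleftrightarrow> set_integrable lborel lower_half (\<lambda>x. (grad_norm f x)\<^sup>2)"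

definition solves_problem ::
  "(real^2) set \<Rightarrow> (real^2 \<Rightarrow> real^2) \<Rightarrow> (real^2 \<Rightarrow> real) \<Rightarrow>
   (real^3 \<Rightarrow> real^3) \<Rightarrow> (real^3 \<Rightarrow> real) \<Rightarrow> (real^2 \<Rightarrow> real^2) \<Rightarrow> (real^2 \<Rightarrow> real) \<Rightarrow> bool" where
  "solves_problem \<Gamma> \<nu> g v q u p \<longleftrightarrow>
     (\<forall>x\<in>lower_half. - laplacian v x + grad q x = 0 \<and> divergence v x = 0) \<and>
     (\<forall>x\<in>- \<Gamma>. v (emb x) $ 3 = 0 \<and> par (v (emb x)) = u x) \<and>
     (\<forall>x\<in>- \<Gamma>. grad p x = - par (pd3_bdry v x) \<and> divergence u x = 0) \<and>
     (\<forall>x\<in>\<Gamma>. jump \<Gamma> u x \<bullet> \<nu> x = 0 \<and> jump \<Gamma> p x = g x)"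

definition classical_solution ::
  "(real^2) set \<Rightarrow> (real^2 \<Rightarrow> real^2) \<Rightarrow> (real^2 \<Rightarrow> real) \<Rightarrow>
   (real^3 \<Rightarrow> real^3) \<Rightarrow> (real^3 \<Rightarrow> real) \<Rightarrow> (real^2 \<Rightarrow> real^2) \<Rightarrow> (real^2 \<Rightarrow> real) \<Rightarrow> bool" where
  "classical_solution \<Gamma> \<nu> g v q u p \<longleftrightarrow>
     classical_regularity \<Gamma> v q u p \<and> classical_decay \<Gamma> v q u p \<and>
     finite_energy v \<and> finite_energy q \<and> solves_problem \<Gamma> \<nu> g v q u p"

end

theory Submission
  imports Defs
begin

text \<open>
  For the difference of two solutions, with velocity \<open>w\<close>, pressure \<open>r\<close>, surface velocity \<open>a\<close> and surface
  pressure \<open>b\<close>, testing the Stokes equation with \<open>w\<close> gives that the Dirichlet integral of \<open>w\<close> equals the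
  boundary integral of \<open>a \<bullet> \<partial>\<^sub>3 w\<close>, that is, minus that of \<open>a \<bullet> grad b\<close>, which vanishes because \<open>a\<close> is
  divergence free and \<open>b\<close> does not jump. Hence \<open>w\<close> is constant, so zero by decay, and then so are \<open>r\<close> and \<open>b\<close>.

  Near the curve nothing is known about \<open>w\<close> and \<open>r\<close> beyond finite energy. A curve has zero capacity in space:
  there are cutoff functions that vanish near it, tend to 1 off it, and whose gradients tend weakly to zero in
  \<open>L\<^sup>2\<close>; with bounded truncations of \<open>w\<close> and \<open>r\<close> as test functions the cutoff can be removed. The same
  principle handles the planar integral: \<open>b\<close> is locally Lipschitz and \<open>a\<close> is the trace of a finite energy
  field, so the cutoff disappears from the boundary integral of \<open>a \<bullet> grad b\<close> as well, and no normal trace of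
  \<open>a\<close> on the curve is needed.
\<close>

section \<open>Half-space coordinates and integration\<close>

text \<open>The tube of radius \<open>1/n\<close> about a curve in space has volume of order
  \<open>n\<^sup>-\<^sup>2\<close>, so a cutoff with gradient of order \<open>n\<close> is
  borderline: its gradient is controlled in \<open>L\<^sup>2\<close> only by a constant. Boundedness
  in \<open>L\<^sup>2\<close> together with convergence to zero in \<open>L\<^sup>1\<close> is
  enough for pairing with a fixed \<open>L\<^sup>2\<close> function. The fluxes to be paired,
  \<open>w i * W i j\<close> and \<open>r * w j\<close>, are products of two
  \<open>L\<^sup>2\<close> functions and hence only integrable on bounded parts of the half-space;
  truncating one factor restores \<open>L\<^sup>2\<close>. This fixes the order of the limits: the
  cutoff at the curve is removed first, then the truncation, then the cutoff at infinity. In the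
  plane the curve has codimension one, and the same count leaves for the restricted cutoff gradient
  only an \<open>L\<^sup>1\<close> bound of order one. Estimates by size on the plane therefore
  cannot dispose of the planar cutoff term, which is why it is pushed into the half-space.\<close>

lemma prod_2: "prod f (UNIV :: 2 set) = f 1 * f 2"
  unfolding UNIV_2 by simp

lemma prod_3: "prod f (UNIV :: 3 set) = f 1 * f 2 * f 3"
  unfolding UNIV_3 by (simp add: ac_simps)

lemma prod_Basis_cart:
  fixes x :: "real^'n"
  shows "(\<Prod>b\<in>Basis. f (x \<bullet> b)) = (\<Prod>i\<in>UNIV. f (x $ i))"
  unfolding Basis_vec_def by (subst prod.UNION_disjoint) (auto simp: axis_eq_axis inner_axis)

lemma lower_half_sets: "lower_half \<in> sets borel"
  and open_lower_half: "open lower_half"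
proof -
  show "open lower_half"
    unfolding lower_half_def by (intro open_Collect_less continuous_intros)
  then show "lower_half \<in> sets borel" by auto
qed

lemma closure_lower_half: "closure lower_half = {x. x $ 3 \<le> 0}"
  using closure_halfspace_lt[of "axis 3 1 :: real^3" 0]
  by (simp add: lower_half_def inner_axis inner_commute)

lemma emb_nth [simp]: "emb x $ 1 = x $ 1" "emb x $ 2 = x $ 2" "emb x $ 3 = 0"
  by (simp_all add: emb_def)

lemma norm_emb [simp]: "norm (emb x) = norm x"
  by (simp add: norm_vec_def L2_set_def sum_3 sum_2)

lemma linear_emb: "linear emb"
  by (intro linearI; simp add: vec_eq_iff forall_3)

lemma bounded_linear_emb: "bounded_linear emb"
  using linear_emb by (simp add: linear_conv_bounded_linear)

lemma continuous_emb: "continuous_on A emb"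
  using bounded_linear.continuous_on[OF bounded_linear_emb continuous_on_id] by simp

lemma emb_inj: "emb x = emb y \<longleftrightarrow> x = y"
  by (auto simp: vec_eq_iff forall_3 forall_2)

lemma emb_in_closure: "emb x \<in> closure lower_half" "emb x \<notin> lower_half"
  by (auto simp: closure_lower_half lower_half_def)

lemma emb_image_disjoint: "emb ` A \<inter> lower_half = {}"
  using emb_in_closure by auto

lemma par_emb: "par (emb x) = x"
  by (simp add: par_def vec_eq_iff forall_2)

definition halfpt :: "(real^2) \<times> real \<Rightarrow> real^3" where
  "halfpt = (\<lambda>(x, s). emb x + s *\<^sub>R axis 3 1)"

lemma halfpt_nth [simp]: "halfpt (x, s) $ 1 = x $ 1" "halfpt (x, s) $ 2 = x $ 2" "halfpt (x, s) $ 3 = s"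
  by (simp_all add: halfpt_def axis_def)

lemma continuous_halfpt: "continuous_on A halfpt"
  unfolding halfpt_def case_prod_beta
  by (intro continuous_intros continuous_on_compose2[OF continuous_emb]) auto

lemma measurable_halfpt [measurable]: "halfpt \<in> borel_measurable borel"
  using continuous_halfpt by (rule borel_measurable_continuous_onI)

lemma measurable_halfpt' [measurable]: "halfpt \<in> borel_measurable (borel \<Otimes>\<^sub>M borel)"
  using measurable_halfpt by (simp add: borel_prod)

lemma norm_le_halfpt: "norm x \<le> norm (halfpt (x, s))" "\<bar>s\<bar> \<le> norm (halfpt (x, s))"
proof -
  show "norm x \<le> norm (halfpt (x, s))"
    by (simp add: norm_vec_def L2_set_def sum_3 sum_2)
  show "\<bar>s\<bar> \<le> norm (halfpt (x, s))"
    using component_le_norm_cart[of "halfpt (x, s)" 3] by simp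
qed

text \<open>A measure that gives every box its volume is \<open>lborel\<close>, and
  \<open>halfpt\<close> pulls a box back to a planar box times an interval. This puts the vertical
  variable innermost in iterated integrals, as needed for integrating along vertical lines.\<close>

lemma lborel_eq_distr_halfpt: "lborel = distr (lborel \<Otimes>\<^sub>M lborel) borel halfpt"
proof (rule lborel_eqI)
  fix l u :: "real^3" assume le: "\<And>b. b \<in> Basis \<Longrightarrow> l \<bullet> b \<le> u \<bullet> b"
  have le3: "l $ i \<le> u $ i" for i
    using le[of "axis i 1"] by (auto simp: inner_axis Basis_vec_def)
  let ?P = "box (par l) (par u) \<times> box (l $ 3) (u $ 3)"
  have eq: "halfpt -` box l u = ?P"
    by (auto simp: mem_box_cart forall_3 forall_2 par_def)
  have le2: "par l \<bullet> b \<le> par u \<bullet> b" if "b \<in> Basis" for b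
  proof -
    obtain i where "b = axis i 1" using \<open>b \<in> Basis\<close> by (auto simp: Basis_vec_def)
    with le3 show ?thesis using exhaust_2[of i] by (auto simp: inner_axis par_def)
  qed
  have "emeasure (distr (lborel \<Otimes>\<^sub>M lborel) borel halfpt) (box l u) = emeasure (lborel \<Otimes>\<^sub>M lborel) ?P"
    by (subst emeasure_distr) (auto simp: eq space_pair_measure)
  also have "\<dots> = emeasure lborel (box (par l) (par u)) * emeasure lborel (box (l $ 3) (u $ 3))"
    by (rule lborel.emeasure_pair_measure_Times) auto
  also have "\<dots> = ennreal (\<Prod>b\<in>Basis. (u - l) \<bullet> b)"
    using le2 le3 by (simp add: emeasure_lborel_box_eq ennreal_mult' [symmetric] prod_Basis_cart[where f=id, simplified] prod_nonneg
        prod_2 prod_3 par_def mult.assoc)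
  finally show "emeasure (distr (lborel \<Otimes>\<^sub>M lborel) borel halfpt) (box l u) = (\<Prod>b\<in>Basis. (u - l) \<bullet> b)" .
qed simp

lemma integral_halfpt:
  fixes f :: "real^3 \<Rightarrow> real"
  assumes "integrable lborel f"
  shows "(LINT x|lborel. f x) = (LINT x|lborel. LINT s|lborel. f (halfpt (x, s)))"
proof -
  have [measurable]: "f \<in> borel_measurable borel" using assms by auto
  have i: "integrable (lborel \<Otimes>\<^sub>M lborel) (\<lambda>z. f (halfpt z))"
    using assms by (subst (asm) lborel_eq_distr_halfpt) (simp add: integrable_distr_eq)
  have "(LINT x|lborel. f x) = (LINT z|(lborel \<Otimes>\<^sub>M lborel). f (halfpt z))"
    by (subst lborel_eq_distr_halfpt) (simp add: integral_distr)
  also have "\<dots> = (LINT x|lborel. LINT s|lborel. f (halfpt (x, s)))"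
    using lborel_pair.integral_fst'[OF i] by simp
  finally show ?thesis .
qed

lemma nn_integral_halfpt:
  assumes [measurable]: "f \<in> borel_measurable borel"
  shows "(\<integral>\<^sup>+x. f x \<partial>lborel) = (\<integral>\<^sup>+x. \<integral>\<^sup>+s. f (halfpt (x, s)) \<partial>lborel \<partial>lborel)"
proof -
  have "(\<integral>\<^sup>+x. f x \<partial>lborel) = (\<integral>\<^sup>+z. f (halfpt z) \<partial>(lborel \<Otimes>\<^sub>M lborel))"
    by (subst lborel_eq_distr_halfpt) (simp add: nn_integral_distr)
  also have "\<dots> = (\<integral>\<^sup>+x. \<integral>\<^sup>+s. f (halfpt (x, s)) \<partial>lborel \<partial>lborel)"
    by (subst lborel.nn_integral_fst[symmetric]) auto
  finally show ?thesis .
qed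

section \<open>Set integrals: domination, bounded supports, translation\<close>

lemma set_dominated_convergence:
  fixes s :: "nat \<Rightarrow> 'a \<Rightarrow> real"
  assumes "A \<in> sets M" and "\<And>n. set_borel_measurable M A (s n)"
    and "set_integrable M A g"
    and lim: "AE x\<in>A in M. (\<lambda>n. s n x) \<longlonglongrightarrow> f x"
    and "\<And>n x. x \<in> A \<Longrightarrow> \<bar>s n x\<bar> \<le> g x"
    and "set_borel_measurable M A f"
  shows "set_integrable M A f" "(\<lambda>n. LINT x:A|M. s n x) \<longlonglongrightarrow> (LINT x:A|M. f x)"
proof -
  have a: "AE x in M. (\<lambda>n. indicator A x *\<^sub>R s n x) \<longlonglongrightarrow> indicator A x *\<^sub>R f x"
    using lim by eventually_elim (auto simp: indicator_def)
  have b: "AE x in M. norm (indicator A x *\<^sub>R s n x) \<le> indicator A x *\<^sub>R g x" for n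
    using assms(5) by (auto simp: indicator_def)
  show "set_integrable M A f" "(\<lambda>n. LINT x:A|M. s n x) \<longlonglongrightarrow> (LINT x:A|M. f x)"
    using dominated_convergence
      integrable_dominated_convergence[of "\<lambda>x. indicator A x *\<^sub>R f x" M "\<lambda>n x. indicator A x *\<^sub>R s n x"
        "\<lambda>x. indicator A x *\<^sub>R g x"]
      integral_dominated_convergence[of "\<lambda>x. indicator A x *\<^sub>R f x" M "\<lambda>n x. indicator A x *\<^sub>R s n x"
        "\<lambda>x. indicator A x *\<^sub>R g x"]  assms a b
    unfolding set_integrable_def set_lebesgue_integral_def set_borel_measurable_def by blast+
qed

lemma set_measurable_continuous:
  fixes f :: "'a::euclidean_space \<Rightarrow> real"
  assumes "continuous_on A f" "A \<in> sets borel"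
  shows "set_borel_measurable lborel A f"
  using borel_measurable_continuous_on_indicator[OF assms(2,1)]
  by (simp add: set_borel_measurable_def)

lemma set_integrable_continuous_bound:
  fixes f g :: "'a::euclidean_space \<Rightarrow> real"
  assumes "continuous_on A f" "A \<in> sets borel" "set_integrable lborel A g"
    and "\<And>x. x \<in> A \<Longrightarrow> \<bar>f x\<bar> \<le> g x"
  shows "set_integrable lborel A f"
  using set_integrable_bound[OF assms(3) set_measurable_continuous[OF assms(1,2)]] assms(4)
  by force

lemma set_integrable_const_cball:
  fixes A :: "'a::euclidean_space set"
  assumes "A \<in> sets borel"
  shows "set_integrable lborel A (\<lambda>x. c * indicator (cball 0 R) x :: real)"
proof -
  have "emeasure lborel (A \<inter> cball 0 R) < \<infinity>"
    by (rule emeasure_bounded_finite) auto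
  then have "integrable lborel (\<lambda>x. indicator (A \<inter> cball 0 R) x *\<^sub>R c)"
    using assms by (intro integrable_real_mult_indicator integrable_indicator) auto
  then show ?thesis
    unfolding set_integrable_def
    by (rule Bochner_Integration.integrable_cong[THEN iffD1, rotated 2]) (auto simp: indicator_def)
qed

lemma set_integrable_compact_support:
  fixes f :: "'a::euclidean_space \<Rightarrow> real"
  assumes "continuous_on A f" "A \<in> sets borel"
    and "\<And>x. x \<in> A \<Longrightarrow> \<bar>f x\<bar> \<le> C" "\<And>x. x \<in> A \<Longrightarrow> norm x > R \<Longrightarrow> f x = 0"
  shows "set_integrable lborel A f"
proof (rule set_integrable_continuous_bound[OF assms(1,2) set_integrable_const_cball[OF assms(2), of C R]])
  show "\<bar>f x\<bar> \<le> C * indicat_real (cball 0 R) x" if "x \<in> A" for x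
    using assms(3,4)[OF that] by (cases "norm x \<le> R") auto
qed

lemma set_integral_translate:
  fixes f :: "'a::euclidean_space \<Rightarrow> real"
  assumes "\<And>x. x + c \<in> A \<longleftrightarrow> x \<in> A"
  shows "set_integrable lborel A (\<lambda>x. f (x + c)) \<longleftrightarrow> set_integrable lborel A f"
    and "(LINT x:A|lborel. f (x + c)) = (LINT x:A|lborel. f x)"
proof -
  let ?g = "\<lambda>x. indicator A x *\<^sub>R f x"
  have e: "(\<lambda>x. indicator A x *\<^sub>R f (x + c)) = (\<lambda>x. ?g (c + x))"
    using assms by (auto simp: indicator_def fun_eq_iff add.commute)
  have "integrable lborel (\<lambda>x. g (d + x))" if "integrable lborel g" for g :: "'a \<Rightarrow> real" and d
  proof -
    have "integrable (distr lborel borel ((+) d)) g" using that by (simp add: lborel_distr_plus)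
    then show ?thesis by (subst (asm) integrable_distr_eq) (use that in auto)
  qed
  from this[of ?g c] this[of "\<lambda>x. ?g (c + x)" "-c"]
  show i: "set_integrable lborel A (\<lambda>x. f (x + c)) \<longleftrightarrow> set_integrable lborel A f"
    unfolding set_integrable_def e by (auto simp: add.assoc[symmetric])
  show "(LINT x:A|lborel. f (x + c)) = (LINT x:A|lborel. f x)"
  proof (cases "set_integrable lborel A f")
    case True
    then have "?g \<in> borel_measurable borel" by (auto simp: set_integrable_def)
    then have "integral\<^sup>L (distr lborel borel ((+) c)) ?g = (LINT x|lborel. ?g (c + x))"
      by (subst integral_distr) auto
    then show ?thesis unfolding set_lebesgue_integral_def e by (simp add: lborel_distr_plus)
  next
    \<comment> \<open>Neither side is integrable, so both integrals have the default value
      0.\<close>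
    case False
    with i show ?thesis
      by (simp add: set_integrable_def set_lebesgue_integral_def not_integrable_integral_eq)
  qed
qed

section \<open>Integration by parts in the half-space\<close>

text \<open>Integration by parts against a weight that is merely Lipschitz: the difference quotient is moved
  onto the weight by translation invariance, so the weight is never differentiated.\<close>

lemma weighted_line_derivative:
  fixes f f' \<beta> :: "'a::euclidean_space \<Rightarrow> real" and e :: 'a
  assumes S: "S \<in> sets borel" and inv: "\<And>x t. x \<in> S \<Longrightarrow> x + t *\<^sub>R e \<in> S"
    and der: "\<And>x. x \<in> S \<Longrightarrow> ((\<lambda>t. f (x + t *\<^sub>R e)) has_real_derivative f' x) (at 0)"
    and cf: "continuous_on S f" and cf': "continuous_on S f'"
    and bf: "\<And>x. x \<in> S \<Longrightarrow> \<bar>f x\<bar> \<le> C" and bf': "\<And>x. x \<in> S \<Longrightarrow> \<bar>f' x\<bar> \<le> C"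
    and supp: "\<And>x. x \<in> S \<Longrightarrow> norm x > R \<Longrightarrow> f x = 0"
    and c\<beta>: "continuous_on UNIV \<beta>"
    and lip: "\<And>x t. norm x \<le> R \<Longrightarrow> \<bar>t\<bar> \<le> 1 \<Longrightarrow> \<bar>\<beta> (x + t *\<^sub>R e) - \<beta> x\<bar> \<le> L * \<bar>t\<bar>"
  shows "\<bar>LINT x:S|lborel. \<beta> x * f' x\<bar> \<le> L * (LINT x:S|lborel. \<bar>f x\<bar>)"
proof -
  have inv': "x + t *\<^sub>R e \<in> S \<longleftrightarrow> x \<in> S" for x t
    using inv[of x t] inv[of "x + t *\<^sub>R e" "-t"] by auto
  \<comment> \<open>Step sizes in \<open>(0, 1]\<close>, the range of shifts for which
    \<open>lip\<close> is available.\<close>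
  define h where "h = (\<lambda>n. inverse (real (Suc n)))"
  have h: "0 < h n" "h n \<le> 1" for n by (auto simp: h_def field_simps)
  have h0: "h \<longlonglongrightarrow> 0" unfolding h_def by (rule LIMSEQ_inverse_real_of_nat)
  define q where "q = (\<lambda>n x. (f (x + h n *\<^sub>R e) - f x) / h n)"
  have qlim: "(\<lambda>n. q n x) \<longlonglongrightarrow> f' x" if "x \<in> S" for x
  proof -
    have "((\<lambda>t. (f (x + t *\<^sub>R e) - f x) / t) \<longlongrightarrow> f' x) (at 0)"
      using der[OF that] by (simp add: DERIV_def)
    moreover have "filterlim h (at 0) sequentially"
      using h0 h(1) by (auto simp: filterlim_at less_imp_neq[THEN not_sym] intro!: always_eventually)
    ultimately show ?thesis unfolding q_def by (rule filterlim_compose)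
  qed
  \<comment> \<open>By the mean value theorem each difference quotient is a value of
    \<open>f'\<close> further along the line, so \<open>C\<close> bounds all of them at
    once.\<close>
  have qb: "\<bar>q n x\<bar> \<le> C" if "x \<in> S" for n x
  proof -
    have "\<exists>z>0. z < h n \<and> f (x + h n *\<^sub>R e) - f (x + 0 *\<^sub>R e) = (h n - 0) * f' (x + z *\<^sub>R e)"
    proof (rule MVT2)
      fix t :: real
      have "((\<lambda>s. f ((x + t *\<^sub>R e) + s *\<^sub>R e)) has_real_derivative f' (x + t *\<^sub>R e)) (at 0)"
        using der inv'[of x t] that by blast
      then show "((\<lambda>t. f (x + t *\<^sub>R e)) has_real_derivative f' (x + t *\<^sub>R e)) (at t)"
        using DERIV_shift[of "\<lambda>s. f (x + s *\<^sub>R e)" _ 0 t] by (simp add: algebra_simps)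
    qed (use h in auto)
    then obtain z where "f (x + h n *\<^sub>R e) - f x = h n * f' (x + z *\<^sub>R e)" by auto
    then have "q n x = f' (x + z *\<^sub>R e)" using h[of n] by (simp add: q_def)
    with bf' inv' that show ?thesis by auto
  qed
  \<comment> \<open>Shifts are at most \<open>norm e\<close> long, so beyond this radius both ends
    of a difference quotient lie outside the support of \<open>f\<close>.\<close>
  define R' where "R' = R + norm e"
  have qsupp: "q n x = 0" if "x \<in> S" "norm x > R'" for n x
  proof -
    have "norm (h n *\<^sub>R e) \<le> norm e" using h[of n] by (simp add: mult_left_le_one_le)
    then have "norm (x + h n *\<^sub>R e) > R" using that norm_diff_ineq[of x "h n *\<^sub>R e"] by (simp add: R'_def)
    moreover have "norm x > R" using that norm_ge_zero[of e] unfolding R'_def by linarith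
    ultimately show ?thesis using supp inv' that by (simp add: q_def)
  qed
  obtain B where B: "\<And>x. norm x \<le> R' \<Longrightarrow> \<bar>\<beta> x\<bar> \<le> B" and B0: "0 \<le> B"
  proof -
    have "compact (\<beta> ` cball 0 R')"
      by (intro compact_continuous_image continuous_on_subset[OF c\<beta>]) auto
    then obtain B where "\<forall>y \<in> \<beta> ` cball 0 R'. norm y \<le> B" by (meson bounded_iff compact_imp_bounded)
    then show ?thesis by (intro that[of "max 0 B"]) (auto simp: le_max_iff_disj)
  qed
  have cfs: "continuous_on S (\<lambda>x. f (x + c *\<^sub>R e))" for c
    by (rule continuous_on_compose2[OF cf]) (auto simp: inv' intro!: continuous_intros)
  have c\<beta>S: "continuous_on S \<beta>" "continuous_on S (\<lambda>x. \<beta> (x + c *\<^sub>R e))" for c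
    by (auto intro: continuous_on_subset[OF c\<beta>] continuous_on_compose2[OF c\<beta>] intro!: continuous_intros)
  have cq: "continuous_on S (q n)" for n
    unfolding q_def using h[of n] by (intro continuous_intros cf cfs) auto
  have C0: "0 \<le> C" if "x \<in> S" for x using bf[OF that] by linarith
  have lim: "(\<lambda>n. LINT x:S|lborel. \<beta> x * q n x) \<longlonglongrightarrow> (LINT x:S|lborel. \<beta> x * f' x)"
  proof (rule set_dominated_convergence(2))
    show "set_integrable lborel S (\<lambda>x. B * C * indicator (cball 0 R') x)"
      by (rule set_integrable_const_cball[OF S])
    show "AE x\<in>S in lborel. (\<lambda>n. \<beta> x * q n x) \<longlonglongrightarrow> \<beta> x * f' x"
      using qlim by (auto intro!: tendsto_intros)
    show "\<bar>\<beta> x * q n x\<bar> \<le> B * C * indicator (cball 0 R') x" if "x \<in> S" for n x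
      using qb[OF that, of n] qsupp[OF that, of n] B[of x] B0 C0[OF that]
      by (cases "norm x \<le> R'") (auto simp: abs_mult intro!: mult_mono)
  qed (use S cq c\<beta>S cf' in \<open>auto intro!: set_measurable_continuous continuous_intros\<close>)
  \<comment> \<open>Summation by parts: translation invariance of the integral over \<open>S\<close>
    carries the shift by \<open>h n *\<^sub>R e\<close> from \<open>f\<close> to
    \<open>\<beta>\<close>.\<close>
  have eq: "(LINT x:S|lborel. \<beta> x * q n x) = (LINT x:S|lborel. ((\<beta> (x - h n *\<^sub>R e) - \<beta> x) / h n) * f x)" for n
  proof -
    have i: "set_integrable lborel S (\<lambda>x. \<beta> (x - c *\<^sub>R e) * f x)" if "\<bar>c\<bar> \<le> 1" for c
    proof (rule set_integrable_compact_support[OF _ S, where C = "B * C" and R = R])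
      show "continuous_on S (\<lambda>x. \<beta> (x - c *\<^sub>R e) * f x)"
        using c\<beta>S(2)[of "-c"] by (intro continuous_intros cf) simp
      fix x assume x: "x \<in> S"
      show "\<bar>\<beta> (x - c *\<^sub>R e) * f x\<bar> \<le> B * C"
      proof (cases "norm x \<le> R")
        case True
        have "norm (c *\<^sub>R e) \<le> norm e" using \<open>\<bar>c\<bar> \<le> 1\<close> by (simp add: mult_left_le_one_le)
        then have "norm (x - c *\<^sub>R e) \<le> R'"
          using True norm_triangle_ineq4[of x "c *\<^sub>R e"] by (simp add: R'_def)
        from B[OF this] bf[OF x] show ?thesis by (auto simp: abs_mult intro!: mult_mono)
      next
        case False
        then show ?thesis using B0 C0[OF x] by (simp add: supp[OF x])
      qed
      show "\<beta> (x - c *\<^sub>R e) * f x = 0" if "norm x > R" using supp[OF x that] by simp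
    qed
    have "set_integrable lborel S (\<lambda>x. \<beta> (x - h n *\<^sub>R e) * f x)" (is "set_integrable _ _ ?g")
      using i h[of n] by simp
    then have i1: "set_integrable lborel S (\<lambda>x. \<beta> x * f (x + h n *\<^sub>R e))"
      and e1: "(LINT x:S|lborel. \<beta> x * f (x + h n *\<^sub>R e)) = (LINT x:S|lborel. ?g x)"
      using set_integral_translate[OF inv', of ?g "h n"] by simp_all
    have i0: "set_integrable lborel S (\<lambda>x. \<beta> x * f x)" using i[of 0] by simp
    have "(LINT x:S|lborel. \<beta> x * q n x)
        = ((LINT x:S|lborel. \<beta> x * f (x + h n *\<^sub>R e)) - (LINT x:S|lborel. \<beta> x * f x)) / h n"
      by (simp add: q_def right_diff_distrib set_integral_diff(2)[OF i1 i0])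
    also have "\<dots> = (LINT x:S|lborel. ((\<beta> (x - h n *\<^sub>R e) - \<beta> x) / h n) * f x)"
      unfolding e1 using h[of n]
      by (simp add: left_diff_distrib set_integral_diff(2)[OF i[of "h n"] i0])
    finally show ?thesis .
  qed
  have fi: "set_integrable lborel S f"
    by (rule set_integrable_compact_support[OF cf S bf supp])
  have bd: "\<bar>LINT x:S|lborel. \<beta> x * q n x\<bar> \<le> L * (LINT x:S|lborel. \<bar>f x\<bar>)" for n
  proof -
    let ?k = "\<lambda>x. ((\<beta> (x - h n *\<^sub>R e) - \<beta> x) / h n) * f x"
    have b: "\<bar>?k x\<bar> \<le> L * \<bar>f x\<bar>" if x: "x \<in> S" for x
    proof (cases "norm x \<le> R")
      case True
      have "\<bar>\<beta> (x + (- h n) *\<^sub>R e) - \<beta> x\<bar> \<le> L * \<bar>- h n\<bar>"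
        by (rule lip[OF True]) (use h[of n] in auto)
      then have "\<bar>(\<beta> (x - h n *\<^sub>R e) - \<beta> x) / h n\<bar> \<le> L"
        using h[of n] by (simp add: abs_divide divide_le_eq)
      then show ?thesis unfolding abs_mult by (intro mult_right_mono) auto
    qed (use supp[OF x] in auto)
    have iL: "set_integrable lborel S (\<lambda>x. L * \<bar>f x\<bar>)" using set_integrable_abs[OF fi] by simp
    have ik: "set_integrable lborel S ?k"
      by (rule set_integrable_continuous_bound[OF _ S iL b])
         (use c\<beta>S(2)[of "- h n"] h[of n] in \<open>auto intro!: continuous_intros c\<beta>S cf\<close>)
    have "\<bar>LINT x:S|lborel. ?k x\<bar> \<le> (LINT x:S|lborel. \<bar>?k x\<bar>)"
      using ik integral_abs_bound[of lborel "\<lambda>x. indicator S x *\<^sub>R ?k x"]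
      unfolding set_lebesgue_integral_def by (simp add: abs_mult)
    also have "\<dots> \<le> (LINT x:S|lborel. L * \<bar>f x\<bar>)"
      by (rule set_integral_mono[OF set_integrable_abs[OF ik] iL b])
    finally show ?thesis unfolding eq by simp
  qed
  show ?thesis
    by (rule LIMSEQ_le_const2[OF tendsto_rabs[OF lim]]) (use bd in auto)
qed

lemma line_derivative_eq_0:
  fixes f :: "'a::real_normed_vector \<Rightarrow> real"
  assumes "open U" "x \<in> U" "\<And>y. y \<in> U \<Longrightarrow> f y = 0"
    and "((\<lambda>t. f (x + t *\<^sub>R e)) has_real_derivative d) (at 0)"
  shows "d = 0"
proof -
  have "\<forall>\<^sub>F t in nhds 0. x + t *\<^sub>R e \<in> U"
    by (rule topological_tendstoD[OF _ assms(1)])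
       (use assms(2) in \<open>auto intro!: tendsto_eq_intros filterlim_ident\<close>)
  then have "\<forall>\<^sub>F t in nhds 0. f (x + t *\<^sub>R e) = 0"
    by eventually_elim (rule assms(3))
  then have "((\<lambda>t::real. 0) has_real_derivative d) (at 0)"
    using assms(4) DERIV_cong_ev[of 0 0 "\<lambda>t. f (x + t *\<^sub>R e)" "\<lambda>_. 0" d d] by simp
  then show ?thesis using DERIV_unique[OF _ DERIV_const] by blast
qed

lemma continuous_bounded_on_compact:
  fixes f :: "'a::t2_space \<Rightarrow> real"
  assumes "continuous_on K f" "compact K"
  obtains B where "0 \<le> B" "\<And>x. x \<in> K \<Longrightarrow> \<bar>f x\<bar> \<le> B"
proof -
  have "compact (f ` K)" using assms by (rule compact_continuous_image)
  then obtain B where "\<forall>y \<in> f ` K. norm y \<le> B" by (meson bounded_iff compact_imp_bounded)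
  then show ?thesis by (intro that[of "max 0 B"]) (auto simp: le_max_iff_disj)
qed

text \<open>On the half-spaces \<open>S n\<close>, kept away from the boundary plane, every
  \<open>D j\<close> is bounded with bounded support. There the horizontal derivatives integrate to
  zero and the vertical one is integrated along lines, which leaves \<open>F 3\<close> on a plane
  slightly below the boundary. Letting this plane rise uses only continuity of \<open>F 3\<close> up
  to the boundary and integrability of the sum of the \<open>D j\<close>, which separately may fail
  to be integrable.\<close>

lemma half_space_divergence:
  fixes F D :: "3 \<Rightarrow> real^3 \<Rightarrow> real"
  assumes der: "\<And>j x. x \<in> lower_half \<Longrightarrow> ((\<lambda>t. F j (x + t *\<^sub>R axis j 1)) has_real_derivative D j x) (at 0)"
    and cD: "\<And>j. continuous_on lower_half (D j)"
    and cF: "\<And>j. continuous_on lower_half (F j)"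
    and cF3: "continuous_on (closure lower_half) (F 3)"
    and supp: "\<And>j x. x \<in> closure lower_half \<Longrightarrow> norm x > R \<Longrightarrow> F j x = 0"
    and int: "set_integrable lborel lower_half (\<lambda>x. \<Sum>j\<in>UNIV. D j x)"
  shows "(LINT x:lower_half|lborel. \<Sum>j\<in>UNIV. D j x) = (LINT x|lborel. F 3 (emb x))"
proof -
  define S where "S = (\<lambda>n. {x :: real^3. x $ 3 < - inverse (real (Suc n))})"
  have S_sub: "S n \<subseteq> lower_half" for n
    by (auto simp: S_def lower_half_def) (smt (verit) inverse_nonnegative_iff_nonnegative of_nat_0_le_iff)
  have S_open: "open (S n)" for n
    unfolding S_def by (intro open_Collect_less continuous_intros)
  then have S_sets: "S n \<in> sets borel" for n by auto
  have cl: "lower_half \<subseteq> closure lower_half" by (rule closure_subset)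
  have D0: "D j x = 0" if "x \<in> lower_half" "norm x > R" for j x
  proof (rule line_derivative_eq_0[OF _ _ _ der[OF that(1)]])
    show "open (lower_half \<inter> - cball 0 R)"
      using open_lower_half by (intro open_Int) (auto simp: closed_cball open_Compl)
    show "F j y = 0" if "y \<in> lower_half \<inter> - cball 0 R" for y
      using that supp cl by (auto simp: dist_norm)
  qed (use that in auto)
  have bdd: "\<exists>C\<ge>0. \<forall>x\<in>S n. \<bar>G x\<bar> \<le> C"
    if cG: "continuous_on lower_half G" and G0: "\<And>x. x \<in> lower_half \<Longrightarrow> norm x > R \<Longrightarrow> G x = 0" for G :: "real^3 \<Rightarrow> real" and n
  proof -
    let ?K = "{x :: real^3. x $ 3 \<le> - inverse (real (Suc n))} \<inter> cball 0 R"
    have "?K \<subseteq> lower_half"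
      by (auto simp: lower_half_def) (smt (verit) inverse_positive_iff_positive of_nat_0_less_iff zero_less_Suc of_nat_Suc)
    moreover have "compact ?K"
      by (intro closed_Int_compact closed_Collect_le continuous_intros) auto
    ultimately obtain B where B: "0 \<le> B" "\<And>x. x \<in> ?K \<Longrightarrow> \<bar>G x\<bar> \<le> B"
      using continuous_bounded_on_compact[of ?K G] continuous_on_subset[OF cG] by blast
    have "\<bar>G x\<bar> \<le> B" if "x \<in> S n" for x
    proof (cases "norm x \<le> R")
      case True
      then show ?thesis using that by (intro B(2)) (auto simp: S_def)
    next
      case False
      then show ?thesis using G0[of x] that S_sub[of n] B(1) by auto
    qed
    with B(1) show ?thesis by blast
  qed
  have Di: "set_integrable lborel (S n) (D j)" for n j
  proof -
    obtain C where "\<forall>x\<in>S n. \<bar>D j x\<bar> \<le> C" using bdd[OF cD D0] by blast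
    then show ?thesis
      by (intro set_integrable_compact_support[of _ _ C R] continuous_on_subset[OF cD] S_sub S_sets D0)
         (use S_sub in auto)
  qed
  have horiz: "(LINT x:S n|lborel. D j x) = 0" if "j \<noteq> 3" for n j
  proof -
    obtain C1 where C1: "\<forall>x\<in>S n. \<bar>D j x\<bar> \<le> C1" using bdd[OF cD D0] by blast
    have F0: "F j x = 0" if "x \<in> lower_half" "norm x > R" for x using supp[of x j] that cl by auto
    obtain C2 where C2: "\<forall>x\<in>S n. \<bar>F j x\<bar> \<le> C2" using bdd[OF cF F0] by blast
    \<comment> \<open>A constant weight has Lipschitz constant 0, so the weighted estimate forces
      the integral to vanish.\<close>
    have "\<bar>LINT x:S n|lborel. 1 * D j x\<bar> \<le> 0 * (LINT x:S n|lborel. \<bar>F j x\<bar>)"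
    proof (rule weighted_line_derivative[where C = "max C1 C2" and R = R])
      show "\<And>x t. x \<in> S n \<Longrightarrow> x + t *\<^sub>R axis j 1 \<in> S n"
        using \<open>j \<noteq> 3\<close> by (auto simp: S_def axis_def)
    qed (use der S_sub S_sub[THEN subsetD] S_sets C1 C2 F0 in
          \<open>auto intro!: continuous_on_subset[OF cD] continuous_on_subset[OF cF] simp: le_max_iff_disj\<close>)
    then show ?thesis by simp
  qed
  have vert: "(LINT x:S n|lborel. D 3 x) = (LINT x|lborel. F 3 (halfpt (x, - inverse (real (Suc n)))))" for n
  proof -
    define \<delta> where "\<delta> = inverse (real (Suc n))"
    have \<delta>: "0 < \<delta>" by (simp add: \<delta>_def)
    \<comment> \<open>Deep enough that every point at height \<open>- T\<close> or below lies
      outside the support, and deeper than \<open>\<delta>\<close>, so that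
      \<open>{- T..- \<delta>}\<close> is nonempty.\<close>
    define T where "T = max R \<delta> + 1"
    have "(LINT x:S n|lborel. D 3 x) =
        (LINT x|lborel. LINT s|lborel. indicator (S n) (halfpt (x, s)) *\<^sub>R D 3 (halfpt (x, s)))"
      using Di[of n 3] unfolding set_lebesgue_integral_def set_integrable_def by (rule integral_halfpt)
    also have "\<dots> = (LINT x|lborel. F 3 (halfpt (x, - \<delta>)))"
    proof (rule Bochner_Integration.integral_cong[OF refl])
      fix x :: "real^2"
      have derx: "((\<lambda>s. F 3 (halfpt (x, s))) has_real_derivative D 3 (halfpt (x, s))) (at s)" if "s < 0" for s
      proof -
        have "halfpt (x, s) \<in> lower_half" using that by (simp add: lower_half_def)
        from der[OF this, of 3] show ?thesis
          using DERIV_shift[of "\<lambda>t. F 3 (halfpt (x, t))" _ 0 s]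
          by (simp add: halfpt_def scaleR_add_left algebra_simps)
      qed
      have cont: "continuous_on {- T..- \<delta>} (\<lambda>s. D 3 (halfpt (x, s)))"
        by (rule continuous_on_compose2[OF cD continuous_on_compose2[OF continuous_halfpt]])
           (use \<delta> in \<open>auto intro!: continuous_intros simp: lower_half_def\<close>)
      have big: "norm (halfpt (x, s)) > R" if "s \<le> - T" for s
        using norm_le_halfpt(2)[of s x] that by (simp add: T_def)
      have "(LINT s|lborel. indicator (S n) (halfpt (x, s)) *\<^sub>R D 3 (halfpt (x, s)))
          = (LINT s|lborel. indicator {- T..- \<delta>} s *\<^sub>R D 3 (halfpt (x, s)))"
      proof (rule integral_cong_AE)
        \<comment> \<open>\<open>S n\<close> is open, so on this line it omits the endpoint
          \<open>- \<delta>\<close>, a null set; below \<open>- T\<close> the derivative is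
          zero.\<close>
        show "AE s in lborel. indicator (S n) (halfpt (x, s)) *\<^sub>R D 3 (halfpt (x, s)) =
           indicat_real {- T..- \<delta>} s *\<^sub>R D 3 (halfpt (x, s))"
          using AE_lborel_singleton[of "- \<delta>"]
        proof eventually_elim
          case (elim s)
          have "D 3 (halfpt (x, s)) = 0" if "s < - T"
            by (rule D0) (use that big[of s] \<delta> in \<open>auto simp: T_def lower_half_def\<close>)
          with elim show ?case by (auto simp: indicator_def S_def \<delta>_def)
        qed
        have "(\<lambda>x. indicator (S n) x *\<^sub>R D 3 x) \<in> borel_measurable borel"
          using Di[of n 3] unfolding set_integrable_def by auto
        then have "(\<lambda>x. indicator (S n) x *\<^sub>R D 3 x) \<circ> (\<lambda>s. halfpt (x, s)) \<in> borel_measurable borel"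
          by (rule measurable_comp[rotated]) (intro borel_measurable_continuous_onI
              continuous_on_compose2[OF continuous_halfpt[of UNIV]] continuous_intros, auto)
        then show "(\<lambda>s. indicator (S n) (halfpt (x, s)) *\<^sub>R D 3 (halfpt (x, s))) \<in> borel_measurable lborel"
          by (simp add: comp_def)
        show "(\<lambda>s. indicat_real {- T..- \<delta>} s *\<^sub>R D 3 (halfpt (x, s))) \<in> borel_measurable lborel"
          using borel_measurable_continuous_on_indicator[OF _ cont] by simp
      qed
      also have "\<dots> = F 3 (halfpt (x, - \<delta>)) - F 3 (halfpt (x, - T))"
        by (rule integral_FTC_Icc[OF _ _ cont])
           (use derx \<delta> in \<open>auto simp: T_def has_real_derivative_iff_has_vector_derivative intro: has_vector_derivative_at_within\<close>)
      also have "F 3 (halfpt (x, - T)) = 0"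
        by (rule supp[OF _ big]) (use \<delta> in \<open>auto simp: closure_lower_half T_def\<close>)
      finally show "(LINT s|lborel. indicator (S n) (halfpt (x, s)) *\<^sub>R D 3 (halfpt (x, s))) = F 3 (halfpt (x, - \<delta>))"
        by simp
    qed
    finally show ?thesis unfolding \<delta>_def .
  qed
  have step: "(LINT x:lower_half|lborel. indicator (S n) x * (\<Sum>j\<in>UNIV. D j x))
      = (LINT x|lborel. F 3 (halfpt (x, - inverse (real (Suc n)))))" for n
  proof -
    have "(LINT x:lower_half|lborel. indicator (S n) x * (\<Sum>j\<in>UNIV. D j x)) = (LINT x:S n|lborel. \<Sum>j\<in>UNIV. D j x)"
      unfolding set_lebesgue_integral_def using S_sub[of n]
      by (intro Bochner_Integration.integral_cong) (auto simp: indicator_def)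
    also have "\<dots> = (\<Sum>j\<in>UNIV. LINT x:S n|lborel. D j x)"
      using set_integral_add[OF set_integral_add(1)[OF Di Di] Di] set_integral_add(2)[OF Di Di] by (simp add: sum_3)
    also have "\<dots> = (LINT x|lborel. F 3 (halfpt (x, - inverse (real (Suc n)))))"
      by (simp add: sum_3 horiz vert)
    finally show ?thesis .
  qed
  have lim1: "(\<lambda>n. LINT x:lower_half|lborel. indicator (S n) x * (\<Sum>j\<in>UNIV. D j x))
      \<longlonglongrightarrow> (LINT x:lower_half|lborel. \<Sum>j\<in>UNIV. D j x)"
  proof (rule set_dominated_convergence(2)[where g = "\<lambda>x. \<bar>\<Sum>j\<in>UNIV. D j x\<bar>"])
    show "AE x\<in>lower_half in lborel. (\<lambda>n. indicat_real (S n) x * (\<Sum>j\<in>UNIV. D j x)) \<longlonglongrightarrow> (\<Sum>j\<in>UNIV. D j x)"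
    proof (intro always_eventually allI impI)
      fix x :: "real^3" assume "x \<in> lower_half"
      then have "\<forall>\<^sub>F n in sequentially. inverse (real (Suc n)) < - x $ 3"
        by (intro order_tendstoD(2)[OF LIMSEQ_inverse_real_of_nat]) (simp add: lower_half_def)
      then have "\<forall>\<^sub>F n in sequentially. indicat_real (S n) x * (\<Sum>j\<in>UNIV. D j x) = (\<Sum>j\<in>UNIV. D j x)"
        by eventually_elim (auto simp: S_def indicator_def)
      then show "(\<lambda>n. indicat_real (S n) x * (\<Sum>j\<in>UNIV. D j x)) \<longlonglongrightarrow> (\<Sum>j\<in>UNIV. D j x)"
        by (rule tendsto_eventually)
    qed
    show m: "set_borel_measurable lborel lower_half (\<lambda>x. \<Sum>j\<in>UNIV. D j x)"
      by (intro set_measurable_continuous continuous_intros cD lower_half_sets)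
    show "set_borel_measurable lborel lower_half (\<lambda>x. indicator (S n) x * (\<Sum>j\<in>UNIV. D j x))" for n
    proof -
      have "(\<lambda>x. indicator (S n) x * (indicator lower_half x *\<^sub>R (\<Sum>j\<in>UNIV. D j x))) \<in> borel_measurable lborel"
        using m S_sets[of n] unfolding set_borel_measurable_def by (intro borel_measurable_times) auto
      then show ?thesis unfolding set_borel_measurable_def by (simp add: mult_ac)
    qed
  qed (use int lower_half_sets in \<open>auto intro: set_integrable_abs simp: indicator_def\<close>)
  have ce: "continuous_on UNIV (\<lambda>x. F 3 (halfpt (x, s)))" if "s \<le> 0" for s
    by (rule continuous_on_compose2[OF cF3 continuous_on_compose2[OF continuous_halfpt]])
       (use that in \<open>auto intro!: continuous_intros simp: closure_lower_half\<close>)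
  have lim2: "(\<lambda>n. LINT x|lborel. F 3 (halfpt (x, - inverse (real (Suc n))))) \<longlonglongrightarrow> (LINT x|lborel. F 3 (emb x))"
  proof -
    have "compact (closure lower_half \<inter> cball 0 R)" by (intro closed_Int_compact) auto
    then obtain B where B: "0 \<le> B" "\<And>x. x \<in> closure lower_half \<inter> cball 0 R \<Longrightarrow> \<bar>F 3 x\<bar> \<le> B"
      using continuous_bounded_on_compact continuous_on_subset[OF cF3] by (metis Int_lower1)
    have bnd: "\<bar>F 3 (halfpt (x, s))\<bar> \<le> B * indicator (cball 0 R) x" if "s \<le> 0" for x s
    proof (cases "norm (halfpt (x, s)) \<le> R")
      case True
      then have "norm x \<le> R" using norm_le_halfpt(1)[of x s] by linarith
      then show ?thesis using B(2)[of "halfpt (x,s)"] True that by (simp add: closure_lower_half)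
    next
      case False
      then show ?thesis using supp[of "halfpt (x, s)" 3] that B(1) by (simp add: closure_lower_half)
    qed
    have "(\<lambda>n. LINT x:UNIV|lborel. F 3 (halfpt (x, - inverse (real (Suc n))))) \<longlonglongrightarrow> (LINT x:UNIV|lborel. F 3 (halfpt (x, 0)))"
    proof (rule set_dominated_convergence(2)[where g = "\<lambda>x. B * indicator (cball 0 R) x"])
      show "set_integrable lborel UNIV (\<lambda>x::real^2. B * indicator (cball 0 R) x)"
        by (rule set_integrable_const_cball) auto
      show "AE x\<in>UNIV in lborel. (\<lambda>n. F 3 (halfpt (x, - inverse (real (Suc n))))) \<longlonglongrightarrow> F 3 (halfpt (x, 0))"
      proof (intro always_eventually allI impI)
        fix x :: "real^2"
        have "continuous_on {..0} (\<lambda>s. F 3 (halfpt (x, s)))"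
          by (rule continuous_on_compose2[OF cF3 continuous_on_compose2[OF continuous_halfpt]])
             (auto intro!: continuous_intros simp: closure_lower_half)
        moreover have "(\<lambda>n. - inverse (real (Suc n))) \<longlonglongrightarrow> 0"
          using tendsto_minus[OF LIMSEQ_inverse_real_of_nat] by simp
        ultimately show "(\<lambda>n. F 3 (halfpt (x, - inverse (real (Suc n))))) \<longlonglongrightarrow> F 3 (halfpt (x, 0))"
          by (rule continuous_on_tendsto_compose) auto
      qed
    qed (use bnd ce in \<open>auto intro!: set_measurable_continuous\<close>)
    then show ?thesis by (simp add: set_lebesgue_integral_def halfpt_def)
  qed
  show ?thesis using LIMSEQ_unique[OF lim1[unfolded step] lim2] .
qed

section \<open>Cutoff functions near a curve\<close>

lemma nn_integral_inverse_1_plus_square: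
  "(\<integral>\<^sup>+s. ennreal (1 / (1 + s\<^sup>2)) \<partial>lborel) \<le> ennreal pi"
proof -
  let ?f = "\<lambda>s::real. ennreal (1 / (1 + s\<^sup>2))"
  have half: "(\<integral>\<^sup>+s. ?f s * indicator {0..} s \<partial>lborel) = ennreal (pi / 2)"
  proof -
    have "(\<integral>\<^sup>+s. ?f s * indicator {0..} s \<partial>lborel) = ennreal (pi / 2 - arctan 0)"
      by (rule nn_integral_FTC_atLeast)
         (auto intro!: derivative_eq_intros tendsto_arctan_at_top simp: add_pos_nonneg inverse_eq_divide)
    then show ?thesis by simp
  qed
  have "(\<integral>\<^sup>+s. ?f s \<partial>lborel) \<le> (\<integral>\<^sup>+s. ?f s * indicator {0..} s + ?f s * indicator {..0} s \<partial>lborel)"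
    by (intro nn_integral_mono) (auto simp: indicator_def)
  also have "\<dots> = (\<integral>\<^sup>+s. ?f s * indicator {0..} s \<partial>lborel) + (\<integral>\<^sup>+s. ?f s * indicator {..0} s \<partial>lborel)"
    by (rule nn_integral_add) auto
  also have "(\<integral>\<^sup>+s. ?f s * indicator {..0} s \<partial>lborel) = (\<integral>\<^sup>+s. ?f s * indicator {0..} s \<partial>lborel)"
    by (subst nn_integral_real_affine[where c = "-1" and t = 0]) (auto simp: indicator_def intro!: nn_integral_cong)
  also note half
  also have "ennreal (pi / 2) + ennreal (pi / 2) = ennreal pi"
    by (subst ennreal_plus[symmetric]) auto
  finally show ?thesis .
qed

text \<open>The product form makes both the integral over the whole space and the logarithmic derivative
  explicit; the latter is bounded by \<open>n\<close>.\<close>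

definition bump :: "real \<Rightarrow> real^'n \<Rightarrow> real^'n \<Rightarrow> real" where
  "bump n c x = (\<Prod>j\<in>UNIV. 1 / (1 + (n * (x $ j - c $ j))\<^sup>2))"

lemma one_plus_square_pos: "0 < 1 + (s::real)\<^sup>2"
  by (simp add: add_pos_nonneg)

lemma bump_pos: "0 < bump n c x"
  unfolding bump_def by (intro prod_pos ballI divide_pos_pos one_plus_square_pos) auto

lemma bump_le: "bump n c x \<le> 1 / (1 + (n * (x $ i - c $ i))\<^sup>2)"
proof -
  have "bump n c x = 1 / (1 + (n * (x $ i - c $ i))\<^sup>2) * (\<Prod>j\<in>UNIV - {i}. 1 / (1 + (n * (x $ j - c $ j))\<^sup>2))"
    unfolding bump_def by (rule prod.remove) auto
  also have "\<dots> \<le> 1 / (1 + (n * (x $ i - c $ i))\<^sup>2) * 1"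
    by (intro mult_left_mono prod_le_1) (auto simp: divide_simps add_pos_nonneg)
  finally show ?thesis by simp
qed

lemma continuous_bump: "continuous_on A (bump n c)"
  unfolding bump_def by (intro continuous_intros) (auto simp: one_plus_square_pos less_imp_neq[symmetric])

text \<open>The integral factors over the coordinates, and each factor is a rescaled arctangent
  integral, at most \<open>pi / n\<close>. With \<open>n = 1\<close> the same function serves later
  as an integrable majorant at infinity.\<close>

lemma bump_integral:
  fixes c :: "real^'n"
  assumes "n > 0"
  shows "integrable lborel (bump n c)" "(LINT x|lborel. bump n c x) \<le> (pi / n) ^ CARD('n)"
proof -
  have one: "(\<integral>\<^sup>+s. ennreal (1 / (1 + (n * (s - a))\<^sup>2)) \<partial>lborel) \<le> ennreal (pi / n)" for a
  proof -
    have "(\<integral>\<^sup>+s. ennreal (1 / (1 + (n * (s - a))\<^sup>2)) \<partial>lborel)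
        = ennreal (1 / n) * (\<integral>\<^sup>+s. ennreal (1 / (1 + s\<^sup>2)) \<partial>lborel)"
      using assms by (subst nn_integral_real_affine[where c = "1 / n" and t = a]) auto
    also have "\<dots> \<le> ennreal (1 / n) * ennreal pi"
      by (intro mult_left_mono nn_integral_inverse_1_plus_square) auto
    also have "\<dots> = ennreal (pi / n)" using assms by (simp flip: ennreal_mult)
    finally show ?thesis .
  qed
  have "(\<integral>\<^sup>+x. ennreal (bump n c x) \<partial>lborel)
      = (\<integral>\<^sup>+x. (\<Prod>b\<in>Basis. ennreal (1 / (1 + (n * (x \<bullet> b - c \<bullet> b))\<^sup>2))) \<partial>lborel)"
  proof (rule nn_integral_cong)
    fix x :: "real^'n"
    have "bump n c x = (\<Prod>b\<in>Basis. 1 / (1 + (n * (x \<bullet> b - c \<bullet> b))\<^sup>2))"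
      unfolding bump_def Basis_vec_def
      by (subst prod.UNION_disjoint) (auto simp: axis_eq_axis inner_axis)
    then show "ennreal (bump n c x) = (\<Prod>b\<in>Basis. ennreal (1 / (1 + (n * (x \<bullet> b - c \<bullet> b))\<^sup>2)))"
      by (simp add: prod_ennreal)
  qed
  also have "\<dots> = (\<Prod>b\<in>Basis. \<integral>\<^sup>+s. ennreal (1 / (1 + (n * (s - c \<bullet> b))\<^sup>2)) \<partial>lborel)"
    by (rule nn_integral_lborel_prod) auto
  also have "\<dots> \<le> (\<Prod>b\<in>(Basis::(real^'n) set). ennreal (pi / n))"
    by (intro prod_mono_ennreal one)
  also have "\<dots> = ennreal ((pi / n) ^ CARD('n))" using assms by (simp add: ennreal_power)
  finally have *: "(\<integral>\<^sup>+x. ennreal (bump n c x) \<partial>lborel) \<le> ennreal ((pi / n) ^ CARD('n))" .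
  have m: "bump n c \<in> borel_measurable borel"
    by (intro borel_measurable_continuous_onI continuous_bump)
  have "(\<integral>\<^sup>+x. ennreal (norm (bump n c x)) \<partial>lborel) < \<infinity>"
    using * bump_pos[of n c] le_less_trans[OF _ ennreal_less_top] by (auto simp: less_imp_le)
  then show i: "integrable lborel (bump n c)" using m by (intro integrableI_bounded) auto
  have "ennreal (LINT x|lborel. bump n c x) = (\<integral>\<^sup>+x. ennreal (bump n c x) \<partial>lborel)"
    using i bump_pos[of n c] by (intro nn_integral_eq_integral[symmetric]) (auto simp: less_imp_le)
  then have "ennreal (LINT x|lborel. bump n c x) \<le> ennreal ((pi / n) ^ CARD('n))" using * by simp
  then show "(LINT x|lborel. bump n c x) \<le> (pi / n) ^ CARD('n)"
    using assms by (subst (asm) ennreal_le_iff) auto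
qed

text \<open>Logarithmic derivative of \<open>1 / (1 + (n * s)\<^sup>2)\<close> in \<open>s\<close>,
  the factor that appears when \<open>bump\<close> is differentiated in one coordinate.\<close>

definition bumplog :: "real \<Rightarrow> real \<Rightarrow> real" where
  "bumplog n s = - (2 * n\<^sup>2 * s) / (1 + (n * s)\<^sup>2)"

lemma abs_bumplog_le:
  assumes "n \<ge> 0"
  shows "\<bar>bumplog n s\<bar> \<le> n"
proof -
  have "2 * \<bar>n * s\<bar> \<le> 1 + (n * s)\<^sup>2"
    using zero_le_power2[of "\<bar>n * s\<bar> - 1"] by (simp add: power2_diff)
  then have "n * (2 * \<bar>n * s\<bar>) \<le> n * (1 + (n * s)\<^sup>2)" using assms by (rule mult_left_mono)
  moreover have "\<bar>bumplog n s\<bar> = (n * (2 * \<bar>n * s\<bar>)) / (1 + (n * s)\<^sup>2)"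
    using assms one_plus_square_pos[of "n * s"] by (simp add: bumplog_def abs_mult abs_divide power2_eq_square)
  ultimately show ?thesis using one_plus_square_pos[of "n * s"] by (simp add: divide_le_eq)
qed

lemma continuous_bumplog: "continuous_on A (bumplog n)"
  unfolding bumplog_def by (intro continuous_intros) (auto simp: one_plus_square_pos less_imp_neq[symmetric])

lemma bump_derivative:
  fixes c x :: "real^'n"
  shows "((\<lambda>t. bump n c (x + t *\<^sub>R axis l 1)) has_real_derivative bumplog n (x $ l - c $ l) * bump n c x) (at 0)"
proof -
  let ?r = "\<Prod>j\<in>UNIV - {l}. 1 / (1 + (n * (x $ j - c $ j))\<^sup>2)"
  have "bump n c (x + t *\<^sub>R axis l 1) = 1 / (1 + (n * (x $ l + t - c $ l))\<^sup>2) * ?r" for t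
    unfolding bump_def
    by (subst prod.remove[of _ l]) (auto simp: axis_def intro!: prod.cong)
  moreover have "bump n c x = 1 / (1 + (n * (x $ l - c $ l))\<^sup>2) * ?r"
    unfolding bump_def by (subst prod.remove[of _ l]) auto
  moreover have "((\<lambda>t. 1 / (1 + (n * (x $ l + t - c $ l))\<^sup>2) * ?r) has_real_derivative
      bumplog n (x $ l - c $ l) * (1 / (1 + (n * (x $ l - c $ l))\<^sup>2)) * ?r) (at 0)"
  proof -
    have "1 + (n * (x $ l + 0 - c $ l))\<^sup>2 \<noteq> 0" using one_plus_square_pos[of "n * (x $ l + 0 - c $ l)"] by linarith
    then show ?thesis
      by (auto intro!: derivative_eq_intros simp: bumplog_def power2_eq_square field_simps)
  qed
  ultimately show ?thesis by (simp add: mult.assoc)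
qed

text \<open>Writing the exponent as \<open>Suc (Suc k)\<close> keeps it at least 2, which is what
  gives the derivative 0 at the kink.\<close>

lemma max_0_power_derivative:
  fixes s :: real
  shows "((\<lambda>s. (max 0 s) ^ Suc (Suc k)) has_real_derivative (real (Suc (Suc k))) * (max 0 s) ^ Suc k) (at s)"
proof -
  consider "s < 0" | "s > 0" | "s = 0" by linarith
  then show ?thesis
  proof cases
    case 1
    have "((\<lambda>s. 0) has_real_derivative 0) (at s)" by simp
    then show ?thesis
      by (rule has_field_derivative_transform_within[of _ _ _ _ "-s", THEN DERIV_cong]) (use 1 in \<open>auto simp: dist_real_def max_def\<close>)
  next
    case 2
    have "((\<lambda>s. s ^ Suc (Suc k)) has_real_derivative (real (Suc (Suc k))) * s ^ Suc k) (at s)"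
      using DERIV_pow[of "Suc (Suc k)" s] by simp
    then show ?thesis
      by (rule has_field_derivative_transform_within[of _ _ _ _ "s", THEN DERIV_cong])
         (use 2 in \<open>auto simp: dist_real_def max_def\<close>)
  next
    case 3
    have "((\<lambda>h::real. max 0 h ^ Suc (Suc k) / h) \<longlongrightarrow> 0) (at 0)"
    proof (rule Lim_null_comparison)
      show "\<forall>\<^sub>F h in at (0::real). norm (max 0 h ^ Suc (Suc k) / h) \<le> (max 0 h) ^ Suc k"
        by (intro always_eventually) (auto simp: max_def)
      have "((\<lambda>h::real. max 0 h ^ Suc k) \<longlongrightarrow> max 0 0 ^ Suc k) (at 0)"
        by (intro tendsto_intros)
      then show "((\<lambda>h::real. max 0 h ^ Suc k) \<longlongrightarrow> 0) (at 0)" by simp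
    qed
    then show ?thesis by (simp add: 3 DERIV_def)
  qed
qed

text \<open>Split at the height \<open>k\<close> of \<open>f\<close>. Where
  \<open>\<bar>f x\<bar>\<close> is at most \<open>k\<close>, the \<open>L\<^sup>1\<close> norm of
  \<open>g n\<close> controls the product; where it is larger, Young's inequality gives a small
  multiple of the bounded integral of \<open>(g n x)\<^sup>2\<close> and a large multiple of a tail
  of the integral of \<open>(f x)\<^sup>2\<close>. The parameter \<open>\<delta>\<close> is fixed
  first, then \<open>k\<close>, then \<open>n\<close>.\<close>

lemma tendsto_integral_mult_weakly_null:
  fixes g :: "nat \<Rightarrow> 'a::euclidean_space \<Rightarrow> real"
  assumes S: "S \<in> sets borel"
    and f: "set_borel_measurable lborel S f" "set_integrable lborel S (\<lambda>x. (f x)\<^sup>2)"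
    and g: "\<And>n. continuous_on UNIV (g n)" "\<And>n x. 0 \<le> g n x" "\<And>n. integrable lborel (g n)"
    and g2: "\<And>n. integrable lborel (\<lambda>x. (g n x)\<^sup>2)" "\<And>n. (LINT x|lborel. (g n x)\<^sup>2) \<le> K"
    and g0: "(\<lambda>n. LINT x|lborel. g n x) \<longlonglongrightarrow> 0"
  shows "set_integrable lborel S (\<lambda>x. g n x * \<bar>f x\<bar>)" "(\<lambda>n. LINT x:S|lborel. g n x * \<bar>f x\<bar>) \<longlonglongrightarrow> 0"
proof -
  define fk where "fk = (\<lambda>(k::nat) x. if \<bar>f x\<bar> > real k then (f x)\<^sup>2 else 0)"
  have gm: "g n \<in> borel_measurable borel" for n using g(1) by (intro borel_measurable_continuous_onI)
  have fm: "(\<lambda>x. indicator S x *\<^sub>R f x) \<in> borel_measurable borel"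
    using f(1) by (simp add: set_borel_measurable_def)
  have gfm: "set_borel_measurable lborel S (\<lambda>x. g n x * \<bar>f x\<bar>)" for n
  proof -
    have "(\<lambda>x. g n x * \<bar>indicator S x *\<^sub>R f x\<bar>) \<in> borel_measurable borel"
      using gm fm by (intro borel_measurable_times borel_measurable_abs)
    then show ?thesis by (simp add: set_borel_measurable_def abs_mult mult_ac)
  qed
  have fkm: "set_borel_measurable lborel S (fk k)" for k
  proof -
    have [measurable]: "(\<lambda>x. indicator S x *\<^sub>R f x) \<in> borel_measurable borel" by (rule fm)
    have "(\<lambda>x. if \<bar>indicator S x *\<^sub>R f x\<bar> > real k then (indicator S x *\<^sub>R f x)\<^sup>2 else 0) \<in> borel_measurable borel"
      by measurable
    moreover have "(\<lambda>x. if \<bar>indicator S x *\<^sub>R f x\<bar> > real k then (indicator S x *\<^sub>R f x)\<^sup>2 else 0) = (\<lambda>x. indicator S x *\<^sub>R fk k x)"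
      by (auto simp: fk_def indicator_def fun_eq_iff)
    ultimately show ?thesis by (simp add: set_borel_measurable_def)
  qed
  have fki: "set_integrable lborel S (fk k)" for k
    by (rule set_integrable_bound[OF f(2) fkm]) (auto simp: fk_def)
  have fk0: "(\<lambda>k. LINT x:S|lborel. fk k x) \<longlonglongrightarrow> (LINT x:S|lborel. 0)"
  proof (rule set_dominated_convergence(2)[OF _ fkm f(2)])
    show "AE x\<in>S in lborel. (\<lambda>k. fk k x) \<longlonglongrightarrow> 0"
    proof (intro always_eventually allI impI)
      fix x
      obtain k0 :: nat where "\<bar>f x\<bar> \<le> real k0" using real_arch_simple by blast
      then have "\<forall>\<^sub>F k in sequentially. fk k x = 0"
        by (intro eventually_sequentiallyI[of k0]) (auto simp: fk_def)
      then show "(\<lambda>k. fk k x) \<longlonglongrightarrow> 0" by (rule tendsto_eventually)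
    qed
  qed (use S in \<open>auto simp: fk_def set_borel_measurable_def\<close>)
  have gS: "set_integrable lborel S (g n)" "set_integrable lborel S (\<lambda>x. (g n x)\<^sup>2)" for n
    unfolding set_integrable_def using S by (intro integrable_mult_indicator g(3) g2(1); simp)+
  have le: "(LINT x:S|lborel. h x) \<le> (LINT x|lborel. h x)" if "integrable lborel h" "\<And>x. 0 \<le> h x" for h :: "'a \<Rightarrow> real"
    unfolding set_lebesgue_integral_def
    by (rule integral_mono'[OF that(1)]) (auto simp: indicator_def that)
  have pt: "g n x * \<bar>f x\<bar> \<le> real k * g n x + \<delta> / 2 * (g n x)\<^sup>2 + 1 / (2 * \<delta>) * fk k x" if "\<delta> > 0" for n k x \<delta>
  proof (cases "\<bar>f x\<bar> > real k")
    case True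
    have "0 \<le> (\<delta> * g n x - \<bar>f x\<bar>)\<^sup>2 / (2 * \<delta>)" using that by simp
    also have "\<dots> = \<delta> / 2 * (g n x)\<^sup>2 + 1 / (2 * \<delta>) * (f x)\<^sup>2 - g n x * \<bar>f x\<bar>"
      using that by (simp add: power2_diff power_mult_distrib field_simps) (simp add: power2_eq_square)
    finally have "g n x * \<bar>f x\<bar> \<le> \<delta> / 2 * (g n x)\<^sup>2 + 1 / (2 * \<delta>) * (f x)\<^sup>2" by simp
    moreover have "fk k x = (f x)\<^sup>2" using True by (simp add: fk_def)
    moreover have "0 \<le> real k * g n x" using g(2) by simp
    ultimately show ?thesis by simp
  next
    case False
    then have "g n x * \<bar>f x\<bar> \<le> g n x * real k" using g(2) by (intro mult_left_mono) auto
    then show ?thesis using False that by (simp add: fk_def mult.commute add_increasing2)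
  qed
  have ib: "set_integrable lborel S (\<lambda>x. real k * g n x + \<delta> / 2 * (g n x)\<^sup>2 + 1 / (2 * \<delta>) * fk k x)" for n k \<delta>
    by (intro set_integral_add(1) set_integrable_mult_right gS fki impI)
  show gf: "set_integrable lborel S (\<lambda>x. g n x * \<bar>f x\<bar>)" for n
    by (rule set_integrable_bound[OF ib[of 1 n 1] gfm]) (use pt[of 1 n _ 1] g(2) in \<open>auto simp: abs_mult intro: order_trans[OF _ abs_ge_self]\<close>)
  have K0: "0 \<le> K" by (rule order_trans[OF _ g2(2)[of 0]]) (rule Bochner_Integration.integral_nonneg, simp)
  have main: "(LINT x:S|lborel. g n x * \<bar>f x\<bar>) \<le> real k * (LINT x|lborel. g n x) + \<delta> / 2 * K + 1 / (2 * \<delta>) * (LINT x:S|lborel. fk k x)"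
    if "\<delta> > 0" for n k \<delta>
  proof -
    have "(LINT x:S|lborel. g n x * \<bar>f x\<bar>) \<le> (LINT x:S|lborel. real k * g n x + \<delta> / 2 * (g n x)\<^sup>2 + 1 / (2 * \<delta>) * fk k x)"
      by (rule set_integral_mono[OF gf ib pt[OF that]])
    also have "\<dots> = real k * (LINT x:S|lborel. g n x) + \<delta> / 2 * (LINT x:S|lborel. (g n x)\<^sup>2) + 1 / (2 * \<delta>) * (LINT x:S|lborel. fk k x)"
    proof -
      have a: "set_integrable lborel S (\<lambda>x. real k * g n x)" "set_integrable lborel S (\<lambda>x. \<delta> / 2 * (g n x)\<^sup>2)"
        "set_integrable lborel S (\<lambda>x. 1 / (2 * \<delta>) * fk k x)"
        by (intro set_integrable_mult_right gS fki impI)+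
      show ?thesis
        unfolding set_integral_add(2)[OF set_integral_add(1)[OF a(1,2)] a(3)] set_integral_add(2)[OF a(1,2)] by simp
    qed
    also have "\<dots> \<le> real k * (LINT x|lborel. g n x) + \<delta> / 2 * K + 1 / (2 * \<delta>) * (LINT x:S|lborel. fk k x)"
      using le[OF g(3)[of n] g(2)] order_trans[OF le[OF g2(1)[of n] zero_le_power2] g2(2)] that
      by (intro add_mono mult_left_mono) auto
    finally show ?thesis .
  qed
  show "(\<lambda>n. LINT x:S|lborel. g n x * \<bar>f x\<bar>) \<longlonglongrightarrow> 0"
  proof (rule LIMSEQ_I)
    fix e :: real assume e: "0 < e"
    \<comment> \<open>With this choice the three terms of \<open>main\<close> end up below
      \<open>e / 4\<close>, \<open>e / 2\<close> and \<open>e / 4\<close>; the added 1 covers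
      \<open>K = 0\<close>.\<close>
    define \<delta> where "\<delta> = e / (K + 1)"
    have \<delta>: "\<delta> > 0" using e K0 by (simp add: \<delta>_def)
    have "\<delta> * (K + 1) = e" using K0 by (simp add: \<delta>_def)
    then have \<delta>K: "\<delta> / 2 * K < e / 2" using \<delta> by (simp add: algebra_simps)
    have "(\<lambda>k. 1 / (2 * \<delta>) * (LINT x:S|lborel. fk k x)) \<longlonglongrightarrow> 1 / (2 * \<delta>) * 0"
      using fk0 by (intro tendsto_intros) simp
    then have "\<forall>\<^sub>F k in sequentially. 1 / (2 * \<delta>) * (LINT x:S|lborel. fk k x) < e / 4"
      by (rule order_tendstoD) (use e in simp)
    then obtain k where k: "1 / (2 * \<delta>) * (LINT x:S|lborel. fk k x) < e / 4"
      by (auto simp: eventually_sequentially)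
    have "(\<lambda>n. real k * (LINT x|lborel. g n x)) \<longlonglongrightarrow> real k * 0"
      using g0 by (intro tendsto_intros)
    then have "\<forall>\<^sub>F n in sequentially. real k * (LINT x|lborel. g n x) < e / 4"
      by (rule order_tendstoD) (use e in simp)
    then have "\<forall>\<^sub>F n in sequentially. norm ((LINT x:S|lborel. g n x * \<bar>f x\<bar>) - 0) < e"
    proof eventually_elim
      case (elim n)
      have "0 \<le> (LINT x:S|lborel. g n x * \<bar>f x\<bar>)"
        unfolding set_lebesgue_integral_def using g(2) by (intro integral_nonneg_AE always_eventually) auto
      with elim main[OF \<delta>, of n k] k \<delta>K show ?case by simp
    qed
    then show "\<exists>no. \<forall>n\<ge>no. norm ((LINT x:S|lborel. g n x * \<bar>f x\<bar>) - 0) < e"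
      by (simp add: eventually_sequentially)
  qed
qed

text \<open>The function \<open>tube n\<close> is at least \<open>thr\<close> within distance \<open>1/n\<close> of the curve, has integral
  \<open>O(n\<^sup>-\<^sup>2)\<close>, and its gradient is at most \<open>n\<close> times itself. Hence the gradient of \<open>cut n\<close> is bounded in \<open>L\<^sup>2\<close>
  and of size \<open>O(1/n)\<close> in \<open>L\<^sup>1\<close>, with no overlap count for the balls along the curve. The exponent 3 in
  \<open>cut\<close> makes it twice continuously differentiable. \<open>ddtube\<close> and \<open>ddcut\<close> are mixed second
  derivatives only: they are not the derivatives for \<open>l = m\<close>.\<close>

locale lipschitz_curve =
  fixes c :: "real \<Rightarrow> real^3" and L :: real
  assumes lip: "L-lipschitz_on {0..1} c"
begin

definition tube :: "nat \<Rightarrow> real^3 \<Rightarrow> real" where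
  "tube n x = (\<Sum>i<n. bump (real n) (c (real i / real n)) x)"

definition dtube :: "nat \<Rightarrow> 3 \<Rightarrow> real^3 \<Rightarrow> real" where
  "dtube n l x = (\<Sum>i<n. bumplog (real n) (x $ l - c (real i / real n) $ l) * bump (real n) (c (real i / real n)) x)"

definition ddtube :: "nat \<Rightarrow> 3 \<Rightarrow> 3 \<Rightarrow> real^3 \<Rightarrow> real" where
  "ddtube n l m x = (\<Sum>i<n. bumplog (real n) (x $ l - c (real i / real n) $ l) *
     bumplog (real n) (x $ m - c (real i / real n) $ m) * bump (real n) (c (real i / real n)) x)"

text \<open>A point within \<open>1/n\<close> of the curve is within \<open>(1 + L) / n\<close> of a
  sample point, so each of the three factors of the \<open>bump\<close> centred there is at least
  \<open>1 / (1 + (1 + L)\<^sup>2)\<close>.\<close>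

definition thr :: real where "thr = 1 / (1 + (1 + L)\<^sup>2) ^ 3"

definition gap :: "nat \<Rightarrow> real^3 \<Rightarrow> real" where
  "gap n x = max 0 (1 - tube n x / thr)"

definition cut :: "nat \<Rightarrow> real^3 \<Rightarrow> real" where "cut n x = gap n x ^ 3"

definition dcut :: "nat \<Rightarrow> 3 \<Rightarrow> real^3 \<Rightarrow> real" where
  "dcut n l x = - (3 / thr) * (gap n x)\<^sup>2 * dtube n l x"

definition ddcut :: "nat \<Rightarrow> 3 \<Rightarrow> 3 \<Rightarrow> real^3 \<Rightarrow> real" where
  "ddcut n l m x = 6 / thr\<^sup>2 * gap n x * dtube n l x * dtube n m x - 3 / thr * (gap n x)\<^sup>2 * ddtube n l m x"

lemma L_nonneg: "0 \<le> L" using lip by (rule lipschitz_on_nonneg)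

lemma thr_pos: "0 < thr"
  unfolding thr_def by (intro divide_pos_pos zero_less_power one_plus_square_pos) auto

lemma tube_nonneg: "0 \<le> tube n x"
  unfolding tube_def by (intro sum_nonneg less_imp_le bump_pos)

lemma continuous_tube: "continuous_on A (tube n)"
  unfolding tube_def by (intro continuous_intros continuous_bump)

lemma continuous_dtube: "continuous_on A (dtube n l)"
  unfolding dtube_def
  by (intro continuous_intros continuous_bump continuous_on_compose2[OF continuous_bumplog[of UNIV]]) auto

lemma continuous_ddtube: "continuous_on A (ddtube n l m)"
  unfolding ddtube_def
  by (intro continuous_intros continuous_bump continuous_on_compose2[OF continuous_bumplog[of UNIV]]) auto

lemma continuous_gap: "continuous_on A (gap n)"
  unfolding gap_def using thr_pos by (intro continuous_intros continuous_tube) auto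

lemma continuous_cut: "continuous_on A (cut n)"
  and continuous_dcut: "continuous_on A (dcut n l)"
  and continuous_ddcut: "continuous_on A (ddcut n l m)"
  unfolding cut_def dcut_def ddcut_def
  by (intro continuous_intros continuous_gap continuous_dtube continuous_ddtube)+

lemma tube_derivative: "((\<lambda>t. tube n (x + t *\<^sub>R axis l 1)) has_real_derivative dtube n l x) (at 0)"
  unfolding tube_def dtube_def by (intro DERIV_sum bump_derivative)

lemma dtube_derivative:
  assumes "l \<noteq> m"
  shows "((\<lambda>t. dtube n l (x + t *\<^sub>R axis m 1)) has_real_derivative ddtube n l m x) (at 0)"
proof -
  \<comment> \<open>For \<open>l \<noteq> m\<close> the factor \<open>bumplog\<close> in coordinate
    \<open>l\<close> is constant along direction \<open>m\<close>, so the derivative falls on the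
    bump alone.\<close>
  have "(x + t *\<^sub>R axis m 1) $ l = x $ l" for t using assms by (simp add: axis_def)
  then have e: "dtube n l (x + t *\<^sub>R axis m 1) = (\<Sum>i<n. bumplog (real n) (x $ l - c (real i / real n) $ l) *
      bump (real n) (c (real i / real n)) (x + t *\<^sub>R axis m 1))" for t
    unfolding dtube_def by presburger
  show ?thesis
    unfolding e ddtube_def
    by (auto intro!: DERIV_sum DERIV_cmult[OF bump_derivative, THEN DERIV_cong] simp: mult.assoc)
qed

lemma gap_range: "0 \<le> gap n x" "gap n x \<le> 1"
  using tube_nonneg[of n x] thr_pos by (auto simp: gap_def)

lemma cut_range: "0 \<le> cut n x" "cut n x \<le> 1"
  using gap_range[of n x] by (auto simp: cut_def power_le_one)

lemma cut_derivative: "((\<lambda>t. cut n (x + t *\<^sub>R axis l 1)) has_real_derivative dcut n l x) (at 0)"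
proof -
  have "((\<lambda>t. 1 - tube n (x + t *\<^sub>R axis l 1) / thr) has_real_derivative - (dtube n l x / thr)) (at 0)"
    using thr_pos by (auto intro!: derivative_eq_intros tube_derivative)
  moreover have "((\<lambda>s. (max 0 s) ^ 3) has_real_derivative 3 * (max 0 s)\<^sup>2) (at s)" for s :: real
    using max_0_power_derivative[of 1 s] by (simp add: numeral_3_eq_3 numeral_2_eq_2)
  ultimately have "((\<lambda>t. max 0 (1 - tube n (x + t *\<^sub>R axis l 1) / thr) ^ 3) has_real_derivative
     3 * (max 0 (1 - tube n (x + 0 *\<^sub>R axis l 1) / thr))\<^sup>2 * (- (dtube n l x / thr))) (at 0)"
    by (rule DERIV_chain2[rotated])
  then show ?thesis
    unfolding cut_def gap_def dcut_def by simp
qed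

lemma dcut_derivative:
  assumes "l \<noteq> m"
  shows "((\<lambda>t. dcut n l (x + t *\<^sub>R axis m 1)) has_real_derivative ddcut n l m x) (at 0)"
proof -
  have "((\<lambda>t. 1 - tube n (x + t *\<^sub>R axis m 1) / thr) has_real_derivative - (dtube n m x / thr)) (at 0)"
    using thr_pos by (auto intro!: derivative_eq_intros tube_derivative)
  then have "((\<lambda>t. max 0 (1 - tube n (x + t *\<^sub>R axis m 1) / thr) ^ Suc (Suc 0)) has_real_derivative
     real (Suc (Suc 0)) * max 0 (1 - tube n (x + 0 *\<^sub>R axis m 1) / thr) ^ Suc 0 * (- (dtube n m x / thr))) (at 0)"
    by (rule DERIV_chain2[OF max_0_power_derivative])
  then have "((\<lambda>t. (gap n (x + t *\<^sub>R axis m 1))\<^sup>2) has_real_derivative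
     2 * gap n x * (- (dtube n m x / thr))) (at 0)"
    by (simp add: gap_def numeral_2_eq_2)
  then have "((\<lambda>t. - (3 / thr) * (gap n (x + t *\<^sub>R axis m 1))\<^sup>2 * dtube n l (x + t *\<^sub>R axis m 1)) has_real_derivative
     - (3 / thr) * (2 * gap n x * (- (dtube n m x / thr))) * dtube n l (x + 0 *\<^sub>R axis m 1)
     + ddtube n l m x * (- (3 / thr) * (gap n (x + 0 *\<^sub>R axis m 1))\<^sup>2)) (at 0)"
    by (intro DERIV_mult DERIV_cmult dtube_derivative assms)
  then show ?thesis
    unfolding dcut_def ddcut_def
    by (rule DERIV_cong) (simp add: power2_eq_square mult_ac)
qed

lemma ddcut_commute: "ddcut n l m x = ddcut n m l x"
  by (simp add: ddcut_def ddtube_def mult_ac)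

lemma abs_dtube_le: "\<bar>dtube n l x\<bar> \<le> real n * tube n x"
proof -
  have "\<bar>dtube n l x\<bar> \<le> (\<Sum>i<n. real n * bump (real n) (c (real i / real n)) x)"
    unfolding dtube_def
  proof (rule order_trans[OF sum_abs sum_mono])
    fix i
    show "\<bar>bumplog (real n) (x $ l - c (real i / real n) $ l) * bump (real n) (c (real i / real n)) x\<bar>
        \<le> real n * bump (real n) (c (real i / real n)) x"
      using abs_bumplog_le[of "real n"] bump_pos[of "real n" "c (real i / real n)" x]
      by (auto simp: abs_mult intro!: mult_right_mono)
  qed
  then show ?thesis by (simp add: tube_def sum_distrib_left)
qed

lemma abs_dcut_le: "\<bar>dcut n l x\<bar> \<le> 3 / thr * (real n * tube n x)"
proof -
  have "\<bar>dcut n l x\<bar> = 3 / thr * ((gap n x)\<^sup>2 * \<bar>dtube n l x\<bar>)"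
    using thr_pos by (simp add: dcut_def abs_mult)
  also have "\<dots> \<le> 3 / thr * (1 * (real n * tube n x))"
    using thr_pos gap_range[of n x] abs_dtube_le[of n l x]
    by (intro mult_left_mono mult_mono) (auto simp: power_le_one)
  finally show ?thesis by simp
qed

text \<open>Squaring \<open>abs_dcut_le\<close> gives a bound quadratic in \<open>tube\<close>, for
  which no integral estimate is at hand. Where \<open>tube\<close> exceeds \<open>thr\<close> the
  factor \<open>gap\<close> vanishes; elsewhere one factor \<open>tube\<close> is at most
  \<open>thr\<close>. What remains is linear in \<open>tube\<close>, with an integral of order
  one.\<close>

lemma dcut_square_le: "(dcut n l x)\<^sup>2 \<le> 9 / thr * ((real n)\<^sup>2 * tube n x)"
proof (cases "tube n x \<le> thr")
  case True
  have "(dcut n l x)\<^sup>2 \<le> (3 / thr * (real n * tube n x))\<^sup>2"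
    using abs_dcut_le[of n l x] by (metis abs_ge_zero power2_abs power_mono)
  also have "\<dots> = 9 / thr\<^sup>2 * ((real n)\<^sup>2 * tube n x) * tube n x"
    by (simp add: power_mult_distrib power_divide power2_eq_square)
  also have "\<dots> \<le> 9 / thr\<^sup>2 * ((real n)\<^sup>2 * tube n x) * thr"
    using True thr_pos tube_nonneg by (intro mult_left_mono) auto
  also have "\<dots> = 9 / thr * ((real n)\<^sup>2 * tube n x)" using thr_pos by (simp add: power2_eq_square)
  finally show ?thesis .
next
  case False
  then have "gap n x = 0" using thr_pos by (simp add: gap_def)
  then show ?thesis using thr_pos tube_nonneg by (simp add: dcut_def)
qed

lemma tube_integral:
  assumes "n > 0"
  shows "integrable lborel (tube n)" "(LINT x|lborel. tube n x) \<le> pi ^ 3 / (real n)\<^sup>2"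
proof -
  have i: "integrable lborel (bump (real n) d :: real^3 \<Rightarrow> real)"
    "(LINT x|lborel. bump (real n) d x) \<le> (pi / real n) ^ 3" for d :: "real^3"
    using bump_integral[of "real n" d] assms by simp_all
  show "integrable lborel (tube n)"
    unfolding tube_def using i by (intro Bochner_Integration.integrable_sum) auto
  have "(LINT x|lborel. tube n x) = (\<Sum>i<n. LINT x|lborel. bump (real n) (c (real i / real n)) x)"
    unfolding tube_def using i by (intro Bochner_Integration.integral_sum) auto
  also have "\<dots> \<le> (\<Sum>i<n. (pi / real n) ^ 3)" by (intro sum_mono i)
  also have "\<dots> = pi ^ 3 / (real n)\<^sup>2" using assms by (simp add: power_divide power2_eq_square power3_eq_cube)
  finally show "(LINT x|lborel. tube n x) \<le> pi ^ 3 / (real n)\<^sup>2" .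
qed

lemma gap_eq_0_near_curve:
  assumes n: "n > 0" and t: "t \<in> {0..1}" and y: "dist y (c t) < 1 / real n"
  shows "gap n y = 0"
proof -
  obtain i where i: "i < n" "\<bar>t - real i / real n\<bar> \<le> 1 / real n"
  proof (cases "t = 1")
    \<comment> \<open>Rounding down would give the index \<open>n\<close> here, one past the last
      sample; the sample with index \<open>n - 1\<close> is at parameter distance exactly
      \<open>1/n\<close>.\<close>
    case True
    have "1 - real (n - 1) / real n = 1 / real n" using n by (simp add: of_nat_diff field_simps)
    with True n show ?thesis by (intro that[of "n - 1"]) auto
  next
    case False
    have "real n * t < real n" using False t n by simp
    then have f: "nat \<lfloor>real n * t\<rfloor> < n" using t n by (simp add: nat_less_iff floor_less_iff)
    have "0 \<le> real n * t" using t n by simp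
    then have "\<bar>real n * t - real (nat \<lfloor>real n * t\<rfloor>)\<bar> \<le> 1" by (simp add: abs_le_iff) linarith
    then have "\<bar>t - real (nat \<lfloor>real n * t\<rfloor>) / real n\<bar> \<le> 1 / real n"
      using n by (simp add: field_simps abs_le_iff)
    with f show ?thesis by (rule that)
  qed
  let ?p = "c (real i / real n)"
  have "dist (c t) ?p \<le> L * \<bar>t - real i / real n\<bar>"
    using lipschitz_onD[OF lip, of t "real i / real n"] t i n by (simp add: dist_real_def)
  also have "\<dots> \<le> L * (1 / real n)" using i L_nonneg by (intro mult_left_mono) auto
  finally have "dist y ?p \<le> (1 + L) / real n"
    using y dist_triangle[of y ?p "c t"] by (simp add: add_divide_distrib)
  then have d: "real n * norm (y - ?p) \<le> 1 + L" using n by (simp add: dist_norm field_simps)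
  have sq: "(real n * (y $ j - ?p $ j))\<^sup>2 \<le> (1 + L)\<^sup>2" for j
  proof -
    have "\<bar>real n * (y $ j - ?p $ j)\<bar> \<le> real n * norm (y - ?p)"
      using component_le_norm_cart[of "y - ?p" j] by (simp add: abs_mult mult_left_mono)
    also note d
    finally show ?thesis by (metis abs_ge_zero power2_abs power_mono)
  qed
  have "thr = (\<Prod>j\<in>(UNIV::3 set). 1 / (1 + (1 + L)\<^sup>2))" by (simp add: thr_def power_divide)
  also have "\<dots> \<le> bump (real n) ?p y"
    unfolding bump_def
    by (intro prod_mono conjI divide_left_mono add_mono sq mult_pos_pos one_plus_square_pos order_refl)
       (auto simp: less_imp_le[OF one_plus_square_pos])
  also have "\<dots> \<le> tube n y"
    unfolding tube_def using i bump_pos by (intro member_le_sum) (auto intro: less_imp_le)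
  finally show ?thesis using thr_pos by (simp add: gap_def)
qed

lemma cut_near_curve:
  assumes "n > 0" "t \<in> {0..1}" "dist y (c t) < 1 / real n"
  shows "cut n y = 0" "dcut n l y = 0" "ddcut n l m y = 0"
  using gap_eq_0_near_curve[OF assms] by (simp_all add: cut_def dcut_def ddcut_def)

lemma compact_curve: "compact (c ` {0..1})"
  using lip by (intro compact_continuous_image lipschitz_on_continuous_on) auto

text \<open>A sample point at distance at least \<open>d\<close> differs from \<open>x\<close> by at
  least \<open>d / 3\<close> in some coordinate, which makes its \<open>bump\<close> of order
  \<open>n\<^sup>-\<^sup>2\<close>; the sum of the \<open>n\<close> bumps is then of order
  \<open>1/n\<close>.\<close>

lemma cut_tendsto_1:
  assumes "x \<notin> c ` {0..1}"
  shows "(\<lambda>n. cut (Suc n) x) \<longlonglongrightarrow> 1"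
proof -
  obtain d where d: "d > 0" "\<And>y. y \<in> c ` {0..1} \<Longrightarrow> d \<le> dist x y"
    using separate_point_closed[OF compact_imp_closed[OF compact_curve] assms] by blast
  have b: "bump (real (Suc n)) (c (real i / real (Suc n))) x \<le> 9 / ((real (Suc n))\<^sup>2 * d\<^sup>2)" if "i < Suc n" for i n
  proof -
    let ?p = "c (real i / real (Suc n))" and ?n = "real (Suc n)"
    have "d \<le> dist x ?p" using that by (intro d) auto
    also have "\<dots> \<le> (\<Sum>j\<in>UNIV. \<bar>(x - ?p) $ j\<bar>)" unfolding dist_norm by (rule norm_le_l1_cart)
    finally have "d \<le> (\<Sum>j\<in>UNIV. \<bar>x $ j - ?p $ j\<bar>)" by simp
    have "\<exists>j. d / 3 \<le> \<bar>x $ j - ?p $ j\<bar>"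
    proof (rule ccontr)
      assume "\<nexists>j. d / 3 \<le> \<bar>x $ j - ?p $ j\<bar>"
      then have "(\<Sum>j\<in>UNIV. \<bar>x $ j - ?p $ j\<bar>) < (\<Sum>j\<in>(UNIV::3 set). d / 3)"
        by (intro sum_strict_mono) (auto simp: not_le)
      with \<open>d \<le> (\<Sum>j\<in>UNIV. \<bar>x $ j - ?p $ j\<bar>)\<close> show False by simp
    qed
    then obtain j where "d / 3 \<le> \<bar>x $ j - ?p $ j\<bar>" by blast
    then have "(d / 3)\<^sup>2 \<le> (x $ j - ?p $ j)\<^sup>2" using d(1)
      by (metis abs_ge_zero divide_nonneg_pos less_imp_le power2_abs power_mono zero_less_numeral)
    then have "?n\<^sup>2 * (d / 3)\<^sup>2 \<le> 1 + (?n * (x $ j - ?p $ j))\<^sup>2"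
      by (simp add: power_mult_distrib add_increasing mult_left_mono)
    then have "1 / (1 + (?n * (x $ j - ?p $ j))\<^sup>2) \<le> 1 / (?n\<^sup>2 * (d / 3)\<^sup>2)"
      using d(1) by (intro divide_left_mono mult_pos_pos one_plus_square_pos) auto
    then show ?thesis using bump_le[of ?n ?p x j] by (simp add: power_divide mult.commute)
  qed
  have t: "tube (Suc n) x \<le> 9 / d\<^sup>2 * inverse (real (Suc n))" for n
  proof -
    have "tube (Suc n) x \<le> (\<Sum>i<Suc n. 9 / ((real (Suc n))\<^sup>2 * d\<^sup>2))"
      unfolding tube_def by (intro sum_mono b) auto
    also have "\<dots> = 9 / d\<^sup>2 * inverse (real (Suc n))" by (simp add: power2_eq_square divide_simps del: of_nat_Suc)
    finally show ?thesis .
  qed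
  have "(\<lambda>n. tube (Suc n) x) \<longlonglongrightarrow> 0"
  proof (rule tendsto_sandwich[OF _ _ tendsto_const])
    show "(\<lambda>n. 9 / d\<^sup>2 * inverse (real (Suc n))) \<longlonglongrightarrow> 0"
      using tendsto_mult[OF tendsto_const LIMSEQ_inverse_real_of_nat, of "9 / d\<^sup>2"] by simp
  qed (use t tube_nonneg in auto)
  then have "(\<lambda>n. max 0 (1 - tube (Suc n) x / thr) ^ 3) \<longlonglongrightarrow> max 0 (1 - 0 / thr) ^ 3"
    using thr_pos by (intro tendsto_intros) auto
  then show ?thesis by (simp add: cut_def gap_def)
qed

text \<open>The absolute values inside the integral make this usable both for signed cutoff terms
  and for remainders that are only bounded by an integral of absolute values.\<close>

lemma dcut_weakly_null:
  assumes S: "S \<in> sets borel" and f: "continuous_on S f" "set_integrable lborel S (\<lambda>x. (f x)\<^sup>2)"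
  shows "set_integrable lborel S (\<lambda>x. \<bar>dcut (Suc n) l x\<bar> * \<bar>f x\<bar>)"
    "(\<lambda>n. LINT x:S|lborel. \<bar>dcut (Suc n) l x\<bar> * \<bar>f x\<bar>) \<longlonglongrightarrow> 0"
proof -
  have cd: "continuous_on UNIV (\<lambda>x. \<bar>dcut (Suc n) l x\<bar>)" for n
    by (intro continuous_intros continuous_dcut)
  have m: "(\<lambda>x. \<bar>dcut (Suc n) l x\<bar>) \<in> borel_measurable lborel" "(\<lambda>x. \<bar>dcut (Suc n) l x\<bar>\<^sup>2) \<in> borel_measurable lborel" for n
    using cd[of n] by (auto intro!: borel_measurable_continuous_onI continuous_intros continuous_dcut)
  have t: "integrable lborel (tube (Suc n))" "(LINT x|lborel. tube (Suc n) x) \<le> pi ^ 3 / (real (Suc n))\<^sup>2" for n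
    using tube_integral[of "Suc n"] by auto
  have i1: "integrable lborel (\<lambda>x. \<bar>dcut (Suc n) l x\<bar>)" for n
    by (rule Bochner_Integration.integrable_bound[of lborel "\<lambda>x. 3 / thr * (real (Suc n) * tube (Suc n) x)"])
       (use order_trans[OF abs_dcut_le abs_ge_self, of "Suc n" l] m t in \<open>auto simp del: of_nat_Suc\<close>)
  have i2: "integrable lborel (\<lambda>x. \<bar>dcut (Suc n) l x\<bar>\<^sup>2)" for n
    by (rule Bochner_Integration.integrable_bound[of lborel "\<lambda>x. 9 / thr * ((real (Suc n))\<^sup>2 * tube (Suc n) x)"])
       (use order_trans[OF dcut_square_le abs_ge_self, of "Suc n" l] m t in \<open>auto simp del: of_nat_Suc\<close>)
  have b1: "(LINT x|lborel. \<bar>dcut (Suc n) l x\<bar>) \<le> 3 * pi ^ 3 / thr * inverse (real (Suc n))" for n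
  proof -
    have "(LINT x|lborel. \<bar>dcut (Suc n) l x\<bar>) \<le> (LINT x|lborel. 3 / thr * (real (Suc n) * tube (Suc n) x))"
      using abs_dcut_le[of "Suc n" l] t i1 by (intro integral_mono) auto
    also have "\<dots> = 3 / thr * (real (Suc n) * (LINT x|lborel. tube (Suc n) x))" by simp
    also have "\<dots> \<le> 3 / thr * (real (Suc n) * (pi ^ 3 / (real (Suc n))\<^sup>2))"
      using t(2)[of n] thr_pos by (intro mult_left_mono) auto
    also have "\<dots> = 3 * pi ^ 3 / thr * inverse (real (Suc n))" by (simp add: power2_eq_square divide_simps del: of_nat_Suc)
    finally show ?thesis .
  qed
  have b2: "(LINT x|lborel. \<bar>dcut (Suc n) l x\<bar>\<^sup>2) \<le> 9 / thr * pi ^ 3" for n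
  proof -
    have "(LINT x|lborel. \<bar>dcut (Suc n) l x\<bar>\<^sup>2) \<le> (LINT x|lborel. 9 / thr * ((real (Suc n))\<^sup>2 * tube (Suc n) x))"
      using dcut_square_le[of "Suc n" l] t i2 by (intro integral_mono) auto
    also have "\<dots> = 9 / thr * ((real (Suc n))\<^sup>2 * (LINT x|lborel. tube (Suc n) x))" by simp
    also have "\<dots> \<le> 9 / thr * ((real (Suc n))\<^sup>2 * (pi ^ 3 / (real (Suc n))\<^sup>2))"
      using t(2)[of n] thr_pos by (intro mult_left_mono) auto
    also have "\<dots> = 9 / thr * pi ^ 3" by simp
    finally show ?thesis .
  qed
  have g0: "(\<lambda>n. LINT x|lborel. \<bar>dcut (Suc n) l x\<bar>) \<longlonglongrightarrow> 0"
  proof (rule tendsto_sandwich[OF _ _ tendsto_const])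
    show "(\<lambda>n. 3 * pi ^ 3 / thr * inverse (real (Suc n))) \<longlonglongrightarrow> 0"
      using tendsto_mult[OF tendsto_const LIMSEQ_inverse_real_of_nat, of "3 * pi ^ 3 / thr"] by simp
  qed (use b1 in auto)
  note * = tendsto_integral_mult_weakly_null[where g = "\<lambda>n x. \<bar>dcut (Suc n) l x\<bar>", OF S
      set_measurable_continuous[OF f(1) S] f(2) cd abs_ge_zero i1 i2 b2 g0]
  from *(1)[of n] *(2) show "set_integrable lborel S (\<lambda>x. \<bar>dcut (Suc n) l x\<bar> * \<bar>f x\<bar>)"
    "(\<lambda>n. LINT x:S|lborel. \<bar>dcut (Suc n) l x\<bar> * \<bar>f x\<bar>) \<longlonglongrightarrow> 0" .
qed

end

text \<open>Cauchy-Schwarz against the constant 1, read off from the nonnegativity of the integral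
  of \<open>(h t - m)\<^sup>2\<close> with \<open>m\<close> the mean of \<open>h\<close>.\<close>

lemma square_integral_le:
  fixes h :: "real \<Rightarrow> real"
  assumes "a \<le> b" "continuous_on {a..b} h"
  shows "(integral {a..b} h)\<^sup>2 \<le> (b - a) * integral {a..b} (\<lambda>t. (h t)\<^sup>2)"
proof (cases "a = b")
  case False
  then have ab: "a < b" using assms by simp
  let ?m = "integral {a..b} h / (b - a)"
  have i: "h integrable_on {a..b}" "(\<lambda>t. (h t)\<^sup>2) integrable_on {a..b}"
    using assms by (auto intro!: integrable_continuous_interval continuous_intros)
  have "0 \<le> integral {a..b} (\<lambda>t. (h t - ?m)\<^sup>2)" by (intro integral_nonneg integrable_continuous_interval continuous_intros assms) auto
  also have "(\<lambda>t. (h t - ?m)\<^sup>2) = (\<lambda>t. (h t)\<^sup>2 + (?m\<^sup>2 - 2 * ?m * h t))"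
    by (simp add: power2_diff fun_eq_iff)
  also have "integral {a..b} \<dots> = integral {a..b} (\<lambda>t. (h t)\<^sup>2) + ((b - a) *\<^sub>R ?m\<^sup>2 - 2 * ?m * integral {a..b} h)"
    using i ab has_integral_const_real[of "?m\<^sup>2" a b]
    by (intro integral_unique has_integral_add has_integral_diff has_integral_mult_right integrable_integral) auto
  also have "(b - a) *\<^sub>R ?m\<^sup>2 - 2 * ?m * integral {a..b} h = - (integral {a..b} h)\<^sup>2 / (b - a)"
  proof -
    have "d *\<^sub>R (I / d)\<^sup>2 - 2 * (I / d) * I = - I\<^sup>2 / d" if "d \<noteq> 0" for d I :: real
      using that by (simp add: power2_eq_square field_simps)
    then show ?thesis using ab by simp
  qed
  finally show ?thesis using ab by (simp add: field_simps)
qed simp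

text \<open>Each vertical line is integrated from a far away point, where \<open>f\<close> is bounded; nothing is assumed
  about \<open>f\<close> near the boundary plane.\<close>

lemma square_integrable_on_bounded:
  fixes f f' :: "real^3 \<Rightarrow> real"
  assumes der: "\<And>x. x \<in> lower_half \<Longrightarrow> ((\<lambda>t. f (x + t *\<^sub>R axis 3 1)) has_real_derivative f' x) (at 0)"
    and cf: "continuous_on lower_half f" and cf': "continuous_on lower_half f'"
    and int: "set_integrable lborel lower_half (\<lambda>x. (f' x)\<^sup>2)"
    and bd: "\<And>x. x \<in> lower_half \<Longrightarrow> norm x \<ge> R0 \<Longrightarrow> \<bar>f x\<bar> \<le> C"
  shows "set_integrable lborel (lower_half \<inter> cball 0 R) (\<lambda>x. (f x)\<^sup>2)"
proof -
  \<comment> \<open>Lines start at height \<open>- S\<close>, below the ball of radius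
    \<open>R\<close> and outside the ball of radius \<open>R0\<close>, where
    \<open>\<bar>f x\<bar>\<close> is at most \<open>C\<close>.\<close>
  define S where "S = max (max R R0) 0 + 1"
  have S: "S > R" "S > R0" "S > 0" by (auto simp: S_def)
  let ?I = "\<lambda>x. \<integral>\<^sup>+t. ennreal (indicator lower_half (halfpt (x, t)) * (f' (halfpt (x, t)))\<^sup>2) \<partial>lborel"
  have [measurable]: "lower_half \<in> sets borel" by (rule lower_half_sets)
  have mf': "(\<lambda>x. indicator lower_half x * (f' x)\<^sup>2) \<in> borel_measurable borel"
    using borel_measurable_integrable[OF int[unfolded set_integrable_def]] by simp
  have mf: "(\<lambda>x. indicator (lower_half \<inter> cball 0 R) x * (f x)\<^sup>2) \<in> borel_measurable borel"
  proof -
    have "continuous_on (lower_half \<inter> cball 0 R) (\<lambda>x. (f x)\<^sup>2)"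
      by (intro continuous_intros continuous_on_subset[OF cf]) auto
    then show ?thesis using borel_measurable_continuous_on_indicator[of "lower_half \<inter> cball 0 R" "\<lambda>x. (f x)\<^sup>2"] by simp
  qed
  \<comment> \<open>The value on a vertical line is its value at the starting point plus an integral
    of \<open>f'\<close>. Cauchy-Schwarz bounds the latter by the energy of the whole line,
    uniformly in the height \<open>s\<close>, so the bound can be integrated over heights up to the
    boundary.\<close>
  have line: "ennreal ((f (halfpt (x, s)))\<^sup>2) \<le> ennreal (2 * C\<^sup>2) + ennreal (2 * S) * ?I x" if s: "- S < s" "s < 0" for x s
  proof -
    let ?h = "\<lambda>t. f' (halfpt (x, t))"
    have derx: "((\<lambda>s. f (halfpt (x, s))) has_real_derivative ?h t) (at t)" if "t < 0" for t
    proof -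
      have "halfpt (x, t) \<in> lower_half" using that by (simp add: lower_half_def)
      from der[OF this] show ?thesis
        using DERIV_shift[of "\<lambda>t. f (halfpt (x, t))" _ 0 t]
        by (simp add: halfpt_def scaleR_add_left algebra_simps)
    qed
    have ch: "continuous_on {- S..s} ?h"
      by (rule continuous_on_compose2[OF cf' continuous_on_compose2[OF continuous_halfpt]])
         (use s in \<open>auto intro!: continuous_intros simp: lower_half_def\<close>)
    have "(?h has_integral (f (halfpt (x, s)) - f (halfpt (x, - S)))) {- S..s}"
      using s derx by (intro fundamental_theorem_of_calculus)
        (auto simp: has_real_derivative_iff_has_vector_derivative intro: has_vector_derivative_at_within)
    then have ftc: "f (halfpt (x, s)) = f (halfpt (x, - S)) + integral {- S..s} ?h" by (simp add: integral_unique)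
    have "\<bar>f (halfpt (x, - S))\<bar> \<le> C"
      by (rule bd) (use S norm_le_halfpt(2)[of "- S" x] in \<open>auto simp: lower_half_def\<close>)
    then have "(f (halfpt (x, - S)))\<^sup>2 \<le> C\<^sup>2" by (metis abs_ge_zero power2_abs power_mono)
    moreover have "(integral {- S..s} ?h)\<^sup>2 \<le> S * integral {- S..s} (\<lambda>t. (?h t)\<^sup>2)"
    proof (rule order_trans[OF square_integral_le[OF _ ch]])
      show "(s - - S) * integral {- S..s} (\<lambda>t. (?h t)\<^sup>2) \<le> S * integral {- S..s} (\<lambda>t. (?h t)\<^sup>2)"
        using s by (intro mult_right_mono integral_nonneg integrable_continuous_interval continuous_intros ch) auto
    qed (use s in auto)
    moreover have "(f (halfpt (x, s)))\<^sup>2 \<le> 2 * (f (halfpt (x, - S)))\<^sup>2 + 2 * (integral {- S..s} ?h)\<^sup>2"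
      using zero_le_power2[of "f (halfpt (x, - S)) - integral {- S..s} ?h"]
      unfolding ftc by (simp add: power2_sum power2_diff)
    ultimately have 1: "(f (halfpt (x, s)))\<^sup>2 \<le> 2 * C\<^sup>2 + 2 * S * integral {- S..s} (\<lambda>t. (?h t)\<^sup>2)" by simp
    have ci: "integrable lborel (\<lambda>t. indicator {- S..s} t * (?h t)\<^sup>2)"
      using borel_integrable_compact[of "{- S..s}" "\<lambda>t. (?h t)\<^sup>2"] continuous_on_power[OF ch, of 2] by simp
    have "integral {- S..s} (\<lambda>t. (?h t)\<^sup>2) = (LINT t|lborel. indicator {- S..s} t * (?h t)\<^sup>2)"
      using set_borel_integral_eq_integral(2)[of "{- S..s}" "\<lambda>t. (?h t)\<^sup>2"] ci
      by (simp add: set_integrable_def set_lebesgue_integral_def)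
    then have "ennreal (integral {- S..s} (\<lambda>t. (?h t)\<^sup>2)) = (\<integral>\<^sup>+t. ennreal (indicator {- S..s} t * (?h t)\<^sup>2) \<partial>lborel)"
      using nn_integral_eq_integral[OF ci] by simp
    also have "\<dots> \<le> ?I x"
      using s by (intro nn_integral_mono ennreal_leI) (auto simp: indicator_def lower_half_def)
    finally have 2: "ennreal (integral {- S..s} (\<lambda>t. (?h t)\<^sup>2)) \<le> ?I x" .
    have i0: "0 \<le> integral {- S..s} (\<lambda>t. (?h t)\<^sup>2)"
      by (intro integral_nonneg integrable_continuous_interval continuous_intros ch) auto
    have "ennreal ((f (halfpt (x, s)))\<^sup>2) \<le> ennreal (2 * C\<^sup>2 + 2 * S * integral {- S..s} (\<lambda>t. (?h t)\<^sup>2))"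
      using 1 by (rule ennreal_leI)
    also have "\<dots> = ennreal (2 * C\<^sup>2) + ennreal (2 * S) * ennreal (integral {- S..s} (\<lambda>t. (?h t)\<^sup>2))"
      using S i0 by (subst ennreal_plus) (auto simp: ennreal_mult)
    also have "\<dots> \<le> ennreal (2 * C\<^sup>2) + ennreal (2 * S) * ?I x"
      by (intro add_left_mono mult_left_mono 2) auto
    finally show ?thesis .
  qed
  have "(\<integral>\<^sup>+x. ennreal (indicator (lower_half \<inter> cball 0 R) x * (f x)\<^sup>2) \<partial>lborel)
      = (\<integral>\<^sup>+x. \<integral>\<^sup>+s. ennreal (indicator (lower_half \<inter> cball 0 R) (halfpt (x, s)) * (f (halfpt (x, s)))\<^sup>2) \<partial>lborel \<partial>lborel)"
    using mf by (subst nn_integral_halfpt) auto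
  also have "\<dots> \<le> (\<integral>\<^sup>+x. \<integral>\<^sup>+s. (ennreal (2 * C\<^sup>2) * indicator (cball 0 R) x + ennreal (2 * S) * ?I x) * indicator {- S..0} s \<partial>lborel \<partial>lborel)"
  proof (intro nn_integral_mono)
    fix x s
    show "ennreal (indicator (lower_half \<inter> cball 0 R) (halfpt (x, s)) * (f (halfpt (x, s)))\<^sup>2)
      \<le> (ennreal (2 * C\<^sup>2) * indicator (cball 0 R) x + ennreal (2 * S) * ?I x) * indicator {- S..0} s"
    proof (cases "halfpt (x, s) \<in> lower_half \<inter> cball 0 R")
      case True
      then have "s < 0" "norm x \<le> R" "\<bar>s\<bar> \<le> R"
        using norm_le_halfpt(1)[of x s] norm_le_halfpt(2)[of s x] by (auto simp: lower_half_def)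
      then show ?thesis using line[of s x] S True by simp
    qed simp
  qed
  also have "\<dots> = (\<integral>\<^sup>+x. (ennreal (2 * C\<^sup>2) * indicator (cball 0 R) x + ennreal (2 * S) * ?I x) * ennreal S \<partial>lborel)"
    using S by (intro nn_integral_cong) (simp add: nn_integral_cmult_indicator)
  also have "\<dots> < \<infinity>"
  proof -
    have mI: "?I \<in> borel_measurable borel"
    proof -
      have "(\<lambda>z. ennreal (indicator lower_half (halfpt z) * (f' (halfpt z))\<^sup>2)) \<in> borel_measurable (borel \<Otimes>\<^sub>M lborel)"
        using measurable_compose[OF measurable_halfpt' mf']
        by (subst measurable_cong_sets[OF sets_pair_measure_cong[OF refl sets_lborel] refl]) simp
      then show ?thesis
        using lborel.borel_measurable_nn_integral_fst[of "\<lambda>z. ennreal (indicator lower_half (halfpt z) * (f' (halfpt z))\<^sup>2)" borel]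
        by simp
    qed
    have "(\<integral>\<^sup>+x. (ennreal (2 * C\<^sup>2) * indicator (cball 0 R) x + ennreal (2 * S) * ?I x) * ennreal S \<partial>lborel)
        = (ennreal (2 * C\<^sup>2) * emeasure lborel (cball (0::real^2) R) + ennreal (2 * S) * (\<integral>\<^sup>+x. ?I x \<partial>lborel)) * ennreal S"
    proof -
      have "(\<integral>\<^sup>+x. (ennreal (2 * C\<^sup>2) * indicator (cball 0 R) x + ennreal (2 * S) * I x) * ennreal S \<partial>lborel)
        = (ennreal (2 * C\<^sup>2) * emeasure lborel (cball (0::real^2) R) + ennreal (2 * S) * (\<integral>\<^sup>+x. I x \<partial>lborel)) * ennreal S"
        if I: "I \<in> borel_measurable lborel" for I :: "real^2 \<Rightarrow> ennreal"
      proof -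
        have 1: "(\<lambda>x. ennreal (2 * C\<^sup>2) * indicator (cball (0::real^2) R) x) \<in> borel_measurable lborel"
          by (intro borel_measurable_times_ennreal borel_measurable_const borel_measurable_indicator) auto
        have 2: "(\<lambda>x. ennreal (2 * S) * I x) \<in> borel_measurable lborel"
          using I by (intro borel_measurable_times_ennreal borel_measurable_const)
        have "(\<integral>\<^sup>+x. ennreal (2 * C\<^sup>2) * indicator (cball (0::real^2) R) x \<partial>lborel) = ennreal (2 * C\<^sup>2) * emeasure lborel (cball (0::real^2) R)"
          by (rule nn_integral_cmult_indicator) auto
        then show ?thesis
          unfolding nn_integral_multc[OF borel_measurable_add[OF 1 2]] nn_integral_add[OF 1 2] nn_integral_cmult[OF I] by simp
      qed
      from this[of ?I] mI show ?thesis by simp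
    qed
    also have "(\<integral>\<^sup>+x. ?I x \<partial>lborel) = (\<integral>\<^sup>+x. ennreal (indicator lower_half x * (f' x)\<^sup>2) \<partial>lborel)"
      using nn_integral_halfpt[of "\<lambda>x. ennreal (indicator lower_half x * (f' x)\<^sup>2)"] mf' by simp
    also have "(ennreal (2 * C\<^sup>2) * emeasure lborel (cball (0::real^2) R) + ennreal (2 * S) * \<dots>) * ennreal S < \<infinity>"
    proof -
      have "(\<integral>\<^sup>+x. ennreal (indicator lower_half x * (f' x)\<^sup>2) \<partial>lborel) < \<infinity>"
        using int integrable_iff_bounded[of lborel "\<lambda>x. indicator lower_half x *\<^sub>R (f' x)\<^sup>2"] by (simp add: set_integrable_def abs_mult)
      moreover have "emeasure lborel (cball (0::real^2) R) < \<infinity>" by (rule emeasure_bounded_finite) auto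
      ultimately show ?thesis by (simp add: ennreal_mult_less_top)
    qed
    finally show ?thesis .
  qed
  finally show ?thesis
    using mf unfolding set_integrable_def integrable_iff_bounded by (simp add: abs_mult)
qed

section \<open>Cutoff at infinity and truncation\<close>

text \<open>Squaring the positive part makes the function continuously differentiable at the edge of
  its support, and the use of \<open>(norm x)\<^sup>2\<close> makes it so at the origin.\<close>

definition chi :: "real \<Rightarrow> real^'n \<Rightarrow> real" where
  "chi R x = (max 0 (1 - (norm x)\<^sup>2 / R\<^sup>2))\<^sup>2"

definition dchi :: "real \<Rightarrow> 'n \<Rightarrow> real^'n \<Rightarrow> real" where
  "dchi R j x = - (4 * x $ j / R\<^sup>2) * max 0 (1 - (norm x)\<^sup>2 / R\<^sup>2)"

lemma continuous_chi: "continuous_on A (chi R)"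
  unfolding chi_def by (cases "R = 0") (auto intro!: continuous_intros)

lemma continuous_dchi: "continuous_on A (dchi R j)"
  unfolding dchi_def by (cases "R = 0") (auto intro!: continuous_intros)

lemma chi_range: "0 \<le> chi R x" "chi R x \<le> 1"
  by (auto simp: chi_def intro!: power_le_one)

lemma chi_dchi_eq_0:
  assumes "R > 0" "norm x \<ge> R"
  shows chi_eq_0: "chi R x = 0" and dchi_eq_0: "dchi R j x = 0"
proof -
  have "R\<^sup>2 \<le> (norm x)\<^sup>2" using assms by (intro power_mono) auto
  then have "max 0 (1 - (norm x)\<^sup>2 / R\<^sup>2) = 0" using assms(1) by simp
  then show "chi R x = 0" "dchi R j x = 0" by (simp_all add: chi_def dchi_def)
qed

lemma abs_chi_le:
  assumes "R > 0"
  shows "\<bar>chi R x\<bar> \<le> indicator (cball 0 R) x"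
  using chi_range[of R x] chi_eq_0[OF assms, of x] by (cases "norm x \<le> R") auto

lemma abs_dchi_le: "\<bar>dchi R j x\<bar> \<le> 4 * norm x / R\<^sup>2"
proof -
  have "\<bar>dchi R j x\<bar> = 4 * \<bar>x $ j\<bar> / R\<^sup>2 * max 0 (1 - (norm x)\<^sup>2 / R\<^sup>2)"
    by (simp add: dchi_def abs_mult)
  also have "\<dots> \<le> 4 * norm x / R\<^sup>2 * 1"
    using component_le_norm_cart[of x j] by (intro mult_mono divide_right_mono) auto
  finally show ?thesis by simp
qed

lemma abs_dchi_le_indicator:
  assumes "R > 0"
  shows "\<bar>dchi R j x\<bar> \<le> 4 / R * indicator (cball 0 R) x"
proof (cases "norm x < R")
  case True
  have "4 * norm x / R\<^sup>2 \<le> 4 * R / R\<^sup>2" using True by (intro divide_right_mono) auto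
  also have "\<dots> = 4 / R" using assms by (simp add: power2_eq_square)
  finally show ?thesis using abs_dchi_le[of R j x] True by simp
next
  case False
  then show ?thesis using dchi_eq_0[of R x j] assms by simp
qed

lemma norm_square_line:
  fixes x :: "real^'n"
  shows "(norm (x + t *\<^sub>R axis j 1))\<^sup>2 = (norm x)\<^sup>2 + 2 * t * x $ j + t\<^sup>2"
  by (simp only: power2_norm_eq_inner)
     (simp add: inner_add_left inner_add_right inner_axis inner_axis' power2_eq_square algebra_simps)

lemma chi_derivative: "((\<lambda>t. chi R (x + t *\<^sub>R axis j 1)) has_real_derivative dchi R j x) (at 0)"
proof (cases "R = 0")
  case False
  have "((\<lambda>t. 1 - (norm (x + t *\<^sub>R axis j 1))\<^sup>2 / R\<^sup>2) has_real_derivative - (2 * x $ j / R\<^sup>2)) (at 0)"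
    unfolding norm_square_line using False
    by (auto intro!: derivative_eq_intros simp: power2_eq_square power4_eq_xxxx)
  moreover have "((\<lambda>s. (max 0 s)\<^sup>2) has_real_derivative 2 * max 0 s) (at s)" for s :: real
    using max_0_power_derivative[of 0 s] by (simp add: numeral_2_eq_2)
  ultimately have "((\<lambda>t. (max 0 (1 - (norm (x + t *\<^sub>R axis j 1))\<^sup>2 / R\<^sup>2))\<^sup>2) has_real_derivative
     2 * max 0 (1 - (norm (x + 0 *\<^sub>R axis j 1))\<^sup>2 / R\<^sup>2) * - (2 * x $ j / R\<^sup>2)) (at 0)"
    by (rule DERIV_chain2[rotated])
  then show ?thesis unfolding chi_def dchi_def by (rule DERIV_cong) simp
qed (simp add: chi_def dchi_def)

lemma chi_tendsto_1: "(\<lambda>n. chi (real (Suc n)) x) \<longlonglongrightarrow> 1"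
proof -
  have "(\<lambda>n. (max 0 (1 - (norm x)\<^sup>2 * (inverse (real (Suc n)))\<^sup>2))\<^sup>2) \<longlonglongrightarrow> (max 0 (1 - (norm x)\<^sup>2 * 0\<^sup>2))\<^sup>2"
    by (intro tendsto_intros LIMSEQ_inverse_real_of_nat)
  then show ?thesis by (simp add: chi_def divide_inverse power_inverse del: of_nat_Suc)
qed

lemma dchi_tendsto_0: "(\<lambda>n. dchi (real (Suc n)) j x) \<longlonglongrightarrow> 0"
proof (rule Lim_null_comparison)
  have "(\<lambda>n. 4 * norm x * (inverse (real (Suc n)))\<^sup>2) \<longlonglongrightarrow> 4 * norm x * 0\<^sup>2"
    by (intro tendsto_intros LIMSEQ_inverse_real_of_nat)
  then show "(\<lambda>n. 4 * norm x * (inverse (real (Suc n)))\<^sup>2) \<longlonglongrightarrow> 0" by simp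
  show "\<forall>\<^sub>F n in sequentially. norm (dchi (real (Suc n)) j x) \<le> 4 * norm x * (inverse (real (Suc n)))\<^sup>2"
    using abs_dchi_le[of "real (Suc n)" j x for n]
    by (simp add: divide_inverse power_inverse del: of_nat_Suc)
qed

text \<open>A smooth bounded truncation; a solution need not be bounded near the curve.\<close>

definition trunc :: "real \<Rightarrow> real \<Rightarrow> real" where "trunc m s = m * arctan (s / m)"
definition dtrunc :: "real \<Rightarrow> real \<Rightarrow> real" where "dtrunc m s = 1 / (1 + (s / m)\<^sup>2)"

lemma trunc_derivative: "m > 0 \<Longrightarrow> (trunc m has_real_derivative dtrunc m s) (at s)"
  unfolding trunc_def dtrunc_def
  by (auto intro!: derivative_eq_intros simp: inverse_eq_divide)

lemma abs_trunc_le: "m > 0 \<Longrightarrow> \<bar>trunc m s\<bar> \<le> m * pi"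
  using arctan_bounded[of "s / m"] pi_gt_zero by (auto simp: trunc_def abs_mult intro!: mult_left_mono)

lemma dtrunc_range: "0 \<le> dtrunc m s" "dtrunc m s \<le> 1"
  using one_plus_square_pos[of "s / m"] by (auto simp: dtrunc_def divide_le_eq)

lemma continuous_trunc: "m > 0 \<Longrightarrow> continuous_on A (trunc m)"
  by (intro continuous_at_imp_continuous_on ballI DERIV_isCont[OF trunc_derivative])

lemma continuous_dtrunc: "continuous_on A (dtrunc m)"
proof -
  have "1 + (s / m)\<^sup>2 \<noteq> 0" for s using one_plus_square_pos[of "s / m"] by linarith
  then show ?thesis
    unfolding dtrunc_def by (cases "m = 0") (auto intro!: continuous_intros)
qed

lemma trunc_0 [simp]: "trunc m 0 = 0" by (simp add: trunc_def)

text \<open>The slope \<open>dtrunc\<close> is at most 1 and \<open>trunc m 0 = 0\<close>. Truncated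
  products are thus dominated by untruncated ones, whatever the truncation level.\<close>

lemma abs_trunc_le_abs:
  assumes "m > 0"
  shows "\<bar>trunc m s\<bar> \<le> \<bar>s\<bar>"
proof -
  have "\<bar>trunc m s - trunc m 0\<bar> \<le> 1 * \<bar>s - 0\<bar>"
    by (rule field_differentiable_bound[of UNIV "trunc m" "dtrunc m" 1 s 0, simplified real_norm_def])
       (use trunc_derivative[OF assms] dtrunc_range[of m] in \<open>auto\<close>)
  then show ?thesis by simp
qed

lemma trunc_tendsto: "(\<lambda>m. trunc (real (Suc m)) s) \<longlonglongrightarrow> s"
proof (cases "s = 0")
  case False
  have "((\<lambda>h. arctan h / h) \<longlongrightarrow> 1) (at 0)"
    using DERIV_arctan[of 0] by (simp add: DERIV_def)
  moreover have "filterlim (\<lambda>m. s * inverse (real (Suc m))) (at 0) sequentially"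
    using tendsto_mult[OF tendsto_const LIMSEQ_inverse_real_of_nat, of s] False
    by (auto simp: filterlim_at intro!: always_eventually)
  ultimately have "(\<lambda>m. arctan (s * inverse (real (Suc m))) / (s * inverse (real (Suc m)))) \<longlonglongrightarrow> 1"
    by (rule filterlim_compose)
  then have "(\<lambda>m. s * (arctan (s * inverse (real (Suc m))) / (s * inverse (real (Suc m))))) \<longlonglongrightarrow> s * 1"
    by (intro tendsto_intros)
  moreover have "s * (arctan (s * inverse (real (Suc m))) / (s * inverse (real (Suc m)))) = trunc (real (Suc m)) s" for m
    using False by (simp add: trunc_def divide_inverse del: of_nat_Suc)
  ultimately show ?thesis by simp
qed simp

lemma dtrunc_tendsto: "(\<lambda>m. dtrunc (real (Suc m)) s) \<longlonglongrightarrow> 1"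
proof -
  have "(\<lambda>m. 1 / (1 + (s * inverse (real (Suc m)))\<^sup>2)) \<longlonglongrightarrow> 1 / (1 + (s * 0)\<^sup>2)"
    by (intro tendsto_intros LIMSEQ_inverse_real_of_nat) auto
  then show ?thesis by (simp add: dtrunc_def divide_inverse del: of_nat_Suc)
qed

text \<open>The factor \<open>f\<close> need not have any limit at \<open>G\<close>: the product is
  zero on \<open>S \<inter> U\<close> and continuous on \<open>S - G\<close>, and these two
  relatively open pieces cover \<open>S\<close>.\<close>

lemma continuous_on_mult_vanishing:
  fixes z f :: "'a::topological_space \<Rightarrow> real"
  assumes f: "continuous_on (S - G) f" and z: "continuous_on UNIV z"
    and U: "open U" "G \<subseteq> U" "closed G" "\<And>x. x \<in> U \<Longrightarrow> z x = 0"
  shows "continuous_on S (\<lambda>x. z x * f x)"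
proof -
  have eq: "S = (S \<inter> U) \<union> (S \<inter> - G)" using U by auto
  have "continuous_on ((S \<inter> U) \<union> (S \<inter> - G)) (\<lambda>x. z x * f x)"
  proof (rule continuous_on_Un_local_open)
    show "openin (top_of_set ((S \<inter> U) \<union> (S \<inter> - G))) (S \<inter> U)"
      "openin (top_of_set ((S \<inter> U) \<union> (S \<inter> - G))) (S \<inter> - G)"
      unfolding eq[symmetric] using U by (auto intro!: openin_open_Int)
    have "continuous_on (S \<inter> U) (\<lambda>x. 0 :: real)" by simp
    then show "continuous_on (S \<inter> U) (\<lambda>x. z x * f x)"
      by (rule continuous_on_cong[THEN iffD1, rotated 2]) (auto simp: U)
    show "continuous_on (S \<inter> - G) (\<lambda>x. z x * f x)"
      using f by (intro continuous_on_mult continuous_on_subset[OF z]) (auto simp: Diff_eq)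
  qed
  then show ?thesis using eq by simp
qed

text \<open>Turns a planar coordinate index into the spatial index of the same direction, so that
  tangential components can be indexed over type \<open>2\<close>.\<close>

definition up :: "2 \<Rightarrow> 3" where "up k = (if k = 1 then 1 else 2)"

lemma up_simps [simp]: "up 1 = 1" "up 2 = 2" by (simp_all add: up_def)

lemma up_neq_3: "up k \<noteq> 3" "3 \<noteq> up k"
  using exhaust_2[of k] by auto

lemma cases_up:
  obtains k where "i = up k" | "i = 3"
  using exhaust_3[of i] by (metis up_simps)

lemma emb_line: "emb (x + t *\<^sub>R axis k 1) = emb x + t *\<^sub>R axis (up k) 1"
  using exhaust_2[of k] by (auto simp: vec_eq_iff forall_3 axis_def)

lemma emb_up: "emb x $ up k = x $ k"
  using exhaust_2[of k] by auto

lemma par_nth: "par y $ k = y $ up k"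
  using exhaust_2[of k] by (auto simp: par_def)

lemma par_line: "par (x + t *\<^sub>R axis (up k) 1) = par x + t *\<^sub>R axis k 1"
  "par (x + t *\<^sub>R axis 3 1) = par x"
  using exhaust_2[of k] by (auto simp: vec_eq_iff forall_2 axis_def par_def)

lemma norm_par_le: "norm (par x) \<le> norm x"
  by (simp add: norm_vec_def L2_set_def sum_3 sum_2 par_def)

lemma continuous_par: "continuous_on A par"
proof -
  have "linear par" by (intro linearI) (auto simp: vec_eq_iff forall_2 par_def)
  then show ?thesis by (rule linear_continuous_on[OF linear_conv_bounded_linear[THEN iffD1]])
qed

lemma chi_emb: "chi R (emb x) = chi R x" "dchi R (up k) (emb x) = dchi R k x"
  by (simp_all add: chi_def dchi_def emb_up)

section \<open>Energy identities for the difference of two solutions\<close>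

text \<open>The balls reach the boundary plane and the curve, so this is stronger than square
  integrability on compact subsets of the open half-space. It is the class of fluxes for which the
  cutoff at the curve can be removed.\<close>

definition locally_L2 :: "(real^3 \<Rightarrow> real) \<Rightarrow> bool" where
  "locally_L2 h \<longleftrightarrow> continuous_on lower_half h \<and>
     (\<forall>R. set_integrable lborel (lower_half \<inter> cball 0 R) (\<lambda>x. (h x)\<^sup>2))"

lemma lower_half_cball_sets: "lower_half \<inter> cball 0 R \<in> sets borel"
  using lower_half_sets by auto

lemma locally_L2_continuous: "locally_L2 h \<Longrightarrow> continuous_on lower_half h"
  by (simp add: locally_L2_def)

lemma locally_L2_const: "locally_L2 (\<lambda>x. c)"
  unfolding locally_L2_def
proof (intro conjI allI)
  show "set_integrable lborel (lower_half \<inter> cball 0 R) (\<lambda>x. c\<^sup>2)" for R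
    by (rule set_integrable_continuous_bound[OF _ lower_half_cball_sets
          set_integrable_const_cball[OF lower_half_cball_sets, of R "c\<^sup>2" R]]) auto
qed simp

lemma locally_L2_bounded_mult:
  assumes "locally_L2 h" "continuous_on lower_half f" "\<And>x. x \<in> lower_half \<Longrightarrow> \<bar>f x\<bar> \<le> M * \<bar>h x\<bar>"
  shows "locally_L2 f"
  unfolding locally_L2_def
proof (intro conjI allI)
  fix R
  have "set_integrable lborel (lower_half \<inter> cball 0 R) (\<lambda>x. M\<^sup>2 * (h x)\<^sup>2)"
    using assms(1) by (auto simp: locally_L2_def)
  then show "set_integrable lborel (lower_half \<inter> cball 0 R) (\<lambda>x. (f x)\<^sup>2)"
  proof (rule set_integrable_continuous_bound[rotated 2])
    show "continuous_on (lower_half \<inter> cball 0 R) (\<lambda>x. (f x)\<^sup>2)"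
      by (intro continuous_intros continuous_on_subset[OF assms(2)]) auto
    show "\<bar>(f x)\<^sup>2\<bar> \<le> M\<^sup>2 * (h x)\<^sup>2" if "x \<in> lower_half \<inter> cball 0 R" for x
    proof -
      have "\<bar>f x\<bar>\<^sup>2 \<le> (M * \<bar>h x\<bar>)\<^sup>2" using assms(3)[of x] that by (intro power_mono) auto
      then show ?thesis by (simp add: power_mult_distrib)
    qed
  qed (rule lower_half_cball_sets)
qed (rule assms(2))

lemma set_integrable_locally_L2_mult:
  assumes h: "locally_L2 h" and k: "locally_L2 k"
    and z: "continuous_on lower_half z" "\<And>x. x \<in> lower_half \<Longrightarrow> \<bar>z x\<bar> \<le> C * indicator (cball 0 R) x"
  shows "set_integrable lborel lower_half (\<lambda>x. z x * (h x * k x))"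
proof -
  have "set_integrable lborel (lower_half \<inter> cball 0 R) (\<lambda>x. C * ((h x)\<^sup>2 + (k x)\<^sup>2))"
    using h k by (intro set_integrable_mult_right set_integral_add(1)) (auto simp: locally_L2_def)
  then have i: "set_integrable lborel lower_half (\<lambda>x. indicator (cball 0 R) x * (C * ((h x)\<^sup>2 + (k x)\<^sup>2)))"
    unfolding set_integrable_def
    by (rule Bochner_Integration.integrable_cong[THEN iffD1, rotated 2]) (auto simp: indicator_def)
  show ?thesis
  proof (rule set_integrable_continuous_bound[OF _ lower_half_sets i])
    show "continuous_on lower_half (\<lambda>x. z x * (h x * k x))"
      using h k z by (auto intro!: continuous_intros simp: locally_L2_def)
    show "\<bar>z x * (h x * k x)\<bar> \<le> indicator (cball 0 R) x * (C * ((h x)\<^sup>2 + (k x)\<^sup>2))" if "x \<in> lower_half" for x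
    proof -
      have "2 * (\<bar>h x\<bar> * \<bar>k x\<bar>) \<le> (h x)\<^sup>2 + (k x)\<^sup>2"
        using zero_le_power2[of "\<bar>h x\<bar> - \<bar>k x\<bar>"] by (simp add: power2_diff)
      then have "\<bar>h x * k x\<bar> \<le> (h x)\<^sup>2 + (k x)\<^sup>2"
        using mult_nonneg_nonneg[OF abs_ge_zero[of "h x"] abs_ge_zero[of "k x"]] unfolding abs_mult by linarith
      then have "\<bar>z x\<bar> * \<bar>h x * k x\<bar> \<le> (C * indicator (cball 0 R) x) * ((h x)\<^sup>2 + (k x)\<^sup>2)"
        using z(2)[OF that] by (intro mult_mono) auto
      then show ?thesis by (simp add: abs_mult mult_ac)
    qed
  qed
qed

text \<open>The difference of two solutions in components: \<open>W i j\<close> and \<open>WW i j\<close> are the first and second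
  derivatives of \<open>w i\<close> in direction \<open>j\<close>, \<open>Q\<close> is the gradient of \<open>r\<close>, \<open>A k\<close> the derivative of the \<open>k\<close>-th
  component of the surface velocity in direction \<open>k\<close>, and \<open>Bd\<close> the gradient of the surface pressure \<open>b\<close>.
  Since the jump of the pressure difference vanishes, \<open>b\<close> extends continuously across the curve.\<close>

locale stokes_difference = lipschitz_curve "\<lambda>t. emb (\<gamma> t)" L for \<gamma> :: "real \<Rightarrow> real^2" and L +
  fixes \<Gamma> :: "(real^2) set"
    and w :: "3 \<Rightarrow> real^3 \<Rightarrow> real" and W WW :: "3 \<Rightarrow> 3 \<Rightarrow> real^3 \<Rightarrow> real"
    and r :: "real^3 \<Rightarrow> real" and Q :: "3 \<Rightarrow> real^3 \<Rightarrow> real"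
    and A :: "2 \<Rightarrow> real^2 \<Rightarrow> real" and b :: "real^2 \<Rightarrow> real" and Bd :: "2 \<Rightarrow> real^2 \<Rightarrow> real"
    and C0 R0 :: real
  assumes \<Gamma>_eq: "\<Gamma> = \<gamma> ` {0..1}" and \<Gamma>_null: "AE x in lborel. x \<notin> \<Gamma>" and \<Gamma>_closed: "closed \<Gamma>"
    and w_cont: "\<And>i. continuous_on (closure lower_half - emb ` \<Gamma>) (w i)"
    and W_cont: "\<And>i j. continuous_on (closure lower_half - emb ` \<Gamma>) (W i j)"
    and WW_cont: "\<And>i j. continuous_on lower_half (WW i j)"
    and w_der: "\<And>i j x. x \<in> lower_half \<Longrightarrow> ((\<lambda>t. w i (x + t *\<^sub>R axis j 1)) has_real_derivative W i j x) (at 0)"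
    and W_der: "\<And>i j x. x \<in> lower_half \<Longrightarrow> ((\<lambda>t. W i j (x + t *\<^sub>R axis j 1)) has_real_derivative WW i j x) (at 0)"
    and r_cont: "continuous_on (closure lower_half - emb ` \<Gamma>) r"
    and Q_cont: "\<And>j. continuous_on lower_half (Q j)"
    and r_der: "\<And>j x. x \<in> lower_half \<Longrightarrow> ((\<lambda>t. r (x + t *\<^sub>R axis j 1)) has_real_derivative Q j x) (at 0)"
    and momentum: "\<And>i x. x \<in> lower_half \<Longrightarrow> (\<Sum>j\<in>UNIV. WW i j x) = Q i x"
    and incompressible: "\<And>x. x \<in> lower_half \<Longrightarrow> (\<Sum>i\<in>UNIV. W i i x) = 0"
    and W_L2: "\<And>i j. set_integrable lborel lower_half (\<lambda>x. (W i j x)\<^sup>2)"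
    and Q_L2: "\<And>j. set_integrable lborel lower_half (\<lambda>x. (Q j x)\<^sup>2)"
    and R0: "R0 \<ge> 1"
    and w_decay: "\<And>i x. x \<in> lower_half \<Longrightarrow> norm x \<ge> R0 \<Longrightarrow> \<bar>w i x\<bar> \<le> C0 / norm x ^ 2"
    and W_decay: "\<And>i j x. x \<in> lower_half \<Longrightarrow> norm x \<ge> R0 \<Longrightarrow> \<bar>W i j x\<bar> \<le> C0 / norm x ^ 3"
    and r_decay: "\<And>x. x \<in> lower_half \<Longrightarrow> norm x \<ge> R0 \<Longrightarrow> \<bar>r x\<bar> \<le> C0 / norm x ^ 3"
    and no_flux: "\<And>x. x \<notin> \<Gamma> \<Longrightarrow> w 3 (emb x) = 0"
    and neumann: "\<And>k x. x \<notin> \<Gamma> \<Longrightarrow> W (up k) 3 (emb x) = - Bd k x"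
    and a_der: "\<And>k x. x \<notin> \<Gamma> \<Longrightarrow> ((\<lambda>t. w (up k) (emb (x + t *\<^sub>R axis k 1))) has_real_derivative A k x) (at 0)"
    and A_cont: "\<And>k. continuous_on (- \<Gamma>) (A k)"
    and A_sum: "\<And>x. x \<notin> \<Gamma> \<Longrightarrow> (\<Sum>k\<in>UNIV. A k x) = 0"
    and a_bdd: "\<And>k R. \<exists>C. \<forall>x. x \<notin> \<Gamma> \<longrightarrow> norm x \<le> R \<longrightarrow> \<bar>w (up k) (emb x)\<bar> \<le> C"
    and a_decay: "\<And>k x. x \<notin> \<Gamma> \<Longrightarrow> norm x \<ge> R0 \<Longrightarrow> \<bar>w (up k) (emb x)\<bar> \<le> C0 / norm x ^ 2"
    and b_cont: "continuous_on UNIV b"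
    and b_der: "\<And>k x. x \<notin> \<Gamma> \<Longrightarrow> ((\<lambda>t. b (x + t *\<^sub>R axis k 1)) has_real_derivative Bd k x) (at 0)"
    and Bd_cont: "\<And>k. continuous_on (- \<Gamma>) (Bd k)"
    and Bd_bdd: "\<And>k R. \<exists>C. \<forall>x. x \<notin> \<Gamma> \<longrightarrow> norm x \<le> R \<longrightarrow> \<bar>Bd k x\<bar> \<le> C"
    and b_lip: "\<And>R M. 0 \<le> M \<Longrightarrow> (\<And>x. x \<notin> \<Gamma> \<Longrightarrow> norm x < R \<Longrightarrow> \<bar>Bd 1 x\<bar> + \<bar>Bd 2 x\<bar> \<le> M) \<Longrightarrow>
      M-lipschitz_on (ball 0 R) b"
    and b_decay: "\<And>x. norm x \<ge> R0 \<Longrightarrow> \<bar>b x\<bar> \<le> C0 / norm x ^ 2"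
begin

lemma curve_eq: "(\<lambda>t. emb (\<gamma> t)) ` {0..1} = emb ` \<Gamma>"
  unfolding \<Gamma>_eq by auto

lemma closed_curve: "closed (emb ` \<Gamma>)"
  using compact_curve unfolding curve_eq by (rule compact_imp_closed)

lemma \<Gamma>_sets: "- \<Gamma> \<in> sets borel"
  using \<Gamma>_closed by auto

lemma lower_half_off_curve: "lower_half \<subseteq> closure lower_half - emb ` \<Gamma>"
  using emb_image_disjoint[of \<Gamma>] closure_subset[of lower_half] by auto

lemma emb_off_curve: "x \<notin> \<Gamma> \<Longrightarrow> emb x \<in> closure lower_half - emb ` \<Gamma>"
  using emb_in_closure by (auto simp: emb_inj)

definition nbhd :: "nat \<Rightarrow> (real^3) set" where
  "nbhd n = (\<Union>t\<in>{0..1}. ball (emb (\<gamma> t)) (1 / real n))"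

lemma nbhd: "open (nbhd n)" "n > 0 \<Longrightarrow> emb ` \<Gamma> \<subseteq> nbhd n"
  by (auto simp: nbhd_def \<Gamma>_eq intro!: bexI)

lemma cut_eq_0: "n > 0 \<Longrightarrow> y \<in> nbhd n \<Longrightarrow> cut n y = 0"
  and dcut_eq_0: "n > 0 \<Longrightarrow> y \<in> nbhd n \<Longrightarrow> dcut n l y = 0"
  and ddcut_eq_0: "n > 0 \<Longrightarrow> y \<in> nbhd n \<Longrightarrow> ddcut n l m y = 0"
  using cut_near_curve by (auto simp: nbhd_def dist_commute)

lemma continuous_cut_mult:
  assumes "continuous_on (closure lower_half - emb ` \<Gamma>) f" "n > 0"
  shows "continuous_on (closure lower_half) (\<lambda>x. cut n x * f x)"
    and "continuous_on (closure lower_half) (\<lambda>x. dcut n l x * f x)"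
    and "continuous_on (closure lower_half) (\<lambda>x. ddcut n l m x * f x)"
  by (rule continuous_on_mult_vanishing[OF assms(1) _ nbhd(1) nbhd(2)[OF assms(2)] closed_curve];
      simp add: continuous_cut continuous_dcut continuous_ddcut cut_eq_0 dcut_eq_0 ddcut_eq_0 assms(2))+

lemma continuous_emb_off_curve:
  "continuous_on (closure lower_half - emb ` \<Gamma>) f \<Longrightarrow> continuous_on (- \<Gamma>) (\<lambda>x. f (emb x))"
  by (erule continuous_on_compose2[OF _ continuous_emb]) (use emb_off_curve in auto)

lemma open_emb_nbhd: "open (emb -` nbhd n)"
  by (rule open_vimage[OF nbhd(1) continuous_emb])

lemma continuous_cut_mult_planar:
  assumes "continuous_on (- \<Gamma>) f" "n > 0"
  shows "continuous_on UNIV (\<lambda>x. cut n (emb x) * f x)"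
    and "continuous_on UNIV (\<lambda>x. dcut n l (emb x) * f x)"
proof -
  have s: "continuous_on (UNIV - \<Gamma>) f" using assms(1) by (simp add: Compl_eq_Diff_UNIV)
  have e: "\<Gamma> \<subseteq> emb -` nbhd n" using nbhd(2)[OF assms(2)] by auto
  show "continuous_on UNIV (\<lambda>x. cut n (emb x) * f x)"
    by (rule continuous_on_mult_vanishing[OF s _ open_emb_nbhd e \<Gamma>_closed])
       (auto intro!: continuous_on_compose2[OF continuous_cut[of UNIV]] continuous_emb cut_eq_0 assms)
  show "continuous_on UNIV (\<lambda>x. dcut n l (emb x) * f x)"
    by (rule continuous_on_mult_vanishing[OF s _ open_emb_nbhd e \<Gamma>_closed])
       (auto intro!: continuous_on_compose2[OF continuous_dcut[of UNIV]] continuous_emb dcut_eq_0 assms)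
qed

lemma cut_emb_tendsto_1: "x \<notin> \<Gamma> \<Longrightarrow> (\<lambda>n. cut (Suc n) (emb x)) \<longlonglongrightarrow> 1"
  by (rule cut_tendsto_1) (auto simp: \<Gamma>_eq emb_inj)

lemma cut_lower_tendsto_1: "x \<in> lower_half \<Longrightarrow> (\<lambda>n. cut (Suc n) x) \<longlonglongrightarrow> 1"
  by (rule cut_tendsto_1) (auto simp: emb_in_closure)

text \<open>Planar integrals are taken off the curve, where the data are meaningful. The curve is
  null, so a function continuous on the whole plane may be integrated either way.\<close>

lemma planar_integral_eq:
  assumes "continuous_on UNIV F"
  shows "(LINT x|lborel. F x) = (LINT x:- \<Gamma>|lborel. F x :: real)"
  unfolding set_lebesgue_integral_def
proof (rule integral_cong_AE)
  have m: "F \<in> borel_measurable borel" using assms by (rule borel_measurable_continuous_onI)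
  then show "F \<in> borel_measurable lborel" by simp
  show "(\<lambda>x. indicat_real (- \<Gamma>) x *\<^sub>R F x) \<in> borel_measurable lborel"
    using set_measurable_continuous[OF continuous_on_subset[OF assms] \<Gamma>_sets] by (simp add: set_borel_measurable_def)
  show "AE x in lborel. F x = indicat_real (- \<Gamma>) x *\<^sub>R F x"
    using \<Gamma>_null by eventually_elim simp
qed

text \<open>A bounded weight \<open>z\<close> with bounded support turns a locally square integrable
  \<open>h\<close> into a globally square integrable function, to which
  \<open>dcut_weakly_null\<close> applies.\<close>

lemma dcut_weakly_null_L2:
  assumes h: "locally_L2 h"
    and z: "continuous_on lower_half z" "\<And>x. x \<in> lower_half \<Longrightarrow> \<bar>z x\<bar> \<le> C * indicator (cball 0 R) x"
  shows "set_integrable lborel lower_half (\<lambda>x. dcut (Suc n) l x * (z x * h x))"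
    and "(\<lambda>n. LINT x:lower_half|lborel. dcut (Suc n) l x * (z x * h x)) \<longlonglongrightarrow> 0"
    and "set_integrable lborel lower_half (\<lambda>x. \<bar>dcut (Suc n) l x\<bar> * \<bar>z x * h x\<bar>)"
    and "(\<lambda>n. LINT x:lower_half|lborel. \<bar>dcut (Suc n) l x\<bar> * \<bar>z x * h x\<bar>) \<longlonglongrightarrow> 0"
proof -
  have c: "continuous_on lower_half (\<lambda>x. z x * h x)"
    using z(1) locally_L2_continuous[OF h] by (rule continuous_on_mult)
  have "set_integrable lborel lower_half (\<lambda>x. (z x)\<^sup>2 * (h x * h x))"
  proof (rule set_integrable_locally_L2_mult[OF h h])
    show "\<bar>(z x)\<^sup>2\<bar> \<le> C\<^sup>2 * indicator (cball 0 R) x" if "x \<in> lower_half" for x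
    proof -
      have "\<bar>z x\<bar>\<^sup>2 \<le> (C * indicator (cball 0 R) x)\<^sup>2" using z(2)[OF that] by (intro power_mono) auto
      then show ?thesis by (simp add: power_mult_distrib power2_eq_square[of "indicator _ _"] flip: indicator_inter_arith)
    qed
  qed (intro continuous_intros z)
  then have q: "set_integrable lborel lower_half (\<lambda>x. (z x * h x)\<^sup>2)"
    by (simp add: power2_eq_square mult_ac)
  note * = dcut_weakly_null[OF lower_half_sets c q]
  show i: "set_integrable lborel lower_half (\<lambda>x. \<bar>dcut (Suc n) l x\<bar> * \<bar>z x * h x\<bar>)" for n by (rule *)
  show l: "(\<lambda>n. LINT x:lower_half|lborel. \<bar>dcut (Suc n) l x\<bar> * \<bar>z x * h x\<bar>) \<longlonglongrightarrow> 0" by (rule *)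
  show i': "set_integrable lborel lower_half (\<lambda>x. dcut (Suc n) l x * (z x * h x))" for n
    by (rule set_integrable_continuous_bound[OF _ lower_half_sets i[of n]])
       (auto intro!: continuous_intros continuous_dcut c simp: abs_mult)
  show "(\<lambda>n. LINT x:lower_half|lborel. dcut (Suc n) l x * (z x * h x)) \<longlonglongrightarrow> 0"
  proof (rule Lim_null_comparison[OF always_eventually[OF allI] l])
    fix n
    have "norm (LINT x:lower_half|lborel. dcut (Suc n) l x * (z x * h x))
        \<le> (LINT x|lborel. norm (indicator lower_half x *\<^sub>R (dcut (Suc n) l x * (z x * h x))))"
      unfolding set_lebesgue_integral_def by (rule integral_norm_bound)
    also have "\<dots> = (LINT x:lower_half|lborel. \<bar>dcut (Suc n) l x\<bar> * \<bar>z x * h x\<bar>)"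
      unfolding set_lebesgue_integral_def by (simp add: abs_mult)
    finally show "norm (LINT x:lower_half|lborel. dcut (Suc n) l x * (z x * h x))
      \<le> (LINT x:lower_half|lborel. \<bar>dcut (Suc n) l x\<bar> * \<bar>z x * h x\<bar>)" .
  qed
qed

lemma chi_bound: "R > 0 \<Longrightarrow> \<bar>chi R x\<bar> \<le> 1 * indicator (cball 0 R) x"
  using abs_chi_le[of R x] by simp

text \<open>The divergence theorem for \<open>chi R * f j\<close>, with square integrability of
  \<open>f j\<close> as the only control inside the half-space near the curve. It is applied to the
  field multiplied by \<open>cut\<close>, which is continuous up to the boundary. As the cutoff is
  removed, the terms with its gradient vanish by \<open>dcut_weakly_null_L2\<close>, and the others
  converge by domination, on the boundary thanks to the bound \<open>C\<close> on
  \<open>f 3\<close>.\<close>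

lemma gauss_off_curve:
  assumes R: "R > 0"
    and cf: "\<And>j. continuous_on (closure lower_half - emb ` \<Gamma>) (f j)"
    and der: "\<And>j x. x \<in> lower_half \<Longrightarrow> ((\<lambda>t. f j (x + t *\<^sub>R axis j 1)) has_real_derivative df j x) (at 0)"
    and cdf: "\<And>j. continuous_on lower_half (df j)"
    and f2: "\<And>j. locally_L2 (f j)"
    and int: "set_integrable lborel lower_half (\<lambda>x. chi R x * (\<Sum>j\<in>UNIV. df j x))"
    and bd: "\<And>x. x \<notin> \<Gamma> \<Longrightarrow> norm x \<le> R \<Longrightarrow> \<bar>f 3 (emb x)\<bar> \<le> C"
  shows "(LINT x:lower_half|lborel. (\<Sum>j\<in>UNIV. dchi R j x * f j x) + chi R x * (\<Sum>j\<in>UNIV. df j x))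
      = (LINT x:- \<Gamma>|lborel. chi R x * f 3 (emb x))"
proof -
  define \<Phi> where "\<Phi> x = (\<Sum>j\<in>UNIV. dchi R j x * f j x) + chi R x * (\<Sum>j\<in>UNIV. df j x)" for x
  have cfl: "continuous_on lower_half (f j)" for j by (rule continuous_on_subset[OF cf lower_half_off_curve])
  have dchi_int: "set_integrable lborel lower_half (\<lambda>x. dchi R j x * f j x)" for j
    using set_integrable_locally_L2_mult[OF f2[of j] locally_L2_const[of 1] continuous_dchi abs_dchi_le_indicator[OF R]] by simp
  have \<Phi>_int: "set_integrable lborel lower_half \<Phi>"
    unfolding \<Phi>_def sum_3 using int dchi_int by (intro set_integral_add(1)) (simp_all add: sum_3)
  have \<Phi>_cont: "continuous_on lower_half \<Phi>"
    unfolding \<Phi>_def by (intro continuous_intros continuous_dchi continuous_chi cfl cdf)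
  \<comment> \<open>The terms in which the derivative falls on the cutoff at the curve.\<close>
  define E where "E n x = (\<Sum>j\<in>UNIV. dcut (Suc n) j x * (chi R x * f j x))" for n x
  have Ei: "set_integrable lborel lower_half (E n)" for n
    unfolding E_def sum_3
    by (intro set_integral_add(1) dcut_weakly_null_L2(1)[OF f2 continuous_chi chi_bound[OF R]])
  have E0: "(\<lambda>n. LINT x:lower_half|lborel. E n x) \<longlonglongrightarrow> 0"
  proof -
    have i: "set_integrable lborel lower_half (\<lambda>x. dcut (Suc n) j x * (chi R x * f j x))" for n j
      by (rule dcut_weakly_null_L2(1)[OF f2 continuous_chi chi_bound[OF R]])
    have "(LINT x:lower_half|lborel. E n x) = (\<Sum>j\<in>UNIV. LINT x:lower_half|lborel. dcut (Suc n) j x * (chi R x * f j x))" for n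
      unfolding E_def sum_3 by (simp add: set_integral_add i)
    moreover have "(\<lambda>n. \<Sum>j\<in>UNIV. LINT x:lower_half|lborel. dcut (Suc n) j x * (chi R x * f j x)) \<longlonglongrightarrow> (\<Sum>j\<in>(UNIV::3 set). 0)"
      by (intro tendsto_sum dcut_weakly_null_L2(2)[OF f2 continuous_chi chi_bound[OF R]])
    ultimately show ?thesis by simp
  qed
  have cutcont: "continuous_on X (cut n)" for X n by (rule continuous_cut)
  have cutb: "\<bar>cut n x * y\<bar> \<le> \<bar>y\<bar>" for n x y
    using cut_range[of n x] by (simp add: abs_mult mult_left_le_one_le)
  have cut\<Phi>_int: "set_integrable lborel lower_half (\<lambda>x. cut (Suc n) x * \<Phi> x)" for n
    by (rule set_integrable_continuous_bound[OF _ lower_half_sets set_integrable_abs[OF \<Phi>_int] cutb])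
       (intro continuous_intros cutcont \<Phi>_cont)
  have cut\<Phi>_lim: "(\<lambda>n. LINT x:lower_half|lborel. cut (Suc n) x * \<Phi> x) \<longlonglongrightarrow> (LINT x:lower_half|lborel. \<Phi> x)"
  proof (rule set_dominated_convergence(2)[OF _ _ set_integrable_abs[OF \<Phi>_int]])
    show "AE x\<in>lower_half in lborel. (\<lambda>n. cut (Suc n) x * \<Phi> x) \<longlonglongrightarrow> \<Phi> x"
      using tendsto_mult[OF cut_lower_tendsto_1 tendsto_const] by (auto intro!: always_eventually)
  qed (use lower_half_sets cutb in \<open>auto intro!: set_measurable_continuous continuous_intros cutcont \<Phi>_cont\<close>)
  have step: "(LINT x:lower_half|lborel. E n x) + (LINT x:lower_half|lborel. cut (Suc n) x * \<Phi> x)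
      = (LINT x:- \<Gamma>|lborel. cut (Suc n) (emb x) * (chi R x * f 3 (emb x)))" for n
  proof -
    let ?F = "\<lambda>j x. cut (Suc n) x * (chi R x * f j x)"
    let ?D = "\<lambda>j x. dcut (Suc n) j x * (chi R x * f j x) + cut (Suc n) x * (dchi R j x * f j x + chi R x * df j x)"
    have cF: "continuous_on (closure lower_half) (?F j)" for j
      by (rule continuous_cut_mult(1)) (auto intro!: continuous_intros continuous_chi cf)
    have sumD: "(\<Sum>j\<in>UNIV. ?D j x) = E n x + cut (Suc n) x * \<Phi> x" for x
      by (simp add: E_def \<Phi>_def sum_3 algebra_simps)
    have "(LINT x:lower_half|lborel. \<Sum>j\<in>UNIV. ?D j x) = (LINT x|lborel. ?F 3 (emb x))"
    proof (rule half_space_divergence)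
      show "((\<lambda>t. ?F j (x + t *\<^sub>R axis j 1)) has_real_derivative ?D j x) (at 0)" if "x \<in> lower_half" for j x
        by (rule DERIV_cong[OF DERIV_mult[OF cut_derivative DERIV_mult[OF chi_derivative der[OF that]]]])
           (simp add: algebra_simps)
      show "continuous_on lower_half (?D j)" for j
        by (intro continuous_intros continuous_dcut cutcont continuous_chi continuous_dchi cfl cdf)
      show "continuous_on lower_half (?F j)" for j
        by (intro continuous_intros cutcont continuous_chi cfl)
      show "set_integrable lborel lower_half (\<lambda>x. \<Sum>j\<in>UNIV. ?D j x)"
        unfolding sumD by (intro set_integral_add(1) Ei cut\<Phi>_int)
      show "?F j x = 0" if "norm x > R" for j x
        using chi_eq_0[OF R, of x] that by simp
    qed (rule cF)
    also have "\<dots> = (LINT x:- \<Gamma>|lborel. ?F 3 (emb x))"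
      by (rule planar_integral_eq, rule continuous_on_compose2[OF cF continuous_emb]) (auto simp: emb_in_closure)
    finally show ?thesis
      unfolding sumD set_integral_add(2)[OF Ei cut\<Phi>_int] by (simp add: chi_emb)
  qed
  have cfe: "continuous_on (- \<Gamma>) (\<lambda>x. chi R x * f 3 (emb x))"
    by (intro continuous_intros continuous_chi continuous_emb_off_curve cf)
  have "(\<lambda>n. LINT x:- \<Gamma>|lborel. cut (Suc n) (emb x) * (chi R x * f 3 (emb x))) \<longlonglongrightarrow> (LINT x:- \<Gamma>|lborel. chi R x * f 3 (emb x))"
  proof (rule set_dominated_convergence(2)[OF _ _ set_integrable_const_cball[OF \<Gamma>_sets]])
    show "AE x\<in>- \<Gamma> in lborel. (\<lambda>n. cut (Suc n) (emb x) * (chi R x * f 3 (emb x))) \<longlonglongrightarrow> chi R x * f 3 (emb x)"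
      using tendsto_mult[OF cut_emb_tendsto_1 tendsto_const] by (auto intro!: always_eventually)
    show "\<bar>cut (Suc n) (emb x) * (chi R x * f 3 (emb x))\<bar> \<le> C * indicator (cball 0 R) x" if "x \<in> - \<Gamma>" for n x
    proof (rule order_trans[OF cutb])
      show "\<bar>chi R x * f 3 (emb x)\<bar> \<le> C * indicator (cball 0 R) x"
      proof (cases "norm x \<le> R")
        case True
        have "\<bar>chi R x * f 3 (emb x)\<bar> \<le> 1 * C"
          unfolding abs_mult using chi_range[of R x] bd[OF _ True] that by (intro mult_mono) auto
        then show ?thesis using True by simp
      qed (use chi_eq_0[OF R, of x] in auto)
    qed
    show "set_borel_measurable lborel (- \<Gamma>) (\<lambda>x. cut (Suc n) (emb x) * (chi R x * f 3 (emb x)))" for n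
      by (intro set_measurable_continuous \<Gamma>_sets continuous_on_mult cfe continuous_on_compose2[OF cutcont[of UNIV] continuous_emb]) auto
  qed (use \<Gamma>_sets cfe in \<open>auto intro!: set_measurable_continuous\<close>)
  from LIMSEQ_unique[OF this[folded step] tendsto_add[OF E0 cut\<Phi>_lim]]
  show ?thesis unfolding \<Phi>_def by simp
qed

end

context stokes_difference begin

lemma inverse_power_le: "norm x \<ge> R0 \<Longrightarrow> C0 / norm x ^ k \<le> \<bar>C0\<bar>"
proof -
  assume "norm x \<ge> R0"
  then have "1 \<le> norm x ^ k" using R0 by (intro one_le_power) simp
  then have "\<bar>C0\<bar> / norm x ^ k \<le> \<bar>C0\<bar> / 1" by (intro divide_left_mono) auto
  then show ?thesis
    using divide_right_mono[of C0 "\<bar>C0\<bar>" "norm x ^ k"] by (smt (verit) norm_ge_zero zero_le_power abs_ge_self div_by_1)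
qed

lemma w_cont_lower: "continuous_on lower_half (w i)" and W_cont_lower: "continuous_on lower_half (W i j)"
  and r_cont_lower: "continuous_on lower_half r"
  using continuous_on_subset[OF _ lower_half_off_curve] w_cont W_cont r_cont by auto

lemma w_L2: "locally_L2 (w i)"
  unfolding locally_L2_def
  using square_integrable_on_bounded[OF w_der[of _ i 3] w_cont_lower W_cont_lower W_L2, where C = "\<bar>C0\<bar>" and ?R0.0 = R0]
    w_cont_lower order_trans[OF w_decay inverse_power_le] by blast

lemma r_L2: "locally_L2 r"
  unfolding locally_L2_def
  using square_integrable_on_bounded[OF r_der[of _ 3] r_cont_lower Q_cont Q_L2, where C = "\<bar>C0\<bar>" and ?R0.0 = R0]
    r_cont_lower order_trans[OF r_decay inverse_power_le] by blast

lemma locally_L2I: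
  assumes "continuous_on lower_half h" "set_integrable lborel lower_half (\<lambda>x. (h x)\<^sup>2)"
  shows "locally_L2 h"
  unfolding locally_L2_def
  using set_integrable_subset[OF assms(2) lower_half_cball_sets[folded sets_lborel]] assms(1) by auto

lemma W_loc: "locally_L2 (W i j)" and Q_loc: "locally_L2 (Q j)"
  by (intro locally_L2I W_cont_lower W_L2 Q_cont Q_L2)+

text \<open>Passage to the limit in the truncation level: \<open>fm\<close>, \<open>sm\<close> and
  \<open>gm\<close> stand for the truncated flux, source and boundary density. The cutoff at the
  curve is already gone, so integrability of the untruncated flux, rather than square integrability,
  is enough for domination.\<close>

lemma gauss_limit:
  fixes f :: "3 \<Rightarrow> real^3 \<Rightarrow> real" and s S :: "real^3 \<Rightarrow> real" and g :: "real^2 \<Rightarrow> real"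
  assumes R: "R > 0"
    and eq: "\<And>m. (LINT x:lower_half|lborel. (\<Sum>j\<in>UNIV. dchi R j x * fm m j x) + chi R x * sm m x)
        = (LINT x:- \<Gamma>|lborel. chi R x * gm m x)"
    and cm: "\<And>m j. continuous_on lower_half (fm m j)" "\<And>m. continuous_on lower_half (sm m)" "\<And>m. continuous_on (- \<Gamma>) (gm m)"
    and c: "\<And>j. continuous_on lower_half (f j)" "continuous_on lower_half s" "continuous_on (- \<Gamma>) g"
    and int: "\<And>j. set_integrable lborel lower_half (\<lambda>x. dchi R j x * f j x)"
      "set_integrable lborel lower_half (\<lambda>x. chi R x * S x)"
    and lim: "\<And>x j. x \<in> lower_half \<Longrightarrow> (\<lambda>m. fm m j x) \<longlonglongrightarrow> f j x"
      "\<And>x. x \<in> lower_half \<Longrightarrow> (\<lambda>m. sm m x) \<longlonglongrightarrow> s x"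
      "\<And>x. x \<notin> \<Gamma> \<Longrightarrow> (\<lambda>m. gm m x) \<longlonglongrightarrow> g x"
    and bd: "\<And>m j x. x \<in> lower_half \<Longrightarrow> \<bar>fm m j x\<bar> \<le> \<bar>f j x\<bar>"
      "\<And>m x. x \<in> lower_half \<Longrightarrow> \<bar>sm m x\<bar> \<le> S x"
      "\<And>m x. x \<notin> \<Gamma> \<Longrightarrow> norm x \<le> R \<Longrightarrow> \<bar>gm m x\<bar> \<le> C"
  shows "(LINT x:lower_half|lborel. (\<Sum>j\<in>UNIV. dchi R j x * f j x) + chi R x * s x)
        = (LINT x:- \<Gamma>|lborel. chi R x * g x)"
proof -
  have "(\<lambda>m. LINT x:lower_half|lborel. (\<Sum>j\<in>UNIV. dchi R j x * fm m j x) + chi R x * sm m x)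
     \<longlonglongrightarrow> (LINT x:lower_half|lborel. (\<Sum>j\<in>UNIV. dchi R j x * f j x) + chi R x * s x)"
  proof (rule set_dominated_convergence(2)[where g = "\<lambda>x. (\<Sum>j\<in>UNIV. \<bar>dchi R j x * f j x\<bar>) + chi R x * S x"])
    show "set_integrable lborel lower_half (\<lambda>x. (\<Sum>j\<in>UNIV. \<bar>dchi R j x * f j x\<bar>) + chi R x * S x)"
      unfolding sum_3 by (intro set_integral_add(1) set_integrable_abs int)
    show "AE x\<in>lower_half in lborel. (\<lambda>m. (\<Sum>j\<in>UNIV. dchi R j x * fm m j x) + chi R x * sm m x)
        \<longlonglongrightarrow> (\<Sum>j\<in>UNIV. dchi R j x * f j x) + chi R x * s x"
      by (intro always_eventually allI impI tendsto_intros lim)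
    show "\<bar>(\<Sum>j\<in>UNIV. dchi R j x * fm m j x) + chi R x * sm m x\<bar> \<le> (\<Sum>j\<in>UNIV. \<bar>dchi R j x * f j x\<bar>) + chi R x * S x"
      if "x \<in> lower_half" for m x
    proof (rule order_trans[OF abs_triangle_ineq add_mono])
      show "\<bar>\<Sum>j\<in>UNIV. dchi R j x * fm m j x\<bar> \<le> (\<Sum>j\<in>UNIV. \<bar>dchi R j x * f j x\<bar>)"
        using bd(1)[OF that] by (intro order_trans[OF sum_abs sum_mono]) (simp add: abs_mult mult_left_mono)
      show "\<bar>chi R x * sm m x\<bar> \<le> chi R x * S x"
        using bd(2)[OF that, of m] chi_range(1)[of R x] by (simp add: abs_mult mult_left_mono)
    qed
  qed (auto intro!: lower_half_sets set_measurable_continuous continuous_intros continuous_chi continuous_dchi c cm)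
  moreover have "(\<lambda>m. LINT x:- \<Gamma>|lborel. chi R x * gm m x) \<longlonglongrightarrow> (LINT x:- \<Gamma>|lborel. chi R x * g x)"
  proof (rule set_dominated_convergence(2)[OF _ _ set_integrable_const_cball[OF \<Gamma>_sets, of C R]])
    show "AE x\<in>- \<Gamma> in lborel. (\<lambda>m. chi R x * gm m x) \<longlonglongrightarrow> chi R x * g x"
      by (intro always_eventually allI impI tendsto_intros lim) auto
    show "\<bar>chi R x * gm m x\<bar> \<le> C * indicator (cball 0 R) x" if "x \<in> - \<Gamma>" for m x
    proof (cases "norm x \<le> R")
      case True
      have "\<bar>chi R x * gm m x\<bar> \<le> 1 * C"
        unfolding abs_mult using chi_range[of R x] bd(3)[OF _ True, of m] that by (intro mult_mono) auto
      then show ?thesis using True by simp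
    qed (use chi_eq_0[OF R, of x] in auto)
  qed (use \<Gamma>_sets in \<open>auto intro!: set_measurable_continuous continuous_intros continuous_chi c cm\<close>)
  ultimately show ?thesis unfolding eq by (rule LIMSEQ_unique)
qed

text \<open>From the half-space side nothing bounds \<open>W i 3\<close> near the curve. For the
  tangential components the boundary condition replaces it by the gradient of \<open>b\<close>,
  which is bounded up to the curve; for \<open>i = 3\<close> the other factor vanishes.\<close>

lemma wW_bdd: "\<exists>C. \<forall>x. x \<notin> \<Gamma> \<longrightarrow> norm x \<le> R \<longrightarrow> \<bar>w i (emb x) * W i 3 (emb x)\<bar> \<le> C"
proof (cases rule: cases_up[of i])
  case (1 k)
  obtain C1 C2 where C: "\<forall>x. x \<notin> \<Gamma> \<longrightarrow> norm x \<le> R \<longrightarrow> \<bar>w (up k) (emb x)\<bar> \<le> C1"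
      "\<forall>x. x \<notin> \<Gamma> \<longrightarrow> norm x \<le> R \<longrightarrow> \<bar>Bd k x\<bar> \<le> C2"
    using a_bdd Bd_bdd by metis
  have "\<bar>w i (emb x) * W i 3 (emb x)\<bar> \<le> \<bar>C1\<bar> * \<bar>C2\<bar>" if "x \<notin> \<Gamma>" "norm x \<le> R" for x
    unfolding 1 neumann[OF that(1)] abs_mult abs_minus
    using C that by (intro mult_mono) (auto intro: order_trans[OF _ abs_ge_self])
  then show ?thesis by blast
next
  case 2
  then show ?thesis using no_flux by (intro exI[of _ 0]) auto
qed

lemma truncated_mult_locally_L2:
  assumes "m > 0" "continuous_on lower_half h" "locally_L2 k"
  shows "locally_L2 (\<lambda>x. trunc m (h x) * k x)" and "locally_L2 (\<lambda>x. dtrunc m (h x) * k x)"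
proof -
  have c: "continuous_on lower_half (\<lambda>x. trunc m (h x) * k x)" "continuous_on lower_half (\<lambda>x. dtrunc m (h x) * k x)"
    by (intro continuous_on_mult continuous_on_compose2[OF continuous_trunc[OF assms(1), of UNIV] assms(2)]
          continuous_on_compose2[OF continuous_dtrunc[of UNIV] assms(2)] locally_L2_continuous assms; simp)+
  show "locally_L2 (\<lambda>x. trunc m (h x) * k x)"
    by (rule locally_L2_bounded_mult[OF assms(3) c(1), of "m * pi"])
       (simp add: abs_mult mult_right_mono abs_trunc_le[OF assms(1)])
  show "locally_L2 (\<lambda>x. dtrunc m (h x) * k x)"
    by (rule locally_L2_bounded_mult[OF assms(3) c(2), of 1])
       (use dtrunc_range[of m] in \<open>simp add: abs_mult mult_left_le_one_le\<close>)
qed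

lemma integrable_chi_mult:
  assumes "R > 0" "locally_L2 h" "locally_L2 k"
  shows "set_integrable lborel lower_half (\<lambda>x. chi R x * (h x * k x))"
    and "set_integrable lborel lower_half (\<lambda>x. dchi R j x * (h x * k x))"
  using set_integrable_locally_L2_mult[OF assms(2,3) continuous_chi chi_bound[OF assms(1)]]
    set_integrable_locally_L2_mult[OF assms(2,3) continuous_dchi abs_dchi_le_indicator[OF assms(1)]] by auto

lemma locally_L2_abs: "locally_L2 h \<Longrightarrow> locally_L2 (\<lambda>x. \<bar>h x\<bar>)"
  using locally_L2_bounded_mult[of h "\<lambda>x. \<bar>h x\<bar>" 1] continuous_on_rabs[OF locally_L2_continuous, of h] by simp

text \<open>Component \<open>i\<close> of the momentum equation tested with \<open>w i\<close>. The
  flux \<open>w i * W i j\<close> is only locally integrable, so \<open>gauss_off_curve\<close> is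
  applied with a truncated \<open>w i\<close>, which makes the flux locally square integrable. In
  the limit the slope of the truncation tends to 1, and \<open>W i j * W i j\<close> and
  \<open>\<bar>w i x\<bar> * \<bar>Q i x\<bar>\<close> serve as majorants.\<close>

lemma energy_component:
  assumes R: "R > 0"
  shows "(LINT x:lower_half|lborel. (\<Sum>j\<in>UNIV. dchi R j x * (w i x * W i j x))
            + chi R x * ((\<Sum>j\<in>UNIV. W i j x * W i j x) + w i x * Q i x))
      = (LINT x:- \<Gamma>|lborel. chi R x * (w i (emb x) * W i 3 (emb x)))"
proof -
  obtain C where C: "\<And>x. x \<notin> \<Gamma> \<Longrightarrow> norm x \<le> R \<Longrightarrow> \<bar>w i (emb x) * W i 3 (emb x)\<bar> \<le> C"
    using wW_bdd by blast
  define tr where "tr m = trunc (real (Suc m))" for m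
  define dtr where "dtr m = dtrunc (real (Suc m))" for m
  have tr_le: "\<bar>tr m s * y\<bar> \<le> \<bar>s * y\<bar>" for m s y
    unfolding abs_mult tr_def by (intro mult_right_mono abs_trunc_le_abs) auto
  have dtr_le: "0 \<le> dtr m s" "dtr m s \<le> 1" for m s using dtrunc_range by (auto simp: dtr_def)
  have trc: "continuous_on X (\<lambda>x. tr m (h x))" "continuous_on X (\<lambda>x. dtr m (h x))"
    if "continuous_on X h" for X :: "'z::topological_space set" and h m
    using continuous_on_compose2[OF continuous_trunc[of "real (Suc m)" UNIV] that]
      continuous_on_compose2[OF continuous_dtrunc[of UNIV] that] by (auto simp: tr_def dtr_def)
  have eq: "(LINT x:lower_half|lborel. (\<Sum>j\<in>UNIV. dchi R j x * (tr m (w i x) * W i j x))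
            + chi R x * ((\<Sum>j\<in>UNIV. dtr m (w i x) * W i j x * W i j x) + tr m (w i x) * Q i x))
      = (LINT x:- \<Gamma>|lborel. chi R x * (tr m (w i (emb x)) * W i 3 (emb x)))" for m
  proof -
    let ?f = "\<lambda>j x. tr m (w i x) * W i j x"
    let ?df = "\<lambda>j x. dtr m (w i x) * W i j x * W i j x + tr m (w i x) * WW i j x"
    have s: "(\<Sum>j\<in>UNIV. ?df j x) = (\<Sum>j\<in>UNIV. dtr m (w i x) * W i j x * W i j x) + tr m (w i x) * Q i x"
      if "x \<in> lower_half" for x
      using momentum[OF that, of i] by (simp add: sum.distrib sum_distrib_left[symmetric])
    have "(LINT x:lower_half|lborel. (\<Sum>j\<in>UNIV. dchi R j x * ?f j x) + chi R x * (\<Sum>j\<in>UNIV. ?df j x))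
      = (LINT x:- \<Gamma>|lborel. chi R x * ?f 3 (emb x))"
    proof (rule gauss_off_curve[OF R])
      show "continuous_on (closure lower_half - emb ` \<Gamma>) (?f j)" for j
        by (intro continuous_intros trc w_cont W_cont)
      show "((\<lambda>t. ?f j (x + t *\<^sub>R axis j 1)) has_real_derivative ?df j x) (at 0)" if "x \<in> lower_half" for j x
      proof -
        have "((\<lambda>t. tr m (w i (x + t *\<^sub>R axis j 1))) has_real_derivative dtr m (w i (x + 0 *\<^sub>R axis j 1)) * W i j x) (at 0)"
          unfolding tr_def dtr_def by (rule DERIV_chain2[OF trunc_derivative w_der[OF that]]) simp
        from DERIV_mult[OF this W_der[OF that]] show ?thesis by (rule DERIV_cong) simp
      qed
      show "continuous_on lower_half (?df j)" for j
        by (intro continuous_intros trc w_cont_lower W_cont_lower WW_cont)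
      show "locally_L2 (?f j)" for j
        unfolding tr_def by (intro truncated_mult_locally_L2 w_cont_lower W_loc) auto
      have "set_integrable lborel lower_half (\<lambda>x. chi R x * (dtr m (w i x) * W i j x * W i j x))" for j
        unfolding dtr_def by (intro integrable_chi_mult truncated_mult_locally_L2 w_cont_lower W_loc R) auto
      moreover have "set_integrable lborel lower_half (\<lambda>x. chi R x * (tr m (w i x) * Q i x * 1))"
        unfolding tr_def by (intro integrable_chi_mult truncated_mult_locally_L2 w_cont_lower Q_loc R locally_L2_const) auto
      ultimately have "set_integrable lborel lower_half (\<lambda>x. chi R x * ((\<Sum>j\<in>UNIV. dtr m (w i x) * W i j x * W i j x) + tr m (w i x) * Q i x))"
        unfolding sum_3 distrib_left by (intro set_integral_add(1)) simp_all
      then show "set_integrable lborel lower_half (\<lambda>x. chi R x * (\<Sum>j\<in>UNIV. ?df j x))"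
        by (rule set_integrable_cong[THEN iffD1, rotated 3]) (simp_all add: s)
      show "\<bar>?f 3 (emb x)\<bar> \<le> C" if "x \<notin> \<Gamma>" "norm x \<le> R" for x
        using tr_le C[OF that] by (rule order_trans)
    qed
    moreover have "(LINT x:lower_half|lborel. (\<Sum>j\<in>UNIV. dchi R j x * ?f j x) + chi R x * (\<Sum>j\<in>UNIV. ?df j x))
      = (LINT x:lower_half|lborel. (\<Sum>j\<in>UNIV. dchi R j x * ?f j x)
            + chi R x * ((\<Sum>j\<in>UNIV. dtr m (w i x) * W i j x * W i j x) + tr m (w i x) * Q i x))"
      by (rule set_lebesgue_integral_cong) (auto simp: s lower_half_sets)
    ultimately show ?thesis by simp
  qed
  show ?thesis
  proof (rule gauss_limit[OF R eq])
    show "continuous_on lower_half (\<lambda>x. tr m (w i x) * W i j x)"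
      "continuous_on lower_half (\<lambda>x. (\<Sum>j\<in>UNIV. dtr m (w i x) * W i j x * W i j x) + tr m (w i x) * Q i x)" for m j
      by (intro continuous_intros trc w_cont_lower W_cont_lower Q_cont)+
    show "continuous_on (- \<Gamma>) (\<lambda>x. tr m (w i (emb x)) * W i 3 (emb x))" for m
      by (intro continuous_intros trc continuous_emb_off_curve w_cont W_cont)
    show "continuous_on (- \<Gamma>) (\<lambda>x. w i (emb x) * W i 3 (emb x))"
      by (intro continuous_intros continuous_emb_off_curve w_cont W_cont)
    show "continuous_on lower_half (\<lambda>x. w i x * W i j x)"
      "continuous_on lower_half (\<lambda>x. (\<Sum>j\<in>UNIV. W i j x * W i j x) + w i x * Q i x)" for j
      by (intro continuous_intros w_cont_lower W_cont_lower Q_cont)+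
    show "set_integrable lborel lower_half (\<lambda>x. dchi R j x * (w i x * W i j x))" for j
      by (intro integrable_chi_mult R w_L2 W_loc)
    have "set_integrable lborel lower_half (\<lambda>x. chi R x * (\<bar>w i x\<bar> * \<bar>Q i x\<bar>))"
      "set_integrable lborel lower_half (\<lambda>x. chi R x * (W i j x * W i j x))" for j
      by (intro integrable_chi_mult R locally_L2_abs w_L2 Q_loc W_loc)+
    then show "set_integrable lborel lower_half (\<lambda>x. chi R x * ((\<Sum>j\<in>UNIV. W i j x * W i j x) + \<bar>w i x\<bar> * \<bar>Q i x\<bar>))"
      unfolding sum_3 distrib_left by (intro set_integral_add(1)) simp_all
    show "\<bar>(\<Sum>j\<in>UNIV. dtr m (w i x) * W i j x * W i j x) + tr m (w i x) * Q i x\<bar>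
        \<le> (\<Sum>j\<in>UNIV. W i j x * W i j x) + \<bar>w i x\<bar> * \<bar>Q i x\<bar>" for m x
    proof (rule order_trans[OF abs_triangle_ineq add_mono])
      show "\<bar>\<Sum>j\<in>UNIV. dtr m (w i x) * W i j x * W i j x\<bar> \<le> (\<Sum>j\<in>UNIV. W i j x * W i j x)"
      proof (rule order_trans[OF sum_abs sum_mono])
        fix j
        show "\<bar>dtr m (w i x) * W i j x * W i j x\<bar> \<le> W i j x * W i j x"
          using dtr_le[of m "w i x"] mult_left_le_one_le[of "W i j x * W i j x" "dtr m (w i x)"]
          by (simp add: abs_mult mult.assoc)
      qed
      show "\<bar>tr m (w i x) * Q i x\<bar> \<le> \<bar>w i x\<bar> * \<bar>Q i x\<bar>"
        using tr_le by (simp add: abs_mult)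
    qed
    show "(\<lambda>m. tr m (w i x) * W i j x) \<longlonglongrightarrow> w i x * W i j x" for x j
      unfolding tr_def by (intro tendsto_intros trunc_tendsto)
    show "(\<lambda>m. tr m (w i (emb x)) * W i 3 (emb x)) \<longlonglongrightarrow> w i (emb x) * W i 3 (emb x)" for x
      unfolding tr_def by (intro tendsto_intros trunc_tendsto)
    have "(\<lambda>m. (\<Sum>j\<in>UNIV. dtr m (w i x) * W i j x * W i j x) + tr m (w i x) * Q i x)
        \<longlonglongrightarrow> (\<Sum>j\<in>UNIV. 1 * W i j x * W i j x) + w i x * Q i x" for x
      unfolding tr_def dtr_def by (intro tendsto_intros trunc_tendsto dtrunc_tendsto)
    then show "(\<lambda>m. (\<Sum>j\<in>UNIV. dtr m (w i x) * W i j x * W i j x) + tr m (w i x) * Q i x)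
        \<longlonglongrightarrow> (\<Sum>j\<in>UNIV. W i j x * W i j x) + w i x * Q i x" for x
      by simp
    show "\<bar>tr m (w i x) * W i j x\<bar> \<le> \<bar>w i x * W i j x\<bar>" for m j x by (rule tr_le)
    show "\<bar>tr m (w i (emb x)) * W i 3 (emb x)\<bar> \<le> C" if "x \<notin> \<Gamma>" "norm x \<le> R" for m x
      using tr_le C[OF that] by (rule order_trans)
  qed
qed

text \<open>Trades the pressure term of the energy identity for a flux at infinity. Here
  \<open>r\<close> is the truncated factor; incompressibility removes the derivatives of
  \<open>w\<close> from the divergence of the flux, and the boundary integral vanishes because
  \<open>w 3\<close> does.\<close>

lemma pressure_work:
  assumes R: "R > 0"
  shows "(LINT x:lower_half|lborel. (\<Sum>j\<in>UNIV. dchi R j x * (r x * w j x)) + chi R x * (\<Sum>j\<in>UNIV. Q j x * w j x)) = 0"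
proof -
  define tr where "tr m = trunc (real (Suc m))" for m
  define dtr where "dtr m = dtrunc (real (Suc m))" for m
  have tr_le: "\<bar>tr m s * y\<bar> \<le> \<bar>s * y\<bar>" for m s y
    unfolding abs_mult tr_def by (intro mult_right_mono abs_trunc_le_abs) auto
  have dtr_le: "0 \<le> dtr m s" "dtr m s \<le> 1" for m s using dtrunc_range by (auto simp: dtr_def)
  have trc: "continuous_on X (\<lambda>x. tr m (h x))" "continuous_on X (\<lambda>x. dtr m (h x))"
    if "continuous_on X h" for X :: "'z::topological_space set" and h m
    using continuous_on_compose2[OF continuous_trunc[of "real (Suc m)" UNIV] that]
      continuous_on_compose2[OF continuous_dtrunc[of UNIV] that] by (auto simp: tr_def dtr_def)
  have eq: "(LINT x:lower_half|lborel. (\<Sum>j\<in>UNIV. dchi R j x * (tr m (r x) * w j x))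
            + chi R x * (\<Sum>j\<in>UNIV. dtr m (r x) * Q j x * w j x))
      = (LINT x:- \<Gamma>|lborel. chi R x * 0)" for m
  proof -
    let ?f = "\<lambda>j x. tr m (r x) * w j x"
    let ?df = "\<lambda>j x. dtr m (r x) * Q j x * w j x + tr m (r x) * W j j x"
    have s: "(\<Sum>j\<in>UNIV. ?df j x) = (\<Sum>j\<in>UNIV. dtr m (r x) * Q j x * w j x)" if "x \<in> lower_half" for x
      using incompressible[OF that] by (simp add: sum.distrib sum_distrib_left[symmetric])
    have "(LINT x:lower_half|lborel. (\<Sum>j\<in>UNIV. dchi R j x * ?f j x) + chi R x * (\<Sum>j\<in>UNIV. ?df j x))
      = (LINT x:- \<Gamma>|lborel. chi R x * ?f 3 (emb x))"
    proof (rule gauss_off_curve[OF R])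
      show "continuous_on (closure lower_half - emb ` \<Gamma>) (?f j)" for j
        by (intro continuous_intros trc w_cont r_cont)
      show "((\<lambda>t. ?f j (x + t *\<^sub>R axis j 1)) has_real_derivative ?df j x) (at 0)" if "x \<in> lower_half" for j x
      proof -
        have "((\<lambda>t. tr m (r (x + t *\<^sub>R axis j 1))) has_real_derivative dtr m (r (x + 0 *\<^sub>R axis j 1)) * Q j x) (at 0)"
          unfolding tr_def dtr_def by (rule DERIV_chain2[OF trunc_derivative r_der[OF that]]) simp
        from DERIV_mult[OF this w_der[OF that]] show ?thesis by (rule DERIV_cong) simp
      qed
      show "continuous_on lower_half (?df j)" for j
        by (intro continuous_intros trc w_cont_lower W_cont_lower r_cont_lower Q_cont)
      show "locally_L2 (?f j)" for j
        unfolding tr_def by (intro truncated_mult_locally_L2 r_cont_lower w_L2) auto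
      have "set_integrable lborel lower_half (\<lambda>x. chi R x * (dtr m (r x) * Q j x * w j x))" for j
        unfolding dtr_def by (intro integrable_chi_mult truncated_mult_locally_L2 r_cont_lower Q_loc w_L2 R) auto
      then have "set_integrable lborel lower_half (\<lambda>x. chi R x * (\<Sum>j\<in>UNIV. dtr m (r x) * Q j x * w j x))"
        unfolding sum_3 distrib_left by (intro set_integral_add(1)) simp_all
      then show "set_integrable lborel lower_half (\<lambda>x. chi R x * (\<Sum>j\<in>UNIV. ?df j x))"
        by (rule set_integrable_cong[THEN iffD1, rotated 3]) (simp_all add: s)
      show "\<bar>?f 3 (emb x)\<bar> \<le> 0" if "x \<notin> \<Gamma>" "norm x \<le> R" for x
        using no_flux that by simp
    qed
    moreover have "(LINT x:lower_half|lborel. (\<Sum>j\<in>UNIV. dchi R j x * ?f j x) + chi R x * (\<Sum>j\<in>UNIV. ?df j x))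
      = (LINT x:lower_half|lborel. (\<Sum>j\<in>UNIV. dchi R j x * ?f j x) + chi R x * (\<Sum>j\<in>UNIV. dtr m (r x) * Q j x * w j x))"
      by (rule set_lebesgue_integral_cong) (auto simp: s lower_half_sets)
    moreover have "(LINT x:- \<Gamma>|lborel. chi R x * ?f 3 (emb x)) = (LINT x:- \<Gamma>|lborel. chi R x * 0)"
      using \<Gamma>_sets by (intro set_lebesgue_integral_cong) (auto simp: no_flux)
    ultimately show ?thesis by simp
  qed
  have "(LINT x:lower_half|lborel. (\<Sum>j\<in>UNIV. dchi R j x * (r x * w j x)) + chi R x * (\<Sum>j\<in>UNIV. Q j x * w j x))
      = (LINT x:- \<Gamma>|lborel. chi R x * 0)"
  proof (rule gauss_limit[OF R eq])
    show "continuous_on lower_half (\<lambda>x. tr m (r x) * w j x)"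
      "continuous_on lower_half (\<lambda>x. \<Sum>j\<in>UNIV. dtr m (r x) * Q j x * w j x)" for m j
      by (intro continuous_intros trc w_cont_lower r_cont_lower Q_cont)+
    show "continuous_on lower_half (\<lambda>x. r x * w j x)"
      "continuous_on lower_half (\<lambda>x. \<Sum>j\<in>UNIV. Q j x * w j x)" for j
      by (intro continuous_intros w_cont_lower r_cont_lower Q_cont)+
    show "set_integrable lborel lower_half (\<lambda>x. dchi R j x * (r x * w j x))" for j
      by (intro integrable_chi_mult R w_L2 r_L2)
    have "set_integrable lborel lower_half (\<lambda>x. chi R x * (\<bar>Q j x\<bar> * \<bar>w j x\<bar>))" for j
      by (intro integrable_chi_mult R locally_L2_abs w_L2 Q_loc)+
    then show "set_integrable lborel lower_half (\<lambda>x. chi R x * (\<Sum>j\<in>UNIV. \<bar>Q j x\<bar> * \<bar>w j x\<bar>))"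
      unfolding sum_3 distrib_left by (intro set_integral_add(1)) simp_all
    show "\<bar>\<Sum>j\<in>UNIV. dtr m (r x) * Q j x * w j x\<bar> \<le> (\<Sum>j\<in>UNIV. \<bar>Q j x\<bar> * \<bar>w j x\<bar>)" for m x
      proof (rule order_trans[OF sum_abs sum_mono])
        fix j
        show "\<bar>dtr m (r x) * Q j x * w j x\<bar> \<le> \<bar>Q j x\<bar> * \<bar>w j x\<bar>"
          using dtr_le[of m "r x"] mult_left_le_one_le[of "\<bar>Q j x\<bar> * \<bar>w j x\<bar>" "dtr m (r x)"]
          by (simp add: abs_mult mult.assoc)
      qed
    show "(\<lambda>m. tr m (r x) * w j x) \<longlonglongrightarrow> r x * w j x" for x j
      unfolding tr_def by (intro tendsto_intros trunc_tendsto)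
    have "(\<lambda>m. \<Sum>j\<in>UNIV. dtr m (r x) * Q j x * w j x) \<longlonglongrightarrow> (\<Sum>j\<in>UNIV. 1 * Q j x * w j x)" for x
      unfolding dtr_def by (intro tendsto_intros dtrunc_tendsto)
    then show "(\<lambda>m. \<Sum>j\<in>UNIV. dtr m (r x) * Q j x * w j x) \<longlonglongrightarrow> (\<Sum>j\<in>UNIV. Q j x * w j x)" for x
      by simp
    show "\<bar>tr m (r x) * w j x\<bar> \<le> \<bar>r x * w j x\<bar>" for m j x by (rule tr_le)
  qed auto
  then show ?thesis by simp
qed

end

section \<open>Bounded supports and fluxes at infinity\<close>

lemma bounded_compact_support:
  fixes f :: "'a::euclidean_space \<Rightarrow> real"
  assumes "continuous_on S f" "closed S" "\<And>x. norm x > R \<Longrightarrow> f x = 0"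
  obtains C where "0 \<le> C" "\<And>x. x \<in> S \<Longrightarrow> \<bar>f x\<bar> \<le> C"
proof -
  have "compact (S \<inter> cball 0 R)" using assms(2) by (intro closed_Int_compact) auto
  then obtain B where B: "0 \<le> B" "\<And>x. x \<in> S \<inter> cball 0 R \<Longrightarrow> \<bar>f x\<bar> \<le> B"
    using continuous_bounded_on_compact[OF continuous_on_subset[OF assms(1)]] by (metis Int_lower1)
  show ?thesis
  proof (rule that[OF B(1)])
    show "\<bar>f x\<bar> \<le> B" if "x \<in> S" for x
      using B(2)[of x] assms(3)[of x] that B(1) by (cases "norm x \<le> R") auto
  qed
qed

text \<open>Outside the unit ball each factor of \<open>bump 1 0 x\<close> is at least
  \<open>1 / (2 * (norm x)\<^sup>2)\<close>. Decay of order \<open>2 * CARD('n)\<close> is thereby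
  integrable at infinity without polar coordinates.\<close>

lemma bump_ge:
  fixes x :: "real^'n"
  assumes "norm x \<ge> 1"
  shows "1 / norm x ^ (2 * CARD('n)) \<le> 2 ^ CARD('n) * bump 1 0 x"
proof -
  have "(1 / (2 * (norm x)\<^sup>2)) ^ CARD('n) = (\<Prod>j\<in>(UNIV::'n set). 1 / (2 * (norm x)\<^sup>2))" by simp
  also have "\<dots> \<le> bump 1 0 x"
    unfolding bump_def
  proof (intro prod_mono conjI divide_left_mono mult_pos_pos one_plus_square_pos)
    fix j
    have "(x $ j)\<^sup>2 \<le> (norm x)\<^sup>2" using component_le_norm_cart[of x j] by (metis abs_ge_zero power2_abs power_mono)
    moreover have "1 \<le> (norm x)\<^sup>2" using assms by simp
    ultimately show "1 + (1 * (x $ j - 0 $ j))\<^sup>2 \<le> 2 * (norm x)\<^sup>2" by simp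
  qed (use assms in auto)
  finally have "(1 / (2 * (norm x)\<^sup>2)) ^ CARD('n) \<le> bump 1 0 x" .
  moreover have "(1 / (2 * (norm x)\<^sup>2)) ^ CARD('n) = 1 / norm x ^ (2 * CARD('n)) / 2 ^ CARD('n)"
    by (simp add: power_mult power_divide power_mult_distrib)
  ultimately have "2 ^ CARD('n) * (1 / norm x ^ (2 * CARD('n)) / 2 ^ CARD('n)) \<le> 2 ^ CARD('n) * bump 1 0 x"
    by (intro mult_left_mono) auto
  then show ?thesis by simp
qed

text \<open>Both bounds are uniform in \<open>R\<close>. The second is the scale invariance of the
  gradient of the cutoff and is worth one extra power of decay.\<close>

lemma abs_dchi_le_4:
  assumes "R \<ge> 1"
  shows "\<bar>dchi R j x\<bar> \<le> 4" "\<bar>dchi R j x\<bar> * norm x \<le> 4"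
proof -
  have "\<bar>dchi R j x\<bar> \<le> 4 \<and> \<bar>dchi R j x\<bar> * norm x \<le> 4"
  proof (cases "norm x < R")
    case True
    have d: "\<bar>dchi R j x\<bar> \<le> 4 * norm x / R\<^sup>2" by (rule abs_dchi_le)
    have "R * 1 \<le> R * R" using assms by (intro mult_left_mono) auto
    then have "norm x \<le> R\<^sup>2" using True by (simp add: power2_eq_square)
    then have "4 * norm x / R\<^sup>2 \<le> 4" using assms by (simp add: divide_le_eq)
    moreover have "4 * norm x / R\<^sup>2 * norm x \<le> 4"
    proof -
      have "norm x * norm x \<le> R * R" using True assms by (intro mult_mono) auto
      then show ?thesis using assms by (simp add: divide_le_eq power2_eq_square)
    qed
    ultimately show ?thesis using d mult_right_mono[OF d, of "norm x"] by auto
  next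
    case False
    then show ?thesis using dchi_eq_0[of R x j] assms by auto
  qed
  then show "\<bar>dchi R j x\<bar> \<le> 4" "\<bar>dchi R j x\<bar> * norm x \<le> 4" by auto
qed

text \<open>The factor \<open>dchi\<close> is at most \<open>4 / norm x\<close> whatever the radius,
  so decay of \<open>k\<close> of order \<open>2 * CARD('n) - 1\<close> yields a majorant comparable
  with \<open>bump 1 0\<close>, while \<open>dchi\<close> tends to 0 pointwise. In space the
  required order is 5, exactly that of \<open>w i * W i j\<close> and \<open>r * w j\<close>; in the
  plane it is 3, and \<open>b\<close> times the surface velocity has 4.\<close>

lemma dchi_integral_tendsto_0:
  fixes k :: "real^'n \<Rightarrow> real"
  assumes S: "S \<in> sets borel" and R0: "R0 \<ge> 1" and k: "continuous_on S k" "set_integrable lborel (S \<inter> cball 0 R0) k"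
    and d: "\<And>x. x \<in> S \<Longrightarrow> norm x \<ge> R0 \<Longrightarrow> \<bar>k x\<bar> * norm x ^ (2 * CARD('n) - 1) \<le> C"
  shows "set_integrable lborel S (\<lambda>x. dchi (real (Suc n)) j x * k x)"
    and "(\<lambda>n. LINT x:S|lborel. dchi (real (Suc n)) j x * k x) \<longlonglongrightarrow> 0"
proof -
  let ?N = "2 * CARD('n)"
  let ?C = "\<bar>C\<bar>"
  define G where "G x = 4 * (indicator (cball 0 R0) x * \<bar>k x\<bar>) + 4 * ?C * 2 ^ CARD('n) * bump 1 0 x" for x
  have "set_integrable lborel S (\<lambda>x. indicator (cball 0 R0) x * \<bar>k x\<bar>)"
    using set_integrable_abs[OF k(2)] unfolding set_integrable_def
    by (rule Bochner_Integration.integrable_cong[THEN iffD1, rotated 2]) (auto simp: indicator_def)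
  moreover have "set_integrable lborel S (bump 1 0 :: real^'n \<Rightarrow> real)"
    unfolding set_integrable_def using S by (intro integrable_mult_indicator bump_integral) auto
  ultimately have Gi: "set_integrable lborel S G"
    unfolding G_def by (intro set_integral_add(1) set_integrable_mult_right) auto
  have bd: "\<bar>dchi (real (Suc n)) j x * k x\<bar> \<le> G x" if "x \<in> S" for n x
  proof (cases "norm x \<le> R0")
    case True
    have "\<bar>dchi (real (Suc n)) j x * k x\<bar> \<le> 4 * \<bar>k x\<bar>"
      unfolding abs_mult by (intro mult_right_mono abs_dchi_le_4) auto
    then show ?thesis using True bump_pos[of 1 0 x] by (simp add: G_def add_increasing2 del: of_nat_Suc)
  next
    case False
    have n1: "norm x \<ge> 1" using False R0 by simp
    have p: "0 < norm x ^ ?N" using n1 by (intro zero_less_power) linarith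
    have "?N = Suc (?N - 1)" using zero_less_card_finite[where 'a='n] by linarith
    then have N: "norm x ^ ?N = norm x * norm x ^ (?N - 1)" by (metis power_Suc)
    have "\<bar>dchi (real (Suc n)) j x * k x\<bar> * norm x ^ ?N
        = (\<bar>dchi (real (Suc n)) j x\<bar> * norm x) * (\<bar>k x\<bar> * norm x ^ (?N - 1))"
      unfolding N abs_mult by (simp only: mult_ac)
    also have "\<dots> \<le> 4 * ?C"
      using d[OF that] False by (intro mult_mono abs_dchi_le_4) auto
    finally have "\<bar>dchi (real (Suc n)) j x * k x\<bar> \<le> 4 * ?C * (1 / norm x ^ ?N)"
      by (simp add: pos_le_divide_eq[OF p])
    also have "\<dots> \<le> 4 * ?C * (2 ^ CARD('n) * bump 1 0 x)"
      by (intro mult_left_mono bump_ge n1) auto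
    finally show ?thesis using False by (simp add: G_def mult.assoc)
  qed
  have c: "continuous_on S (\<lambda>x. dchi (real (Suc n)) j x * k x)" for n
    by (intro continuous_on_mult continuous_dchi k)
  show "set_integrable lborel S (\<lambda>x. dchi (real (Suc n)) j x * k x)" for n
    by (rule set_integrable_continuous_bound[OF c S Gi bd])
  have "(\<lambda>n. LINT x:S|lborel. dchi (real (Suc n)) j x * k x) \<longlonglongrightarrow> (LINT x:S|lborel. 0)"
  proof (rule set_dominated_convergence(2)[OF _ _ Gi])
    show "AE x\<in>S in lborel. (\<lambda>n. dchi (real (Suc n)) j x * k x) \<longlonglongrightarrow> 0"
      by (intro always_eventually allI impI tendsto_mult_left_zero dchi_tendsto_0)
    show "\<bar>dchi (real (Suc n)) j x * k x\<bar> \<le> G x" if "x \<in> S" for n x using that by (rule bd)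
  qed (use S in \<open>auto intro!: set_measurable_continuous continuous_intros continuous_dchi k\<close>)
  then show "(\<lambda>n. LINT x:S|lborel. dchi (real (Suc n)) j x * k x) \<longlonglongrightarrow> 0" by simp
qed

section \<open>The work of the surface pressure\<close>

context stokes_difference begin

lemma b_lipschitz: "\<exists>M. M-lipschitz_on (cball 0 R) b"
proof -
  obtain C1 C2 where C: "\<forall>x. x \<notin> \<Gamma> \<longrightarrow> norm x \<le> R + 1 \<longrightarrow> \<bar>Bd 1 x\<bar> \<le> C1" "\<forall>x. x \<notin> \<Gamma> \<longrightarrow> norm x \<le> R + 1 \<longrightarrow> \<bar>Bd 2 x\<bar> \<le> C2"
    using Bd_bdd by metis
  have "(\<bar>C1\<bar> + \<bar>C2\<bar>)-lipschitz_on (ball 0 (R + 1)) b"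
  proof (rule b_lip)
    show "\<bar>Bd 1 x\<bar> + \<bar>Bd 2 x\<bar> \<le> \<bar>C1\<bar> + \<bar>C2\<bar>" if "x \<notin> \<Gamma>" "norm x < R + 1" for x
      using C that by (intro add_mono) (auto intro: order_trans[OF _ abs_ge_self])
  qed simp
  then have "(\<bar>C1\<bar> + \<bar>C2\<bar>)-lipschitz_on (cball 0 R) b"
    by (rule lipschitz_on_subset) auto
  then show ?thesis by blast
qed

lemma b_bdd: "\<exists>C\<ge>0. \<forall>x. norm x \<le> R \<longrightarrow> \<bar>b x\<bar> \<le> C"
  using continuous_bounded_on_compact[OF continuous_on_subset[OF b_cont subset_UNIV] compact_cball[of 0 R]]
  by (metis mem_cball_0)

lemma continuous_b_par: "continuous_on X (\<lambda>x. b (par x))"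
  by (rule continuous_on_compose2[OF b_cont continuous_par]) auto

text \<open>The surface velocity is the trace of a field with square integrable gradient, so it cannot see a
  curve: with \<open>v = w (up k)\<close>, the boundary integral of \<open>b v \<partial>\<^sub>k cut\<close> equals the half-space integral of
  \<open>\<partial>\<^sub>3 (b v \<partial>\<^sub>k cut)\<close>, and in the term with \<open>\<partial>\<^sub>3 \<partial>\<^sub>k cut\<close> the derivative \<open>\<partial>\<^sub>k\<close> is moved onto \<open>b v\<close>. What remains is
  linear in the gradient of \<open>cut\<close>, hence tends to zero. This replaces the divergence theorem on the
  two sides of the curve.\<close>

lemma boundary_cutoff_term:
  assumes R: "R > 0"
  shows "(\<lambda>n. LINT x|lborel. dcut (Suc n) (up k) (emb x) * (chi R x * (b x * w (up k) (emb x)))) \<longlonglongrightarrow> 0"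
proof -
  \<comment> \<open>The extra 1 in the radius leaves room for the shifts of length at most 1 in
    \<open>weighted_line_derivative\<close>.\<close>
  obtain M where "M-lipschitz_on (cball 0 (R + 1)) b" using b_lipschitz by blast
  then have lip: "\<And>x y. x \<in> cball 0 (R + 1) \<Longrightarrow> y \<in> cball 0 (R + 1) \<Longrightarrow> dist (b x) (b y) \<le> M * dist x y" and "0 \<le> M"
    by (auto dest: lipschitz_onD lipschitz_on_nonneg)
  obtain B where B: "0 \<le> B" "\<And>x. norm x \<le> R \<Longrightarrow> \<bar>b x\<bar> \<le> B" using b_bdd by metis
  define \<beta> where "\<beta> y = b (par y)" for y
  have c\<beta>: "continuous_on X \<beta>" for X unfolding \<beta>_def by (rule continuous_b_par)
  have \<beta>B: "\<bar>z * \<beta> x\<bar> \<le> c * B * indicator (cball 0 R) x" if "\<bar>z\<bar> \<le> c * indicator (cball 0 R) x" "0 \<le> c" for z c x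
  proof (cases "norm x \<le> R")
    case True
    then have "\<bar>\<beta> x\<bar> \<le> B" unfolding \<beta>_def by (intro B order_trans[OF norm_par_le])
    then have "\<bar>z\<bar> * \<bar>\<beta> x\<bar> \<le> c * B" using that True B by (intro mult_mono) auto
    then show ?thesis using True by (simp add: abs_mult)
  next
    case False
    then show ?thesis using that by simp
  qed
  define v where "v = w (up k)"
  define z1 where "z1 y = dchi R 3 y * \<beta> y" for y
  define z2 where "z2 y = chi R y * \<beta> y" for y
  define z3 where "z3 y = dchi R (up k) y * \<beta> y" for y
  have z: "continuous_on X z1" "continuous_on X z2" "continuous_on X z3" for X
    unfolding z1_def z2_def z3_def by (intro continuous_intros continuous_dchi continuous_chi c\<beta>)+
  have zb: "\<bar>z1 y\<bar> \<le> 4 / R * B * indicator (cball 0 R) y" "\<bar>z2 y\<bar> \<le> 1 * B * indicator (cball 0 R) y"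
     "\<bar>z3 y\<bar> \<le> 4 / R * B * indicator (cball 0 R) y" for y
    using \<beta>B[OF abs_dchi_le_indicator[OF R, of 3 y]] \<beta>B[OF chi_bound[OF R, of y]]
      \<beta>B[OF abs_dchi_le_indicator[OF R, of "up k" y]] R unfolding z1_def z2_def z3_def by auto
  \<comment> \<open>All terms linear in the gradient of the cutoff. The negative ones compensate for
    completing the second derivative of the cutoff to the full derivative \<open>f'\<close>.\<close>
  define I where "I n = (LINT x:lower_half|lborel. dcut (Suc n) (up k) x * (z1 x * v x))
     + (LINT x:lower_half|lborel. dcut (Suc n) (up k) x * (z2 x * W (up k) 3 x))
     - (LINT x:lower_half|lborel. dcut (Suc n) 3 x * (z3 x * v x))
     - (LINT x:lower_half|lborel. dcut (Suc n) 3 x * (z2 x * W (up k) (up k) x))" for n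
  note wn1 = dcut_weakly_null_L2[OF w_L2[of "up k", folded v_def] z(1) zb(1)]
  note wn2 = dcut_weakly_null_L2[OF W_loc[of "up k" 3] z(2) zb(2)]
  note wn3 = dcut_weakly_null_L2[OF w_L2[of "up k", folded v_def] z(3) zb(3)]
  note wn4 = dcut_weakly_null_L2[OF W_loc[of "up k" "up k"] z(2) zb(2)]
  note wn5 = dcut_weakly_null_L2[OF w_L2[of "up k", folded v_def] continuous_chi chi_bound[OF R]]
  have I0: "I \<longlonglongrightarrow> 0"
    unfolding I_def using tendsto_diff[OF tendsto_diff[OF tendsto_add[OF wn1(2) wn2(2)] wn3(2)] wn4(2)] by simp
  define J where "J n y = dcut (Suc n) (up k) y * (z1 y * v y) + dcut (Suc n) (up k) y * (z2 y * W (up k) 3 y)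
        - dcut (Suc n) 3 y * (z3 y * v y) - dcut (Suc n) 3 y * (z2 y * W (up k) (up k) y)" for n y
  have Ji: "set_integrable lborel lower_half (J n)" and JI: "(LINT y:lower_half|lborel. J n y) = I n" for n
  proof -
    have i12: "set_integrable lborel lower_half (\<lambda>y. dcut (Suc n) (up k) y * (z1 y * v y) + dcut (Suc n) (up k) y * (z2 y * W (up k) 3 y))"
      by (intro set_integral_add(1) wn1(1) wn2(1))
    have i123: "set_integrable lborel lower_half (\<lambda>y. dcut (Suc n) (up k) y * (z1 y * v y) + dcut (Suc n) (up k) y * (z2 y * W (up k) 3 y)
        - dcut (Suc n) 3 y * (z3 y * v y))"
      by (intro set_integral_diff(1) i12 wn3(1))
    show "set_integrable lborel lower_half (J n)" unfolding J_def by (intro set_integral_diff(1) i123 wn4(1))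
    show "(LINT y:lower_half|lborel. J n y) = I n"
      unfolding J_def I_def set_integral_diff(2)[OF i123 wn4(1)] set_integral_diff(2)[OF i12 wn3(1)]
        set_integral_add(2)[OF wn1(1) wn2(1)] ..
  qed
  define f where "f n y = dcut (Suc n) 3 y * (chi R y * v y)" for n y
  define f' where "f' n y = ddcut (Suc n) 3 (up k) y * (chi R y * v y)
      + dcut (Suc n) 3 y * (dchi R (up k) y * v y + chi R y * W (up k) (up k) y)" for n y
  have vc: "continuous_on (closure lower_half - emb ` \<Gamma>) v" unfolding v_def by (rule w_cont)
  have sub: "continuous_on lower_half h" if "continuous_on (closure lower_half) h" for h :: "real^3 \<Rightarrow> real"
    using that closure_subset by (rule continuous_on_subset)
  have fc: "continuous_on (closure lower_half) (f n)" for n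
    unfolding f_def by (rule continuous_cut_mult) (auto intro!: continuous_intros continuous_chi vc)
  have f'c: "continuous_on (closure lower_half) (f' n)" for n
    unfolding f'_def by (intro continuous_on_add continuous_cut_mult)
      (auto intro!: continuous_intros continuous_chi continuous_dchi vc W_cont)
  \<comment> \<open>What is left after subtracting \<open>I n\<close> is the integral of
    \<open>\<beta> * f'\<close>, with \<open>f'\<close> the derivative of \<open>f\<close> in
    direction \<open>up k\<close>. The Lipschitz weight takes over that derivative, and
    \<open>f\<close> itself is linear in the gradient of the cutoff.\<close>
  have main: "\<bar>(LINT x|lborel. dcut (Suc n) (up k) (emb x) * (chi R x * (b x * v (emb x)))) - I n\<bar>
      \<le> M * (LINT x:lower_half|lborel. \<bar>f n x\<bar>)" for n
  proof -
    let ?F3 = "\<lambda>y. dcut (Suc n) (up k) y * (chi R y * (\<beta> y * v y))"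
    let ?D3 = "\<lambda>y. ddcut (Suc n) (up k) 3 y * (chi R y * (\<beta> y * v y))
        + dcut (Suc n) (up k) y * (dchi R 3 y * (\<beta> y * v y) + chi R y * (\<beta> y * W (up k) 3 y))"
    have F3c: "continuous_on (closure lower_half) ?F3"
      by (rule continuous_cut_mult) (auto intro!: continuous_intros continuous_chi vc c\<beta>)
    have D3c: "continuous_on (closure lower_half) ?D3"
      by (intro continuous_on_add continuous_cut_mult)
        (auto intro!: continuous_intros continuous_chi continuous_dchi vc W_cont c\<beta>)
    have D30: "?D3 y = 0" "f' n y = 0" "f n y = 0" "?F3 y = 0" if "norm y > R" for y
      using chi_eq_0[OF R, of y] dchi_eq_0[OF R, of y] that by (auto simp: f_def f'_def)
    have D3i: "set_integrable lborel lower_half ?D3"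
    proof -
      obtain C where "0 \<le> C" "\<And>y. y \<in> closure lower_half \<Longrightarrow> \<bar>?D3 y\<bar> \<le> C"
        using bounded_compact_support[OF D3c closed_closure D30(1)] by blast
      then show ?thesis
        using closure_subset[of lower_half]
        by (intro set_integrable_compact_support[OF sub[OF D3c] lower_half_sets, where C = C and R = R]) (auto simp: D30)
    qed
    have "(LINT x|lborel. ?F3 (emb x)) = (LINT x:lower_half|lborel. ?D3 x)"
    proof -
      \<comment> \<open>A field with a vertical component only, so the divergence theorem becomes
        integration in the third coordinate.\<close>
      let ?F = "\<lambda>j y. if j = (3::3) then ?F3 y else 0" and ?D = "\<lambda>j y. if j = (3::3) then ?D3 y else 0"
      have s: "(\<Sum>j\<in>UNIV. ?D j y) = ?D3 y" for y by (simp add: sum_3)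
      have "(LINT x:lower_half|lborel. \<Sum>j\<in>UNIV. ?D j x) = (LINT x|lborel. ?F 3 (emb x))"
      proof (rule half_space_divergence[where F = ?F and D = ?D and R = R])
        show "((\<lambda>t. ?F j (x + t *\<^sub>R axis j 1)) has_real_derivative ?D j x) (at 0)" if "x \<in> lower_half" for j x
        proof (cases "j = 3")
          case True
          have bconst: "((\<lambda>t. \<beta> (x + t *\<^sub>R axis 3 1)) has_real_derivative 0) (at 0)"
            by (simp add: \<beta>_def par_line)
          have "((\<lambda>t. ?F3 (x + t *\<^sub>R axis 3 1)) has_real_derivative ?D3 x) (at 0)"
            by (rule DERIV_cong[OF DERIV_mult[OF dcut_derivative[OF up_neq_3(1)] DERIV_mult[OF chi_derivative
                  DERIV_mult[OF bconst w_der[OF that, of "up k", folded v_def]]]]]) (simp add: algebra_simps)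
          then show ?thesis using True by simp
        qed simp
        show "continuous_on lower_half (?D j)" for j using sub[OF D3c] by (cases "j = 3") auto
        show "continuous_on lower_half (?F j)" for j using sub[OF F3c] by (cases "j = 3") auto
        show "continuous_on (closure lower_half) (?F 3)" using F3c by simp
        show "?F j x = 0" if "norm x > R" for j x using D30(4)[OF that] by simp
        show "set_integrable lborel lower_half (\<lambda>x. \<Sum>j\<in>UNIV. ?D j x)" unfolding s by (rule D3i)
      qed
      then show ?thesis unfolding s by simp
    qed
    moreover have "(LINT y:lower_half|lborel. ?D3 y) = (LINT y:lower_half|lborel. \<beta> y * f' n y) + I n"
    proof -
      have split: "?D3 y - J n y = \<beta> y * f' n y" for y
        by (simp add: J_def f'_def z1_def z2_def z3_def ddcut_commute[of _ "up k" 3] algebra_simps)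
      show ?thesis
        using set_integral_diff(2)[OF D3i Ji[of n]] unfolding split JI by simp
    qed
    moreover have "\<bar>LINT y:lower_half|lborel. \<beta> y * f' n y\<bar> \<le> M * (LINT x:lower_half|lborel. \<bar>f n x\<bar>)"
    proof -
      obtain C1 where C1: "0 \<le> C1" "\<And>y. y \<in> closure lower_half \<Longrightarrow> \<bar>f n y\<bar> \<le> C1"
        using bounded_compact_support[OF fc closed_closure D30(3)] by blast
      obtain C2 where C2: "0 \<le> C2" "\<And>y. y \<in> closure lower_half \<Longrightarrow> \<bar>f' n y\<bar> \<le> C2"
        using bounded_compact_support[OF f'c closed_closure D30(2)] by blast
      show ?thesis
      proof (rule weighted_line_derivative[where e = "axis (up k) 1" and C = "max C1 C2" and R = R])
        show "x + t *\<^sub>R axis (up k) 1 \<in> lower_half" if "x \<in> lower_half" for x t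
          using that up_neq_3[of k] by (simp add: lower_half_def axis_def)
        show "((\<lambda>t. f n (x + t *\<^sub>R axis (up k) 1)) has_real_derivative f' n x) (at 0)" if "x \<in> lower_half" for x
          unfolding f_def
          by (rule DERIV_cong[OF DERIV_mult[OF dcut_derivative[OF up_neq_3(2)] DERIV_mult[OF chi_derivative
                w_der[OF that, of "up k", folded v_def]]]]) (simp add: f'_def v_def algebra_simps)
        show "\<bar>\<beta> (x + t *\<^sub>R axis (up k) 1) - \<beta> x\<bar> \<le> M * \<bar>t\<bar>" if "norm x \<le> R" "\<bar>t\<bar> \<le> 1" for x t
        proof -
          have "norm (par x) \<le> R" using that norm_par_le order_trans by blast
          moreover have "norm (par x + t *\<^sub>R axis k 1) \<le> norm (par x) + \<bar>t\<bar>"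
            using norm_triangle_ineq[of "par x" "t *\<^sub>R axis k 1"] by simp
          ultimately have "par x + t *\<^sub>R axis k 1 \<in> cball 0 (R + 1)" "par x \<in> cball 0 (R + 1)"
            using that unfolding mem_cball_0 by linarith+
          from lip[OF this] show ?thesis by (simp add: \<beta>_def par_line dist_norm)
        qed
        show "\<bar>f n x\<bar> \<le> max C1 C2" "\<bar>f' n x\<bar> \<le> max C1 C2" if "x \<in> lower_half" for x
          using C1(2)[of x] C2(2)[of x] that closure_subset[of lower_half] by (auto simp: le_max_iff_disj)
        show "continuous_on lower_half (f n)" "continuous_on lower_half (f' n)" "continuous_on UNIV \<beta>"
          by (rule sub[OF fc], rule sub[OF f'c], rule c\<beta>)
        show "f n x = 0" if "norm x > R" for x using that by (rule D30(3))
      qed (rule lower_half_sets)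
    qed
    ultimately show ?thesis by (simp add: \<beta>_def par_emb chi_emb)
  qed
  have "(\<lambda>n. M * (LINT x:lower_half|lborel. \<bar>f n x\<bar>)) \<longlonglongrightarrow> M * 0"
    using wn5(4)[of 3] by (intro tendsto_intros) (simp add: f_def abs_mult)
  then have lim0: "(\<lambda>n. M * (LINT x:lower_half|lborel. \<bar>f n x\<bar>)) \<longlonglongrightarrow> 0" by simp
  have "(\<lambda>n. (LINT x|lborel. dcut (Suc n) (up k) (emb x) * (chi R x * (b x * v (emb x)))) - I n) \<longlonglongrightarrow> 0"
  proof (rule Lim_null_comparison[OF always_eventually[OF allI] lim0])
    show "norm ((LINT x|lborel. dcut (Suc n) (up k) (emb x) * (chi R x * (b x * v (emb x)))) - I n)
      \<le> M * (LINT x:lower_half|lborel. \<bar>f n x\<bar>)" for n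
      unfolding real_norm_def by (rule main)
  qed
  from tendsto_add[OF this I0] show ?thesis by (simp add: v_def)
qed

text \<open>Incompressibility of the surface velocity tested with \<open>b\<close>. With both
  cutoffs in place the \<open>k\<close>-th product is differentiable in direction \<open>k\<close>
  at every point of the plane, so each \<open>D k\<close> integrates to zero. Summing over
  \<open>k\<close> removes the derivatives of the surface velocity, and
  \<open>boundary_cutoff_term\<close> disposes of the terms with the gradient of
  \<open>cut\<close>.\<close>

lemma planar_work:
  assumes R: "R > 0"
  shows "(LINT x:- \<Gamma>|lborel. (\<Sum>k\<in>UNIV. dchi R k x * (b x * w (up k) (emb x)))
      + chi R x * (\<Sum>k\<in>UNIV. Bd k x * w (up k) (emb x))) = 0"
proof -
  define a where "a k x = w (up k) (emb x)" for k x
  have ac: "continuous_on (- \<Gamma>) (a k)" for k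
    unfolding a_def by (intro continuous_emb_off_curve w_cont)
  have bc: "continuous_on X b" for X using b_cont by (rule continuous_on_subset) simp
  define H where "H x = (\<Sum>k\<in>UNIV. dchi R k x * (b x * a k x)) + chi R x * (\<Sum>k\<in>UNIV. Bd k x * a k x)" for x
  have Hc: "continuous_on (- \<Gamma>) H"
    unfolding H_def by (intro continuous_intros continuous_dchi continuous_chi bc ac Bd_cont)
  obtain B where B: "0 \<le> B" "\<And>x. norm x \<le> R \<Longrightarrow> \<bar>b x\<bar> \<le> B" using b_bdd by metis
  obtain Ca where Ca: "\<And>k x. x \<notin> \<Gamma> \<Longrightarrow> norm x \<le> R \<Longrightarrow> \<bar>a k x\<bar> \<le> Ca k" using a_bdd unfolding a_def by metis
  obtain Cb where Cb: "\<And>k x. x \<notin> \<Gamma> \<Longrightarrow> norm x \<le> R \<Longrightarrow> \<bar>Bd k x\<bar> \<le> Cb k" using Bd_bdd by metis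
  define C where "C = (\<Sum>k\<in>(UNIV::2 set). 4 / R * (B * \<bar>Ca k\<bar>)) + 1 * (\<Sum>k\<in>UNIV. \<bar>Cb k\<bar> * \<bar>Ca k\<bar>)"
  have Hb: "\<bar>H x\<bar> \<le> C * indicator (cball 0 R) x" if "x \<in> - \<Gamma>" for x
  proof (cases "norm x \<le> R")
    case True
    have a: "\<bar>a k x\<bar> \<le> \<bar>Ca k\<bar>" "\<bar>Bd k x\<bar> \<le> \<bar>Cb k\<bar>" for k
      using Ca[of x k] Cb[of x k] that True by (auto intro: order_trans[OF _ abs_ge_self])
    have d: "\<bar>dchi R k x\<bar> \<le> 4 / R" for k using abs_dchi_le_indicator[OF R, of k x] True by simp
    have c: "\<bar>chi R x\<bar> \<le> 1" using chi_range[of R x] by simp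
    have "\<bar>H x\<bar> \<le> C"
      unfolding H_def C_def
    proof (rule order_trans[OF abs_triangle_ineq add_mono])
      show "\<bar>\<Sum>k\<in>UNIV. dchi R k x * (b x * a k x)\<bar> \<le> (\<Sum>k\<in>UNIV. 4 / R * (B * \<bar>Ca k\<bar>))"
      proof (rule order_trans[OF sum_abs sum_mono])
        show "\<bar>dchi R k x * (b x * a k x)\<bar> \<le> 4 / R * (B * \<bar>Ca k\<bar>)" for k
          unfolding abs_mult using R B(1) by (intro mult_mono d a B True) auto
      qed
      show "\<bar>chi R x * (\<Sum>k\<in>UNIV. Bd k x * a k x)\<bar> \<le> 1 * (\<Sum>k\<in>UNIV. \<bar>Cb k\<bar> * \<bar>Ca k\<bar>)"
        unfolding abs_mult
        by (intro mult_mono c order_trans[OF sum_abs sum_mono]) (auto simp: abs_mult intro!: mult_mono a sum_nonneg)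
    qed
    then show ?thesis using True by simp
  qed (use chi_eq_0[OF R, of x] dchi_eq_0[OF R, of x] in \<open>auto simp: H_def\<close>)
  have Hi: "set_integrable lborel (- \<Gamma>) H"
    by (rule set_integrable_continuous_bound[OF Hc \<Gamma>_sets set_integrable_const_cball[OF \<Gamma>_sets] Hb])
  have cutb: "\<bar>cut n x * y\<bar> \<le> \<bar>y\<bar>" for n x y
    using cut_range[of n x] by (simp add: abs_mult mult_left_le_one_le)
  have cce: "continuous_on X (\<lambda>x. cut n (emb x))" for X n
    by (rule continuous_on_compose2[OF continuous_cut[of UNIV] continuous_emb]) auto
  have cutHi: "set_integrable lborel (- \<Gamma>) (\<lambda>x. cut (Suc n) (emb x) * H x)" for n
    by (rule set_integrable_continuous_bound[OF continuous_on_mult[OF cce Hc] \<Gamma>_sets set_integrable_abs[OF Hi] cutb])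
  have lim: "(\<lambda>n. LINT x:- \<Gamma>|lborel. cut (Suc n) (emb x) * H x) \<longlonglongrightarrow> (LINT x:- \<Gamma>|lborel. H x)"
  proof (rule set_dominated_convergence(2)[OF _ _ set_integrable_abs[OF Hi]])
    show "AE x\<in>- \<Gamma> in lborel. (\<lambda>n. cut (Suc n) (emb x) * H x) \<longlonglongrightarrow> H x"
      using tendsto_mult[OF cut_emb_tendsto_1 tendsto_const] by (auto intro!: always_eventually)
  qed (use \<Gamma>_sets cutb in \<open>auto intro!: set_measurable_continuous continuous_on_mult cce Hc\<close>)
  define E where "E n k x = dcut (Suc n) (up k) (emb x) * (chi R x * (b x * a k x))" for n k x
  have Ec: "continuous_on UNIV (E n k)" for n k
    unfolding E_def by (rule continuous_cut_mult_planar) (auto intro!: continuous_intros continuous_chi bc ac)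
  have cint: "set_integrable lborel X h" if h: "continuous_on UNIV h" "\<And>x. norm x > R \<Longrightarrow> h x = 0" and X: "X \<in> sets borel"
    for h :: "real^2 \<Rightarrow> real" and X
  proof -
    obtain C where C: "\<And>y. \<bar>h y\<bar> \<le> C"
      using bounded_compact_support[OF h(1) closed_UNIV h(2)] by (metis UNIV_I)
    show ?thesis
    proof (rule set_integrable_compact_support[OF _ X C h(2)])
      show "continuous_on X h" using h(1) by (rule continuous_on_subset) simp
    qed
  qed
  have E0: "E n k x = 0" if "norm x > R" for n k x using chi_eq_0[OF R, of x] that by (simp add: E_def)
  have Ei: "set_integrable lborel (- \<Gamma>) (E n k)" for n k
    by (rule cint[OF Ec E0 \<Gamma>_sets])
  have zero: "(\<Sum>k\<in>UNIV. LINT x|lborel. E n k x) + (LINT x:- \<Gamma>|lborel. cut (Suc n) (emb x) * H x) = 0" for n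
  proof -
    let ?F = "\<lambda>k x. cut (Suc n) (emb x) * (chi R x * (b x * a k x))"
    define D where "D k x = E n k x + cut (Suc n) (emb x) * (dchi R k x * (b x * a k x) + chi R x * (Bd k x * a k x + b x * A k x))" for k x
    have Fc: "continuous_on UNIV (?F k)" for k
      by (rule continuous_cut_mult_planar) (auto intro!: continuous_intros continuous_chi bc ac)
    have Dc: "continuous_on UNIV (D k)" for k
      unfolding D_def by (intro continuous_on_add[OF Ec] continuous_cut_mult_planar)
        (auto intro!: continuous_intros continuous_chi continuous_dchi bc ac Bd_cont A_cont)
    have D0: "D k x = 0" "?F k x = 0" if "norm x > R" for k x
      using chi_eq_0[OF R, of x] dchi_eq_0[OF R, of x] that by (auto simp: D_def E_def)
    have Di: "set_integrable lborel (- \<Gamma>) (D k)" for k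
      by (rule cint[OF Dc D0(1) \<Gamma>_sets])
    have "(LINT x|lborel. D k x) = 0" for k
    proof -
      obtain C1 where C1: "\<And>x. \<bar>?F k x\<bar> \<le> C1"
        using bounded_compact_support[OF Fc closed_UNIV D0(2)] by (metis UNIV_I)
      obtain C2 where C2: "\<And>x. \<bar>D k x\<bar> \<le> C2"
        using bounded_compact_support[OF Dc closed_UNIV D0(1)] by (metis UNIV_I)
      have "\<bar>LINT x:UNIV|lborel. 1 * D k x\<bar> \<le> 0 * (LINT x:UNIV|lborel. \<bar>?F k x\<bar>)"
      proof (rule weighted_line_derivative[where e = "axis k 1" and C = "max C1 C2" and R = R])
        fix x :: "real^2"
        show "((\<lambda>t. ?F k (x + t *\<^sub>R axis k 1)) has_real_derivative D k x) (at 0)"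
        proof (cases "x \<in> \<Gamma>")
          case False
          have "((\<lambda>t. cut (Suc n) (emb (x + t *\<^sub>R axis k 1))) has_real_derivative dcut (Suc n) (up k) (emb x)) (at 0)"
            unfolding emb_line by (rule cut_derivative)
          from DERIV_mult[OF this DERIV_mult[OF chi_derivative DERIV_mult[OF b_der[OF False] a_der[OF False]]]]
          show ?thesis unfolding a_def D_def E_def by (rule DERIV_cong) (simp add: algebra_simps)
        next
          \<comment> \<open>At a point of the curve neither \<open>b\<close> nor the surface
            velocity need be differentiable, but the cutoff vanishes in a whole
            neighbourhood.\<close>
          case True
          then have x: "emb x \<in> nbhd (Suc n)" using nbhd(2)[of "Suc n"] by auto
          have "\<forall>\<^sub>F t in nhds 0. x + t *\<^sub>R axis k 1 \<in> emb -` nbhd (Suc n)"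
            by (rule topological_tendstoD[OF _ open_emb_nbhd])
               (use x in \<open>auto intro!: tendsto_eq_intros filterlim_ident\<close>)
          then have "\<forall>\<^sub>F t in nhds 0. ?F k (x + t *\<^sub>R axis k 1) = 0"
            by eventually_elim (simp add: cut_eq_0)
          then have "((\<lambda>t. ?F k (x + t *\<^sub>R axis k 1)) has_real_derivative 0) (at 0)"
            by (subst DERIV_cong_ev[OF refl _ refl, of _ "\<lambda>_. 0"]) auto
          moreover have "D k x = 0" using x by (simp add: D_def E_def cut_eq_0 dcut_eq_0)
          ultimately show ?thesis by simp
        qed
      qed (use C1 C2 D0 Fc Dc in \<open>auto simp: le_max_iff_disj\<close>)
      then show ?thesis by (simp add: set_lebesgue_integral_def)
    qed
    then have "(\<Sum>k\<in>UNIV. LINT x:- \<Gamma>|lborel. D k x) = 0"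
      using planar_integral_eq[OF Dc] by simp
    also have "(\<Sum>k\<in>UNIV. LINT x:- \<Gamma>|lborel. D k x) = (LINT x:- \<Gamma>|lborel. \<Sum>k\<in>UNIV. D k x)"
      by (simp add: sum_2 set_integral_add Di)
    also have "\<dots> = (LINT x:- \<Gamma>|lborel. (\<Sum>k\<in>UNIV. E n k x) + cut (Suc n) (emb x) * H x)"
    proof (rule set_lebesgue_integral_cong)
      show "\<forall>x. x \<in> - \<Gamma> \<longrightarrow> (\<Sum>k\<in>UNIV. D k x) = (\<Sum>k\<in>UNIV. E n k x) + cut (Suc n) (emb x) * H x"
      proof (intro allI impI)
        fix x assume "x \<in> - \<Gamma>"
        then have "A 2 x = - A 1 x" using A_sum[of x] by (simp add: sum_2)
        then show "(\<Sum>k\<in>UNIV. D k x) = (\<Sum>k\<in>UNIV. E n k x) + cut (Suc n) (emb x) * H x"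
          by (simp add: sum_2 D_def H_def algebra_simps)
      qed
    qed (use \<Gamma>_sets in simp)
    also have "\<dots> = (\<Sum>k\<in>UNIV. LINT x:- \<Gamma>|lborel. E n k x) + (LINT x:- \<Gamma>|lborel. cut (Suc n) (emb x) * H x)"
      by (simp add: sum_2 set_integral_add Ei cutHi)
    finally show ?thesis using planar_integral_eq[OF Ec] by simp
  qed
  have "(\<lambda>n. (\<Sum>k\<in>UNIV. LINT x|lborel. E n k x) + (LINT x:- \<Gamma>|lborel. cut (Suc n) (emb x) * H x))
      \<longlonglongrightarrow> (\<Sum>k\<in>(UNIV::2 set). 0) + (LINT x:- \<Gamma>|lborel. H x)"
    unfolding E_def a_def by (intro tendsto_add tendsto_sum boundary_cutoff_term R lim[unfolded H_def a_def] lim)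
  then have "(LINT x:- \<Gamma>|lborel. H x) = 0" unfolding zero by (simp add: LIMSEQ_const_iff)
  then show ?thesis by (simp add: H_def a_def)
qed

end

lemma continuous_AE_eq_0:
  fixes f :: "'a::euclidean_space \<Rightarrow> real"
  assumes "open S" "continuous_on S f" "AE x\<in>S in lborel. f x = 0" "x \<in> S"
  shows "f x = 0"
proof -
  define U where "U = S \<inter> f -` (- {0})"
  have "open U" unfolding U_def by (rule continuous_open_preimage[OF assms(2,1)]) auto
  moreover have "AE x in lborel. x \<in> - U"
    using assms(3) by eventually_elim (auto simp: U_def)
  then have "AE x\<in>UNIV in lebesgue. x \<in> - U"
    by (simp add: AE_completion)
  ultimately have "x \<in> - U"
    using mem_closed_if_AE_lebesgue_open[of UNIV "- U" x] by (simp add: closed_Compl)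
  with assms(4) show ?thesis by (auto simp: U_def)
qed

section \<open>The energy identity and the vanishing of the difference\<close>

context stokes_difference begin

lemma decay_product:
  assumes "\<bar>h\<bar> \<le> C0 / norm x ^ m" "\<bar>k\<bar> \<le> C0 / norm x ^ n" "norm x \<ge> R0" "N = m + n"
  shows "\<bar>h * k\<bar> * norm x ^ N \<le> C0\<^sup>2"
proof -
  have p: "norm x > 0" using assms(3) R0 by linarith
  have h: "\<bar>h\<bar> * norm x ^ m \<le> C0" "\<bar>k\<bar> * norm x ^ n \<le> C0"
    using assms(1,2) p by (simp_all add: pos_le_divide_eq)
  have "\<bar>h * k\<bar> * norm x ^ N = (\<bar>h\<bar> * norm x ^ m) * (\<bar>k\<bar> * norm x ^ n)"
    by (simp add: assms(4) power_add abs_mult)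
  also have "\<dots> \<le> C0 * C0"
    using h by (intro mult_mono) (auto intro: order_trans[OF mult_nonneg_nonneg h(1)])
  finally show ?thesis by (simp add: power2_eq_square)
qed

lemma locally_L2_mult_integrable:
  assumes "locally_L2 h" "locally_L2 k"
  shows "set_integrable lborel (lower_half \<inter> cball 0 R) (\<lambda>x. h x * k x)"
proof (rule set_integrable_continuous_bound[OF _ lower_half_cball_sets])
  show "continuous_on (lower_half \<inter> cball 0 R) (\<lambda>x. h x * k x)"
    by (intro continuous_on_mult continuous_on_subset[OF locally_L2_continuous] assms) auto
  show "set_integrable lborel (lower_half \<inter> cball 0 R) (\<lambda>x. (h x)\<^sup>2 + (k x)\<^sup>2)"
    using assms by (intro set_integral_add(1)) (auto simp: locally_L2_def)
  show "\<bar>h x * k x\<bar> \<le> (h x)\<^sup>2 + (k x)\<^sup>2" for x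
  proof -
    have "2 * (\<bar>h x\<bar> * \<bar>k x\<bar>) \<le> (h x)\<^sup>2 + (k x)\<^sup>2"
      using zero_le_power2[of "\<bar>h x\<bar> - \<bar>k x\<bar>"] by (simp add: power2_diff)
    then show ?thesis
      using mult_nonneg_nonneg[OF abs_ge_zero[of "h x"] abs_ge_zero[of "k x"]] unfolding abs_mult by linarith
  qed
qed

lemma w_W_flux_tendsto_0:
  "set_integrable lborel lower_half (\<lambda>x. dchi (real (Suc n)) j x * (w i x * W i j x))"
  "(\<lambda>n. LINT x:lower_half|lborel. dchi (real (Suc n)) j x * (w i x * W i j x)) \<longlonglongrightarrow> 0"
  by (rule dchi_integral_tendsto_0[OF lower_half_sets R0 _ locally_L2_mult_integrable[OF w_L2 W_loc], where C = "C0\<^sup>2"];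
      (rule continuous_on_mult[OF w_cont_lower W_cont_lower] | rule decay_product[OF w_decay W_decay]; simp))+

lemma r_w_flux_tendsto_0:
  "set_integrable lborel lower_half (\<lambda>x. dchi (real (Suc n)) j x * (r x * w j x))"
  "(\<lambda>n. LINT x:lower_half|lborel. dchi (real (Suc n)) j x * (r x * w j x)) \<longlonglongrightarrow> 0"
  by (rule dchi_integral_tendsto_0[OF lower_half_sets R0 _ locally_L2_mult_integrable[OF r_L2 w_L2], where C = "C0\<^sup>2"];
      (rule continuous_on_mult[OF r_cont_lower w_cont_lower] | rule decay_product[OF r_decay w_decay]; simp))+

lemma b_a_flux_tendsto_0:
  "set_integrable lborel (- \<Gamma>) (\<lambda>x. dchi (real (Suc n)) k x * (b x * w (up k) (emb x)))"
  "(\<lambda>n. LINT x:- \<Gamma>|lborel. dchi (real (Suc n)) k x * (b x * w (up k) (emb x))) \<longlonglongrightarrow> 0"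
proof -
  have c: "continuous_on (- \<Gamma>) (\<lambda>x. b x * w (up k) (emb x))"
    by (intro continuous_on_mult continuous_on_subset[OF b_cont] continuous_emb_off_curve w_cont) auto
  obtain B where B: "0 \<le> B" "\<And>x. norm x \<le> R0 \<Longrightarrow> \<bar>b x\<bar> \<le> B" using b_bdd by metis
  obtain C where C: "\<And>x. x \<notin> \<Gamma> \<Longrightarrow> norm x \<le> R0 \<Longrightarrow> \<bar>w (up k) (emb x)\<bar> \<le> C" using a_bdd by metis
  have i: "set_integrable lborel (- \<Gamma> \<inter> cball 0 R0) (\<lambda>x. b x * w (up k) (emb x))"
  proof (rule set_integrable_compact_support[where C = "B * \<bar>C\<bar>" and R = R0])
    show "continuous_on (- \<Gamma> \<inter> cball 0 R0) (\<lambda>x. b x * w (up k) (emb x))"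
      using c by (rule continuous_on_subset) auto
    show "- \<Gamma> \<inter> cball 0 R0 \<in> sets borel" using \<Gamma>_sets by auto
    show "\<bar>b x * w (up k) (emb x)\<bar> \<le> B * \<bar>C\<bar>" if "x \<in> - \<Gamma> \<inter> cball 0 R0" for x
      unfolding abs_mult using B C[of x] that by (intro mult_mono B) auto
  qed auto
  have d: "\<bar>b x * w (up k) (emb x)\<bar> * norm x ^ (2 * CARD(2) - 1) \<le> \<bar>C0\<^sup>2\<bar>" if "x \<in> - \<Gamma>" "norm x \<ge> R0" for x
  proof -
    have "\<bar>b x * w (up k) (emb x)\<bar> * norm x ^ 4 \<le> C0\<^sup>2"
      by (rule decay_product[OF b_decay a_decay]) (use that in auto)
    moreover have "norm x ^ 3 \<le> norm x ^ 4" using R0 that by (intro power_increasing) auto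
    ultimately show ?thesis
      using mult_left_mono[of "norm x ^ 3" "norm x ^ 4" "\<bar>b x * w (up k) (emb x)\<bar>"] by simp
  qed
  from dchi_integral_tendsto_0[OF \<Gamma>_sets R0 c i d]
  show "set_integrable lborel (- \<Gamma>) (\<lambda>x. dchi (real (Suc n)) k x * (b x * w (up k) (emb x)))"
    "(\<lambda>n. LINT x:- \<Gamma>|lborel. dchi (real (Suc n)) k x * (b x * w (up k) (emb x))) \<longlonglongrightarrow> 0" by auto
qed

text \<open>When \<open>energy_component\<close> is summed over \<open>i\<close>,
  \<open>pressure_work\<close> exchanges the pressure terms for fluxes, and
  \<open>planar_work\<close> does the same with the tangential boundary terms, rewritten by
  \<open>neumann\<close>. Every term left on the right carries a derivative of \<open>chi\<close>
  and tends to zero as the radius grows.\<close>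

lemma energy_identity:
  assumes R: "R = real (Suc n)"
  shows "(LINT x:lower_half|lborel. chi R x * (\<Sum>i\<in>UNIV. \<Sum>j\<in>UNIV. W i j x * W i j x))
     = (\<Sum>j\<in>UNIV. LINT x:lower_half|lborel. dchi R j x * (r x * w j x))
       + (\<Sum>k\<in>UNIV. LINT x:- \<Gamma>|lborel. dchi R k x * (b x * w (up k) (emb x)))
       - (\<Sum>i\<in>UNIV. \<Sum>j\<in>UNIV. LINT x:lower_half|lborel. dchi R j x * (w i x * W i j x))"
proof -
  have Rp: "R > 0" using R by simp
  let ?wW = "\<lambda>i j. LINT x:lower_half|lborel. dchi R j x * (w i x * W i j x)"
  let ?WW = "\<lambda>i j. LINT x:lower_half|lborel. chi R x * (W i j x * W i j x)"
  let ?wQ = "\<lambda>i. LINT x:lower_half|lborel. chi R x * (w i x * Q i x)"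
  let ?rw = "\<lambda>j. LINT x:lower_half|lborel. dchi R j x * (r x * w j x)"
  let ?ba = "\<lambda>k. LINT x:- \<Gamma>|lborel. dchi R k x * (b x * w (up k) (emb x))"
  let ?Ba = "\<lambda>k. LINT x:- \<Gamma>|lborel. chi R x * (Bd k x * w (up k) (emb x))"
  have i: "set_integrable lborel lower_half (\<lambda>x. dchi R j x * (w i x * W i j x))"
    "set_integrable lborel lower_half (\<lambda>x. chi R x * (W i j x * W i j x))"
    "set_integrable lborel lower_half (\<lambda>x. chi R x * (w i x * Q i x))"
    "set_integrable lborel lower_half (\<lambda>x. chi R x * (Q j x * w j x))"
    "set_integrable lborel lower_half (\<lambda>x. dchi R j x * (r x * w j x))" for i j
    by (intro integrable_chi_mult Rp w_L2 W_loc Q_loc r_L2)+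
  have i2: "set_integrable lborel (- \<Gamma>) (\<lambda>x. dchi R k x * (b x * w (up k) (emb x)))" for k
    unfolding R by (rule b_a_flux_tendsto_0)
  have i3: "set_integrable lborel (- \<Gamma>) (\<lambda>x. chi R x * (Bd k x * w (up k) (emb x)))" for k
  proof -
    obtain C where C: "\<And>x. x \<notin> \<Gamma> \<Longrightarrow> norm x \<le> R \<Longrightarrow> \<bar>w (up k) (emb x) * W (up k) 3 (emb x)\<bar> \<le> C"
      using wW_bdd by blast
    show ?thesis
    proof (rule set_integrable_continuous_bound[OF _ \<Gamma>_sets set_integrable_const_cball[OF \<Gamma>_sets, of C R]])
      show "continuous_on (- \<Gamma>) (\<lambda>x. chi R x * (Bd k x * w (up k) (emb x)))"
        by (intro continuous_on_mult continuous_chi Bd_cont continuous_emb_off_curve w_cont)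
      show "\<bar>chi R x * (Bd k x * w (up k) (emb x))\<bar> \<le> C * indicator (cball 0 R) x" if "x \<in> - \<Gamma>" for x
      proof (cases "norm x \<le> R")
        case True
        have "\<bar>chi R x * (Bd k x * w (up k) (emb x))\<bar> \<le> 1 * C"
          unfolding abs_mult[of "chi R x"] using chi_range[of R x] C[OF _ True] that neumann[of x k]
          by (intro mult_mono) (auto simp: abs_mult mult.commute)
        then show ?thesis using True by simp
      qed (use chi_eq_0[OF Rp, of x] in auto)
    qed
  qed
  have e: "(\<Sum>j\<in>UNIV. ?wW i j) + ((\<Sum>j\<in>UNIV. ?WW i j) + ?wQ i)
      = (LINT x:- \<Gamma>|lborel. chi R x * (w i (emb x) * W i 3 (emb x)))" for i
    using energy_component[OF Rp, of i] unfolding sum_3 distrib_left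
    by (simp add: set_integral_add i)
  have e12: "(\<Sum>j\<in>UNIV. ?wW (up k) j) + ((\<Sum>j\<in>UNIV. ?WW (up k) j) + ?wQ (up k)) = - ?Ba k" for k
  proof -
    have "(LINT x:- \<Gamma>|lborel. chi R x * (w (up k) (emb x) * W (up k) 3 (emb x)))
        = (LINT x:- \<Gamma>|lborel. - (chi R x * (Bd k x * w (up k) (emb x))))"
      using \<Gamma>_sets by (intro set_lebesgue_integral_cong) (auto simp: neumann)
    also have "\<dots> = - ?Ba k" by (rule set_integral_uminus[OF i3])
    finally show ?thesis using e[of "up k"] by simp
  qed
  have e3: "(\<Sum>j\<in>UNIV. ?wW 3 j) + ((\<Sum>j\<in>UNIV. ?WW 3 j) + ?wQ 3) = 0"
  proof -
    have "(LINT x:- \<Gamma>|lborel. chi R x * (w 3 (emb x) * W 3 3 (emb x))) = (LINT x:- \<Gamma>|lborel. 0)"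
      using \<Gamma>_sets by (intro set_lebesgue_integral_cong) (auto simp: no_flux)
    then show ?thesis using e[of 3] by simp
  qed
  have p: "(\<Sum>j\<in>UNIV. ?rw j) + (\<Sum>i\<in>UNIV. ?wQ i) = 0"
    using pressure_work[OF Rp] unfolding sum_3 distrib_left
    by (simp add: set_integral_add i mult.commute[of "Q _ _"])
  have b: "(\<Sum>k\<in>UNIV. ?ba k) + (\<Sum>k\<in>UNIV. ?Ba k) = 0"
    using planar_work[OF Rp] unfolding sum_2 distrib_left
    by (simp add: set_integral_add i2[of 1, simplified] i2[of 2, simplified] i3[of 1, simplified] i3[of 2, simplified])
  have s: "(LINT x:lower_half|lborel. chi R x * (\<Sum>i\<in>UNIV. \<Sum>j\<in>UNIV. W i j x * W i j x)) = (\<Sum>i\<in>UNIV. \<Sum>j\<in>UNIV. ?WW i j)"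
    unfolding sum_3 distrib_left by (simp add: set_integral_add i)
  show ?thesis
    unfolding s using e12[of 1] e12[of 2] e3 p b by (simp add: sum_3[of "\<lambda>i. \<Sum>j\<in>UNIV. _ i j"] sum_3[of ?wQ] sum_2)
qed

lemma W_eq_0_lower:
  assumes x: "x \<in> lower_half"
  shows "W i j x = 0"
proof -
  define s where "s x = (\<Sum>i\<in>UNIV. \<Sum>j\<in>UNIV. W i j x * W i j x)" for x
  have sc: "continuous_on lower_half s"
    unfolding s_def by (intro continuous_intros W_cont_lower)
  have s0: "0 \<le> s x" for x unfolding s_def by (intro sum_nonneg) simp
  have si: "set_integrable lborel lower_half s"
    unfolding s_def sum_3 by (intro set_integral_add(1) W_L2[unfolded power2_eq_square])
  have "(\<lambda>n. LINT x:lower_half|lborel. chi (real (Suc n)) x * s x) \<longlonglongrightarrow> (LINT x:lower_half|lborel. s x)"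
  proof (rule set_dominated_convergence(2)[OF _ _ si])
    show "AE x\<in>lower_half in lborel. (\<lambda>n. chi (real (Suc n)) x * s x) \<longlonglongrightarrow> s x"
      using tendsto_mult[OF chi_tendsto_1 tendsto_const] by (intro always_eventually) auto
    show "\<bar>chi (real (Suc n)) x * s x\<bar> \<le> s x" for n x
      using chi_range[of "real (Suc n)" x] s0[of x] by (simp add: abs_mult mult_left_le_one_le del: of_nat_Suc)
  qed (auto intro!: lower_half_sets set_measurable_continuous continuous_on_mult continuous_chi sc)
  moreover have "(\<lambda>n. LINT x:lower_half|lborel. chi (real (Suc n)) x * s x) \<longlonglongrightarrow>
     (\<Sum>j\<in>(UNIV::3 set). 0) + (\<Sum>k\<in>(UNIV::2 set). 0) - (\<Sum>i\<in>(UNIV::3 set). \<Sum>j\<in>(UNIV::3 set). 0)"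
    unfolding s_def energy_identity[OF refl]
    by (intro tendsto_diff tendsto_add tendsto_sum w_W_flux_tendsto_0 r_w_flux_tendsto_0 b_a_flux_tendsto_0)
  ultimately have "(LINT x:lower_half|lborel. s x) = 0"
    using LIMSEQ_unique by fastforce
  then have "AE x in lborel. indicator lower_half x *\<^sub>R s x = 0"
    using si s0 unfolding set_lebesgue_integral_def set_integrable_def
    by (subst (asm) integral_nonneg_eq_0_iff_AE) auto
  then have "AE x\<in>lower_half in lborel. s x = 0"
    by eventually_elim (simp split: split_indicator_asm)
  from continuous_AE_eq_0[OF open_lower_half sc this x] have "s x = 0" .
  then show ?thesis
    unfolding s_def by (simp add: sum_nonneg_eq_0_iff sum_nonneg)
qed

text \<open>Points of the boundary plane off the curve are approached vertically from below, through
  the open half-space.\<close>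

lemma vanishing_on_closure:
  assumes f: "continuous_on (closure lower_half - emb ` \<Gamma>) f" and 0: "\<And>x. x \<in> lower_half \<Longrightarrow> f x = (0::real)"
    and x: "x \<in> closure lower_half - emb ` \<Gamma>"
  shows "f x = 0"
proof -
  let ?s = "\<lambda>n. x - inverse (real (Suc n)) *\<^sub>R axis 3 1"
  have s: "?s n \<in> lower_half" for n
    using x inverse_positive_iff_positive[of "real (Suc n)"]
    by (auto simp: closure_lower_half lower_half_def axis_def simp del: of_nat_Suc inverse_positive_iff_positive)
  have "?s \<longlonglongrightarrow> x - 0 *\<^sub>R axis 3 1" by (intro tendsto_intros LIMSEQ_inverse_real_of_nat)
  then have "?s \<longlonglongrightarrow> x" by simp
  then have "(\<lambda>n. f (?s n)) \<longlonglongrightarrow> f x"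
    using s lower_half_off_curve
    by (intro continuous_on_tendsto_compose[OF f _ x] always_eventually allI) (assumption, blast)
  then show ?thesis unfolding 0[OF s] by (simp add: LIMSEQ_const_iff)
qed

lemma W_eq_0: "x \<in> closure lower_half - emb ` \<Gamma> \<Longrightarrow> W i j x = 0"
  by (rule vanishing_on_closure[OF W_cont W_eq_0_lower])

text \<open>Along the vertical ray going down from \<open>x\<close> the function is constant, while
  the norm grows at least like the depth, so any positive power of decay forces the constant to be
  0.\<close>

lemma constant_decaying_eq_0:
  fixes f :: "real^3 \<Rightarrow> real"
  assumes der: "\<And>x. x \<in> lower_half \<Longrightarrow> ((\<lambda>t. f (x + t *\<^sub>R axis 3 1)) has_real_derivative 0) (at 0)"
    and d: "\<And>x. x \<in> lower_half \<Longrightarrow> norm x \<ge> R0 \<Longrightarrow> \<bar>f x\<bar> \<le> C0 / norm x ^ Suc m"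
    and x: "x \<in> lower_half"
  shows "f x = 0"
proof -
  have der': "((\<lambda>t. f (x + t *\<^sub>R axis 3 1)) has_real_derivative 0) (at t)" if "t \<le> 0" for t
  proof -
    have "x + t *\<^sub>R axis 3 1 \<in> lower_half" using x that by (simp add: lower_half_def axis_def)
    from der[OF this] show ?thesis
      using DERIV_shift[of "\<lambda>s. f (x + s *\<^sub>R axis 3 1)" _ 0 t] by (simp add: algebra_simps)
  qed
  have const: "f (x + (- real n) *\<^sub>R axis 3 1) = f x" for n
  proof -
    have "\<exists>c. \<forall>t\<in>{..0}. f (x + t *\<^sub>R axis 3 1) = c"
      by (rule has_field_derivative_zero_constant) (auto intro: has_field_derivative_at_within der')
    then show ?thesis by (metis add.right_neutral atMost_iff neg_le_0_iff_le of_nat_0_le_iff order_refl scaleR_zero_left)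
  qed
  have bound: "\<bar>f x\<bar> * real n \<le> \<bar>C0\<bar>" if "real n \<ge> R0" for n
  proof -
    let ?y = "x + (- real n) *\<^sub>R axis 3 1"
    have y: "?y \<in> lower_half" using x by (simp add: lower_half_def axis_def)
    have "real n \<le> \<bar>?y $ 3\<bar>" using x by (simp add: lower_half_def axis_def)
    then have n: "real n \<le> norm ?y" using component_le_norm_cart[of ?y 3] by linarith
    then have ny: "norm ?y \<ge> R0" using that by linarith
    then have y1: "norm ?y \<ge> 1" using R0 by linarith
    have "\<bar>f x\<bar> \<le> C0 / norm ?y ^ Suc m" using d[OF y ny] const[of n] by simp
    then have "\<bar>f x\<bar> * norm ?y ^ Suc m \<le> C0"
      using pos_le_divide_eq[of "norm ?y ^ Suc m" "\<bar>f x\<bar>" C0] y1 by (smt (verit) zero_less_power)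
    moreover have "norm ?y \<le> norm ?y ^ Suc m" using y1 by (metis power_increasing[of 1 "Suc m" "norm ?y"] One_nat_def Suc_le_mono le0 power_one_right)
    ultimately have "\<bar>f x\<bar> * norm ?y \<le> C0" by (smt (verit) abs_ge_zero mult_left_mono)
    then show ?thesis using n by (smt (verit) abs_ge_zero mult_left_mono)
  qed
  show ?thesis
  proof (rule ccontr)
    assume "f x \<noteq> 0"
    obtain n :: nat where "max R0 (\<bar>C0\<bar> / \<bar>f x\<bar>) < real n" using reals_Archimedean2 by blast
    then have "R0 \<le> real n" "\<bar>C0\<bar> < real n * \<bar>f x\<bar>" using \<open>f x \<noteq> 0\<close> by (auto simp: divide_less_eq)
    with bound[of n] show False by (simp add: mult.commute)
  qed
qed

lemma w_eq_0:
  assumes "x \<in> closure lower_half - emb ` \<Gamma>"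
  shows "w i x = 0"
proof (rule vanishing_on_closure[OF w_cont _ assms])
  fix x assume "x \<in> lower_half"
  show "w i x = 0"
  proof (rule constant_decaying_eq_0[OF _ _ \<open>x \<in> lower_half\<close>])
    show "((\<lambda>t. w i (x + t *\<^sub>R axis 3 1)) has_real_derivative 0) (at 0)" if "x \<in> lower_half" for x
      using w_der[OF that, of i 3] W_eq_0_lower[OF that] by simp
    show "\<bar>w i x\<bar> \<le> C0 / norm x ^ Suc 1" if "x \<in> lower_half" "R0 \<le> norm x" for x
      using w_decay[OF that] by (simp add: numeral_2_eq_2)
  qed
qed

lemma Q_eq_0:
  assumes "x \<in> lower_half"
  shows "Q i x = 0"
proof -
  have "WW i j x = 0" for j
    by (rule line_derivative_eq_0[OF open_lower_half assms W_eq_0_lower W_der[OF assms]])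
  then show ?thesis using momentum[OF assms, of i] by simp
qed

lemma r_eq_0:
  assumes "x \<in> closure lower_half - emb ` \<Gamma>"
  shows "r x = 0"
proof (rule vanishing_on_closure[OF r_cont _ assms])
  fix x assume "x \<in> lower_half"
  show "r x = 0"
  proof (rule constant_decaying_eq_0[OF _ _ \<open>x \<in> lower_half\<close>])
    show "((\<lambda>t. r (x + t *\<^sub>R axis 3 1)) has_real_derivative 0) (at 0)" if "x \<in> lower_half" for x
      using r_der[OF that, of 3] Q_eq_0[OF that] by simp
    show "\<bar>r x\<bar> \<le> C0 / norm x ^ Suc 2" if "x \<in> lower_half" "R0 \<le> norm x" for x
      using r_decay[OF that] by (simp add: numeral_3_eq_3 numeral_2_eq_2)
  qed
qed

text \<open>Since \<open>W\<close> vanishes, the boundary condition makes \<open>Bd\<close> zero off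
  the curve, so \<open>b\<close> is Lipschitz with constant 0 on every ball: it is constant across
  the curve and not merely on each side. Decay then excludes a nonzero constant.\<close>

lemma b_eq_0: "b x = 0"
proof -
  have Bd: "Bd k x = 0" if "x \<notin> \<Gamma>" for k x
    using neumann[OF that, of k] W_eq_0[OF emb_off_curve[OF that]] by simp
  have const: "b y = b x" for y
  proof -
    have "0-lipschitz_on (ball 0 (max (norm x) (norm y) + 1)) b"
      by (rule b_lip) (simp_all add: Bd)
    then have "dist (b y) (b x) \<le> 0 * dist y x" by (rule lipschitz_onD) auto
    then show ?thesis by simp
  qed
  have bound: "\<bar>b x\<bar> * real n \<le> \<bar>C0\<bar>" if "real n \<ge> R0" for n
  proof -
    let ?y = "real n *\<^sub>R axis 1 1 :: real^2"
    have n: "norm ?y = real n" by simp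
    have n1: "real n \<ge> 1" using that R0 by simp
    have "\<bar>b x\<bar> \<le> C0 / real n ^ 2" using b_decay[of ?y] that const[of ?y] by simp
    then have "\<bar>b x\<bar> * real n ^ 2 \<le> C0" using n1 by (simp add: pos_le_divide_eq)
    moreover have "real n \<le> real n ^ 2" using n1 by (simp add: power2_eq_square)
    ultimately show ?thesis by (smt (verit) abs_ge_zero mult_left_mono)
  qed
  show ?thesis
  proof (rule ccontr)
    assume "b x \<noteq> 0"
    obtain n :: nat where "max R0 (\<bar>C0\<bar> / \<bar>b x\<bar>) < real n" using reals_Archimedean2 by blast
    then have "R0 \<le> real n" "\<bar>C0\<bar> < real n * \<bar>b x\<bar>" using \<open>b x \<noteq> 0\<close> by (auto simp: divide_less_eq)
    with bound[of n] show False by (simp add: mult.commute)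
  qed
qed

end

section \<open>Traces and gluing across a Jordan curve\<close>

text \<open>By the Jordan-Brouwer theorems the complement is disconnected and each of its components
  has the whole curve as frontier. The outside is connected, so the inside is nonempty, and a single
  component of the inside already accumulates at every point of the curve.\<close>

lemma Jordan_curve_plane:
  fixes c :: "real \<Rightarrow> real^2"
  assumes "simple_path c" "pathfinish c = pathstart c"
  shows "path_image c \<subseteq> closure (inside (path_image c))" "path_image c \<subseteq> closure (outside (path_image c))"
    "closure (inside (path_image c)) \<inter> closure (outside (path_image c)) \<subseteq> path_image c"
    "closure (inside (path_image c)) \<union> closure (outside (path_image c)) = UNIV"
proof -
  let ?S = "path_image c"
  have "?S homeomorphic sphere (0 :: complex) 1"
    by (rule homeomorphic_simple_path_image_circle[OF assms]) simp
  also have "sphere (0 :: complex) 1 homeomorphic sphere (0 :: real^2) 1"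
    by (rule homeomorphic_spheres_gen) auto
  finally have hom: "?S homeomorphic sphere (0 :: real^2) 1" .
  have cpt: "compact ?S" using assms(1) by (simp add: compact_simple_path_image)
  have cl: "closed ?S" and bd: "bounded ?S" using cpt by (auto intro: compact_imp_closed compact_imp_bounded)
  have uo: "\<not> bounded (outside ?S)" using bd by (intro unbounded_outside) auto
  have co: "connected (outside ?S)" using bd by (rule connected_outside) simp
  then have "outside ?S \<in> components (- ?S)"
    using uo by (auto simp: outside_in_components)
  then have fo: "frontier (outside ?S) = ?S"
    by (rule Jordan_Brouwer_frontier[OF hom]) simp
  have "\<not> connected (- ?S)" by (rule Jordan_Brouwer_separation[OF hom]) simp
  then have "inside ?S \<noteq> {}"
    using co inside_Un_outside[of ?S] by (metis sup_bot_left)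
  then obtain x where x: "x \<in> inside ?S" by auto
  let ?C = "connected_component_set (- ?S) x"
  have "x \<in> - ?S" using x inside_Un_outside[of ?S] by blast
  then have "?C \<in> components (- ?S)" by (rule componentsI)
  then have fC: "frontier ?C = ?S" by (rule Jordan_Brouwer_frontier[OF hom]) simp
  have "?C \<subseteq> inside ?S"
    using x inside_same_component by blast
  then have "closure ?C \<subseteq> closure (inside ?S)" by (rule closure_mono)
  then show "?S \<subseteq> closure (inside ?S)" using fC by (auto simp: frontier_def)
  show o: "?S \<subseteq> closure (outside ?S)" using fo by (auto simp: frontier_def)
  then show "closure (inside ?S) \<union> closure (outside ?S) = UNIV"
    using inside_Un_outside[of ?S] closure_subset[of "inside ?S"] closure_subset[of "outside ?S"] by blast
  have "closure (outside ?S) = outside ?S \<union> ?S" using fo by (metis closure_Un_frontier)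
  moreover have "closure (inside ?S) \<inter> outside ?S = {}"
    using open_outside[OF cl] inside_Int_outside[of ?S]
    by (metis Int_commute open_Int_closure_eq_empty)
  ultimately show "closure (inside ?S) \<inter> closure (outside ?S) \<subseteq> ?S" by auto
qed

text \<open>The local condition compares with the one value at \<open>x\<close>, from both sides;
  two such estimates chain at \<open>x\<close>, and bisection does the rest. Along a segment that
  meets the curve the function need not be differentiable, and the meeting points may accumulate, so
  a subdivision at the crossings is not an option.\<close>

lemma real_lipschitz_of_local:
  fixes h :: "real \<Rightarrow> real"
  assumes "a \<le> b"
    and loc: "\<And>x. a \<le> x \<Longrightarrow> x \<le> b \<Longrightarrow> \<exists>d>0. \<forall>y. a \<le> y \<and> y \<le> b \<and> \<bar>y - x\<bar> < d \<longrightarrow> \<bar>h y - h x\<bar> \<le> K * \<bar>y - x\<bar>"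
  shows "\<bar>h b - h a\<bar> \<le> K * (b - a)"
proof -
  have "a \<le> a \<longrightarrow> b \<le> b \<longrightarrow> \<bar>h b - h a\<bar> \<le> K * (b - a)" using assms(1)
  proof (rule Bolzano[where P = "\<lambda>p q. a \<le> p \<longrightarrow> q \<le> b \<longrightarrow> \<bar>h q - h p\<bar> \<le> K * (q - p)"])
    fix p q r
    assume *: "a \<le> p \<longrightarrow> q \<le> b \<longrightarrow> \<bar>h q - h p\<bar> \<le> K * (q - p)"
      "a \<le> q \<longrightarrow> r \<le> b \<longrightarrow> \<bar>h r - h q\<bar> \<le> K * (r - q)" "p \<le> q" "q \<le> r"
    show "a \<le> p \<longrightarrow> r \<le> b \<longrightarrow> \<bar>h r - h p\<bar> \<le> K * (r - p)"
    proof (intro impI)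
      assume "a \<le> p" "r \<le> b"
      with * have "\<bar>h q - h p\<bar> \<le> K * (q - p)" "\<bar>h r - h q\<bar> \<le> K * (r - q)" by auto
      then show "\<bar>h r - h p\<bar> \<le> K * (r - p)" by (simp add: algebra_simps)
    qed
  next
    fix x assume x: "a \<le> x" "x \<le> b"
    then obtain d where d: "d > 0" "\<And>y. a \<le> y \<Longrightarrow> y \<le> b \<Longrightarrow> \<bar>y - x\<bar> < d \<Longrightarrow> \<bar>h y - h x\<bar> \<le> K * \<bar>y - x\<bar>"
      using loc by meson
    show "\<exists>d>0. \<forall>p q. p \<le> x \<and> x \<le> q \<and> q - p < d \<longrightarrow> a \<le> p \<longrightarrow> q \<le> b \<longrightarrow> \<bar>h q - h p\<bar> \<le> K * (q - p)"
    proof (intro exI[of _ d] conjI allI impI d(1))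
      fix p q assume *: "p \<le> x \<and> x \<le> q \<and> q - p < d" "a \<le> p" "q \<le> b"
      have "\<bar>h p - h x\<bar> \<le> K * \<bar>p - x\<bar>" by (rule d(2)) (use * x in auto)
      moreover have "\<bar>h q - h x\<bar> \<le> K * \<bar>q - x\<bar>" by (rule d(2)) (use * x in auto)
      ultimately show "\<bar>h q - h p\<bar> \<le> K * (q - p)" using * by (simp add: algebra_simps)
    qed
  qed
  then show ?thesis by simp
qed

text \<open>Differentiability within a closed side gives, at each of its points, an increment bound
  with slope \<open>M + e\<close> towards points of that side; a point off a side has a
  neighbourhood that misses it. The two sides cover the space, so
  \<open>real_lipschitz_of_local\<close> along a segment gives the slope \<open>M + e\<close>, and
  \<open>e\<close> is arbitrary. The absence of a jump is encoded in using one function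
  \<open>f\<close> for both sides.\<close>

lemma glued_lipschitz:
  fixes f :: "'a::real_normed_vector \<Rightarrow> real" and D1 D2 :: "'a \<Rightarrow> 'a \<Rightarrow>\<^sub>L real"
  assumes cl: "closed S1" "closed S2" and cover: "S1 \<union> S2 = UNIV" and M: "0 \<le> M"
    and d1: "\<And>x. x \<in> S1 \<Longrightarrow> (f has_derivative D1 x) (at x within S1)"
    and d2: "\<And>x. x \<in> S2 \<Longrightarrow> (f has_derivative D2 x) (at x within S2)"
    and n1: "\<And>x. x \<in> S1 \<Longrightarrow> x \<in> ball 0 R \<Longrightarrow> norm (D1 x) \<le> M"
    and n2: "\<And>x. x \<in> S2 \<Longrightarrow> x \<in> ball 0 R \<Longrightarrow> norm (D2 x) \<le> M"
  shows "M-lipschitz_on (ball 0 R) f"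
proof -
  have one: "\<exists>d>0. \<forall>y\<in>S. dist y x < d \<longrightarrow> \<bar>f y - f x\<bar> \<le> (M + e) * dist y x"
    if S: "closed S" and D: "\<And>x. x \<in> S \<Longrightarrow> (f has_derivative D x) (at x within S)"
      "\<And>x. x \<in> S \<Longrightarrow> x \<in> ball 0 R \<Longrightarrow> norm (D x) \<le> M" and "x \<in> ball 0 R" "e > 0"
    for S x e and D :: "'a \<Rightarrow> 'a \<Rightarrow>\<^sub>L real"
  proof (cases "x \<in> S")
    case True
    obtain d where d: "d > 0" "\<And>y. y \<in> S \<Longrightarrow> norm (y - x) < d \<Longrightarrow> norm (f y - f x - D x (y - x)) \<le> e * norm (y - x)"
      using D(1)[OF True] \<open>e > 0\<close> unfolding has_derivative_within_alt by meson
    show ?thesis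
    proof (intro exI[of _ d] conjI d(1) ballI impI)
      fix y assume "y \<in> S" "dist y x < d"
      then have "norm (f y - f x - D x (y - x)) \<le> e * norm (y - x)" using d(2) by (simp add: dist_norm)
      moreover have "norm (D x (y - x)) \<le> M * norm (y - x)"
        using order_trans[OF norm_blinfun mult_right_mono[OF D(2)[OF True \<open>x \<in> ball 0 R\<close>] norm_ge_zero]] .
      ultimately show "\<bar>f y - f x\<bar> \<le> (M + e) * dist y x"
        by (simp add: dist_norm algebra_simps)
    qed
  next
    case False
    then obtain d where "d > 0" "ball x d \<subseteq> - S" using S open_contains_ball[of "- S"] by (auto simp: open_Compl)
    then show ?thesis by (intro exI[of _ d]) (auto simp: subset_iff dist_commute)
  qed
  have bound: "\<bar>f y - f x\<bar> \<le> (M + e) * dist y x" if xy: "x \<in> ball 0 R" "y \<in> ball 0 R" and e: "e > 0" for x y e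
  proof -
    define z where "z t = x + t *\<^sub>R (y - x)" for t
    have zb: "z t \<in> ball 0 R" if "0 \<le> t" "t \<le> 1" for t
    proof -
      have "z t = (1 - t) *\<^sub>R x + t *\<^sub>R y" by (simp add: z_def algebra_simps)
      then show ?thesis using convexD[OF convex_ball xy, of "1 - t" t] that by simp
    qed
    have "\<bar>f (z 1) - f (z 0)\<bar> \<le> ((M + e) * norm (y - x)) * (1 - 0)"
    proof (rule real_lipschitz_of_local[of 0 1 "\<lambda>t. f (z t)"])
      fix t :: real assume t: "0 \<le> t" "t \<le> 1"
      obtain da where da: "da > 0" "\<And>y. y \<in> S1 \<Longrightarrow> dist y (z t) < da \<Longrightarrow> \<bar>f y - f (z t)\<bar> \<le> (M + e) * dist y (z t)"
        using one[OF cl(1) d1 n1 zb[OF t] e] by blast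
      obtain db where db: "db > 0" "\<And>y. y \<in> S2 \<Longrightarrow> dist y (z t) < db \<Longrightarrow> \<bar>f y - f (z t)\<bar> \<le> (M + e) * dist y (z t)"
        using one[OF cl(2) d2 n2 zb[OF t] e] by blast
      have dz: "dist (z s) (z t) = \<bar>s - t\<bar> * norm (y - x)" for s
        by (simp add: z_def dist_norm scaleR_diff_left[symmetric])
      \<comment> \<open>The added 1 avoids a division by zero when \<open>x = y\<close>.\<close>
      let ?d = "min da db / (norm (y - x) + 1)"
      have np: "norm (y - x) + 1 > 0" by (rule add_nonneg_pos) auto
      show "\<exists>d>0. \<forall>s. 0 \<le> s \<and> s \<le> 1 \<and> \<bar>s - t\<bar> < d \<longrightarrow> \<bar>f (z s) - f (z t)\<bar> \<le> (M + e) * norm (y - x) * \<bar>s - t\<bar>"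
      proof (intro exI[of _ ?d] conjI allI impI)
        show "?d > 0" using da db np by simp
        fix s assume s: "0 \<le> s \<and> s \<le> 1 \<and> \<bar>s - t\<bar> < ?d"
        then have "\<bar>s - t\<bar> * (norm (y - x) + 1) < min da db" using np by (simp add: pos_less_divide_eq)
        then have "dist (z s) (z t) < min da db"
          unfolding dz using mult_left_mono[of "norm (y - x)" "norm (y - x) + 1" "\<bar>s - t\<bar>"] by linarith
        then have "\<bar>f (z s) - f (z t)\<bar> \<le> (M + e) * dist (z s) (z t)"
          using da(2)[of "z s"] db(2)[of "z s"] cover by auto
        then show "\<bar>f (z s) - f (z t)\<bar> \<le> (M + e) * norm (y - x) * \<bar>s - t\<bar>"
          by (simp add: dz mult_ac)
      qed
    qed simp
    then show ?thesis by (simp add: z_def dist_norm)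
  qed
  show ?thesis
  proof (rule lipschitz_onI[OF _ M])
    fix x y :: 'a assume xy: "x \<in> ball 0 R" "y \<in> ball 0 R"
    show "dist (f x) (f y) \<le> M * dist x y"
    proof (rule field_le_epsilon)
      fix e :: real assume "e > 0"
      have p: "dist x y + 1 > 0" by (rule add_nonneg_pos) auto
      have "\<bar>f x - f y\<bar> \<le> (M + e / (dist x y + 1)) * dist x y"
        by (rule bound[OF xy(2,1)]) (use \<open>e > 0\<close> p in auto)
      also have "\<dots> \<le> M * dist x y + e"
        using \<open>e > 0\<close> p by (simp add: distrib_right divide_le_eq mult_left_mono)
      finally show "dist (f x) (f y) \<le> M * dist x y + e" by (simp add: dist_real_def)
    qed
  qed
qed

lemma decays_onE:
  assumes "decays_on S k f"
  obtains C R where "C > 0" "\<And>x. x \<in> S \<Longrightarrow> norm x \<ge> R \<Longrightarrow> norm (f x) \<le> C / norm x ^ k"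
proof -
  obtain c where c: "c > 0" "\<forall>\<^sub>F x in inf at_infinity (principal S). norm (norm (f x)) \<le> c * norm (1 / norm x ^ k)"
    using assms unfolding decays_on_def by (elim landau_o.bigE)
  then obtain R where "\<And>x. R \<le> norm x \<Longrightarrow> x \<in> S \<Longrightarrow> norm (f x) \<le> c * norm (1 / norm x ^ k)"
    by (auto simp: eventually_inf_principal eventually_at_infinity)
  then show ?thesis using c(1) by (intro that[of c R]) auto
qed

lemma line_has_derivative:
  fixes f :: "'a::real_normed_vector \<Rightarrow> 'b::real_normed_vector" and h :: "'b \<Rightarrow> real"
  assumes "(f has_derivative F) (at x)" "bounded_linear h"
  shows "((\<lambda>t. h (f (x + t *\<^sub>R e))) has_real_derivative h (F e)) (at 0)"
proof -
  have "((\<lambda>t. x + t *\<^sub>R e) has_derivative (\<lambda>t. t *\<^sub>R e)) (at 0)"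
    by (auto intro!: derivative_eq_intros)
  then have "((\<lambda>t. f (x + t *\<^sub>R e)) has_derivative (\<lambda>t. F (t *\<^sub>R e))) (at 0)"
    by (rule has_derivative_compose) (use assms(1) in simp)
  then have "((\<lambda>t. h (f (x + t *\<^sub>R e))) has_derivative (\<lambda>t. h (F (t *\<^sub>R e)))) (at 0)"
    by (rule bounded_linear.has_derivative[OF assms(2)])
  moreover have "(\<lambda>t. h (F (t *\<^sub>R e))) = (*) (h (F e))"
    using linear_scale[OF bounded_linear.linear[OF bounded_linear_compose[OF assms(2) has_derivative_bounded_linear[OF assms(1)]]], of _ e]
    by (simp add: fun_eq_iff mult.commute)
  ultimately show ?thesis by (simp only: has_field_derivative_def)
qed

section \<open>Component data of one classical solution\<close>

lemma pd_eq:
  assumes "(f has_derivative F) (at x)"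
  shows "pd i f x = F (axis i 1)"
  unfolding pd_def using frechet_derivative_at[OF assms] by simp

lemma grad_norm_bounds:
  "norm (pd j f x) \<le> grad_norm f x" "(norm (pd j f x))\<^sup>2 \<le> (grad_norm f x)\<^sup>2"
proof -
  show 2: "(norm (pd j f x))\<^sup>2 \<le> (grad_norm f x)\<^sup>2"
    unfolding grad_norm_def
    by (subst real_sqrt_pow2) (auto intro!: sum_nonneg member_le_sum)
  show "norm (pd j f x) \<le> grad_norm f x"
    using 2 by (rule power2_le_imp_le) (simp add: grad_norm_def sum_nonneg)
qed

text \<open>Two derivatives of \<open>v\<close> are given: one on the open half-space that is itself
  continuously differentiable, and one continuous up to the boundary off the curve. They agree
  inside, so \<open>W\<close>, built from the second, has both the boundary values and the
  derivatives \<open>WW\<close>.\<close>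

lemma velocity_data:
  fixes v :: "real^3 \<Rightarrow> real^3"
  assumes cl: "closed \<Gamma>"
    and C2: "C2_on lower_half v" and C1: "C1_on (closure lower_half - emb ` \<Gamma>) v"
    and fe: "finite_energy v"
  obtains W WW :: "3 \<Rightarrow> 3 \<Rightarrow> real^3 \<Rightarrow> real" where
    "\<And>i. continuous_on (closure lower_half - emb ` \<Gamma>) (\<lambda>x. v x $ i)"
    "\<And>i j. continuous_on (closure lower_half - emb ` \<Gamma>) (W i j)"
    "\<And>i j. continuous_on lower_half (WW i j)"
    "\<And>i j x. x \<in> lower_half \<Longrightarrow> ((\<lambda>t. v (x + t *\<^sub>R axis j 1) $ i) has_real_derivative W i j x) (at 0)"
    "\<And>i j x. x \<in> lower_half \<Longrightarrow> ((\<lambda>t. W i j (x + t *\<^sub>R axis j 1)) has_real_derivative WW i j x) (at 0)"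
    "\<And>i x. x \<in> lower_half \<Longrightarrow> laplacian v x $ i = (\<Sum>j\<in>UNIV. WW i j x)"
    "\<And>x. x \<in> lower_half \<Longrightarrow> divergence v x = (\<Sum>i\<in>UNIV. W i i x)"
    "\<And>i j. set_integrable lborel lower_half (\<lambda>x. (W i j x)\<^sup>2)"
    "\<And>i j x. x \<in> lower_half \<Longrightarrow> \<bar>W i j x\<bar> \<le> grad_norm v x"
    "\<And>k x. x \<notin> \<Gamma> \<Longrightarrow> par (pd3_bdry v x) $ k = W (up k) 3 (emb x)"
proof -
  let ?S = "closure lower_half - emb ` \<Gamma>"
  have sub: "lower_half \<subseteq> ?S" using emb_image_disjoint[of \<Gamma>] closure_subset[of lower_half] by auto
  obtain D D2 where D: "\<And>x. x \<in> lower_half \<Longrightarrow> (v has_derivative blinfun_apply (D x)) (at x within lower_half)"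
    and D2: "\<And>x. x \<in> lower_half \<Longrightarrow> (D has_derivative blinfun_apply (D2 x)) (at x within lower_half)"
      "continuous_on lower_half D2"
    using C2 unfolding C2_on_def C1_on_def by metis
  obtain E where E: "\<And>x. x \<in> ?S \<Longrightarrow> (v has_derivative blinfun_apply (E x)) (at x within ?S)" "continuous_on ?S E"
    using C1 unfolding C1_on_def by metis
  have Eat: "(v has_derivative blinfun_apply (E x)) (at x)" if "x \<in> lower_half" for x
    using has_derivative_subset[OF E(1)[OF subsetD[OF sub that]] sub] at_within_open[OF that open_lower_half] by simp
  have DE: "D x = E x" if "x \<in> lower_half" for x
    using has_derivative_unique[OF Eat[OF that]] D[OF that] at_within_open[OF that open_lower_half]
    by (auto intro: blinfun_eqI simp: fun_eq_iff)
  have ED: "(E has_derivative blinfun_apply (D2 x)) (at x)" if "x \<in> lower_half" for x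
  proof (rule has_derivative_transform_within_open[OF _ open_lower_half that DE])
    show "(D has_derivative blinfun_apply (D2 x)) (at x)"
      using D2(1)[OF that] at_within_open[OF that open_lower_half] by simp
  qed
  define W where "W i j x = E x (axis j 1) $ i" for i j x
  define WW where "WW i j x = D2 x (axis j 1) (axis j 1) $ i" for i j x
  have blE: "bounded_linear (\<lambda>B :: (real^3) \<Rightarrow>\<^sub>L (real^3). B y $ i)" for y i
    by (rule bounded_linear_compose[OF bounded_linear_vec_nth blinfun.bounded_linear_left])
  have pd: "pd j v x = E x (axis j 1)" if "x \<in> lower_half" for j x
    by (rule pd_eq[OF Eat[OF that]])
  have pd2: "pd j (pd j v) x = D2 x (axis j 1) (axis j 1)" if "x \<in> lower_half" for j x
  proof (rule pd_eq[where F = "\<lambda>h. D2 x h (axis j 1)"])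
    have "((\<lambda>y. E y (axis j 1)) has_derivative (\<lambda>h. D2 x h (axis j 1))) (at x)"
      by (rule bounded_linear.has_derivative[OF blinfun.bounded_linear_left ED[OF that]])
    then show "(pd j v has_derivative (\<lambda>h. D2 x h (axis j 1))) (at x)"
      by (rule has_derivative_transform_within_open[OF _ open_lower_half that]) (simp add: pd)
  qed
  show ?thesis
  proof (rule that[of W WW])
    show "continuous_on ?S (\<lambda>x. v x $ i)" for i
      using has_derivative_continuous_on[of ?S v "\<lambda>x. blinfun_apply (E x)"] E(1)
      by (intro continuous_on_component) blast
    show "continuous_on ?S (W i j)" for i j
      unfolding W_def by (intro continuous_on_component continuous_intros E)
    show "continuous_on lower_half (WW i j)" for i j
      unfolding WW_def by (intro continuous_on_component continuous_intros D2)
    show "((\<lambda>t. v (x + t *\<^sub>R axis j 1) $ i) has_real_derivative W i j x) (at 0)" if "x \<in> lower_half" for i j x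
      unfolding W_def by (rule line_has_derivative[OF Eat[OF that] bounded_linear_vec_nth])
    show "((\<lambda>t. W i j (x + t *\<^sub>R axis j 1)) has_real_derivative WW i j x) (at 0)" if "x \<in> lower_half" for i j x
      unfolding W_def WW_def by (rule line_has_derivative[OF ED[OF that] blE])
    show "laplacian v x $ i = (\<Sum>j\<in>UNIV. WW i j x)" if "x \<in> lower_half" for i x
      by (simp add: laplacian_def pd2[OF that] WW_def)
    show "divergence v x = (\<Sum>i\<in>UNIV. W i i x)" if "x \<in> lower_half" for x
      by (simp add: divergence_def pd[OF that] W_def)
    have Wle: "\<bar>W i j x\<bar> \<le> norm (pd j v x)" if "x \<in> lower_half" for i j x
      unfolding W_def pd[OF that] by (rule component_le_norm_cart)
    show le: "\<bar>W i j x\<bar> \<le> grad_norm v x" if "x \<in> lower_half" for i j x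
      using Wle[OF that] grad_norm_bounds(1) by (rule order_trans)
    show "set_integrable lborel lower_half (\<lambda>x. (W i j x)\<^sup>2)" for i j
    proof (rule set_integrable_continuous_bound[OF _ lower_half_sets fe[unfolded finite_energy_def]])
      show "continuous_on lower_half (\<lambda>x. (W i j x)\<^sup>2)"
        unfolding W_def by (intro continuous_intros continuous_on_component continuous_on_subset[OF E(2) sub])
      show "\<bar>(W i j x)\<^sup>2\<bar> \<le> (grad_norm v x)\<^sup>2" if "x \<in> lower_half" for x
        using power_mono[OF le[OF that, of i j] abs_ge_zero, of 2] by simp
    qed
    \<comment> \<open>The vertical line below \<open>emb x\<close> stays in the half-space, so the
      derivative of \<open>v\<close> within \<open>?S\<close> at \<open>emb x\<close> already
      determines the one-sided derivative.\<close>
    show "par (pd3_bdry v x) $ k = W (up k) 3 (emb x)" if "x \<notin> \<Gamma>" for k x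
    proof -
      have x: "emb x \<in> ?S" using that emb_in_closure by (auto simp: emb_inj)
      let ?l = "\<lambda>s::real. emb x + s *\<^sub>R axis 3 1"
      have "(?l has_derivative (\<lambda>s. s *\<^sub>R axis 3 1)) (at 0 within {..<0})"
        by (auto intro!: derivative_eq_intros)
      moreover have "(v has_derivative blinfun_apply (E (emb x))) (at (?l 0) within ?l ` {..<0})"
      proof -
        have "?l ` {..<0} \<subseteq> lower_half" by (auto simp: lower_half_def axis_def)
        then have "?l ` {..<0} \<subseteq> ?S" using sub by blast
        then show ?thesis using has_derivative_subset[OF E(1)[OF x]] by simp
      qed
      ultimately have "((\<lambda>s. v (?l s)) has_derivative (\<lambda>s. E (emb x) (s *\<^sub>R axis 3 1))) (at 0 within {..<0})"
        by (rule has_derivative_in_compose)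
      then have "((\<lambda>s. v (?l s)) has_vector_derivative E (emb x) (axis 3 1)) (at_left 0)"
        by (simp add: has_vector_derivative_def blinfun.scaleR_right)
      then have "pd3_bdry v x = E (emb x) (axis 3 1)"
        unfolding pd3_bdry_def by (intro vector_derivative_within) (simp_all add: trivial_limit_at_left_real)
      then show ?thesis by (simp add: W_def par_nth)
    qed
  qed
qed

lemma pressure_data:
  fixes q :: "real^3 \<Rightarrow> real"
  assumes C1: "C1_on lower_half q" and fe: "finite_energy q"
  shows "\<And>j. continuous_on lower_half (\<lambda>x. grad q x $ j)"
    and "\<And>j x. x \<in> lower_half \<Longrightarrow> ((\<lambda>t. q (x + t *\<^sub>R axis j 1)) has_real_derivative grad q x $ j) (at 0)"
    and "\<And>j. set_integrable lborel lower_half (\<lambda>x. (grad q x $ j)\<^sup>2)"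
proof -
  obtain E where E: "\<And>x. x \<in> lower_half \<Longrightarrow> (q has_derivative blinfun_apply (E x)) (at x within lower_half)" "continuous_on lower_half E"
    using C1 unfolding C1_on_def by metis
  have Eat: "(q has_derivative blinfun_apply (E x)) (at x)" if "x \<in> lower_half" for x
    using E(1)[OF that] at_within_open[OF that open_lower_half] by simp
  have pd: "grad q x $ j = E x (axis j 1)" if "x \<in> lower_half" for j x
    unfolding grad_def using pd_eq[OF Eat[OF that]] by simp
  have "continuous_on lower_half (\<lambda>x. E x (axis j 1))" for j
    by (intro continuous_intros E)
  then show c: "continuous_on lower_half (\<lambda>x. grad q x $ j)" for j
    by (rule continuous_on_cong[THEN iffD1, OF refl, rotated]) (simp add: pd)
  show "((\<lambda>t. q (x + t *\<^sub>R axis j 1)) has_real_derivative grad q x $ j) (at 0)" if "x \<in> lower_half" for j x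
    unfolding pd[OF that] using line_has_derivative[OF Eat[OF that] bounded_linear_ident] by simp
  show "set_integrable lborel lower_half (\<lambda>x. (grad q x $ j)\<^sup>2)" for j
  proof (rule set_integrable_continuous_bound[OF _ lower_half_sets fe[unfolded finite_energy_def]])
    show "continuous_on lower_half (\<lambda>x. (grad q x $ j)\<^sup>2)" by (intro continuous_intros c)
    show "\<bar>(grad q x $ j)\<^sup>2\<bar> \<le> (grad_norm q x)\<^sup>2" if "x \<in> lower_half" for x
      using grad_norm_bounds(2)[of j q x] by (simp add: grad_def)
  qed
qed

lemma C1_up_to_boundaryE:
  fixes f :: "'a::euclidean_space \<Rightarrow> 'b::real_normed_vector"
  assumes "C1_up_to_boundary U f" "open U"
  obtains F D where "\<And>x. x \<in> U \<Longrightarrow> F x = f x"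
    "\<And>x. x \<in> closure U \<Longrightarrow> (F has_derivative blinfun_apply (D x)) (at x within closure U)" "continuous_on (closure U) D"
    "continuous_on (closure U) F" "\<And>x. x \<in> U \<Longrightarrow> (f has_derivative blinfun_apply (D x)) (at x)"
proof -
  obtain F D where F: "\<And>x. x \<in> U \<Longrightarrow> F x = f x"
    and D: "\<And>x. x \<in> closure U \<Longrightarrow> (F has_derivative blinfun_apply (D x)) (at x within closure U)" "continuous_on (closure U) D"
    using assms(1) unfolding C1_up_to_boundary_def C1_on_def by metis
  have "continuous_on (closure U) F" by (rule has_derivative_continuous_on) (rule D(1))
  moreover have "(f has_derivative blinfun_apply (D x)) (at x)" if "x \<in> U" for x
  proof (rule has_derivative_transform_within_open[OF _ assms(2) that F])
    show "(F has_derivative blinfun_apply (D x)) (at x)"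
      using has_derivative_subset[OF D(1) closure_subset, of x] that closure_subset[of U] at_within_open[OF that assms(2)] by auto
  qed
  ultimately show ?thesis using that F D by blast
qed

text \<open>The planar derivatives are taken from \<open>u\<close>, which coincides with the
  tangential trace of \<open>v\<close>. This gives \<open>A\<close> the divergence constraint, and
  the extensions of \<open>u\<close> to the two closed sides bound the trace up to the
  curve.\<close>

lemma surface_velocity_data:
  fixes u :: "real^2 \<Rightarrow> real^2"
  assumes cl: "closed \<Gamma>" and C1: "C1_up_to_boundary (inside \<Gamma>) u" "C1_up_to_boundary (outside \<Gamma>) u"
    and uv: "\<forall>x\<in>- \<Gamma>. par (v (emb x)) = u x" and div: "\<forall>x\<in>- \<Gamma>. divergence u x = 0"
  obtains A :: "2 \<Rightarrow> real^2 \<Rightarrow> real" where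
    "\<And>k x. x \<notin> \<Gamma> \<Longrightarrow> ((\<lambda>t. v (emb (x + t *\<^sub>R axis k 1)) $ up k) has_real_derivative A k x) (at 0)"
    "\<And>k. continuous_on (- \<Gamma>) (A k)" "\<And>x. x \<notin> \<Gamma> \<Longrightarrow> (\<Sum>k\<in>UNIV. A k x) = 0"
    "\<And>k R. \<exists>C. \<forall>x. x \<notin> \<Gamma> \<longrightarrow> norm x \<le> R \<longrightarrow> \<bar>v (emb x) $ up k\<bar> \<le> C"
proof -
  obtain F1 D1 where 1: "\<And>x. x \<in> inside \<Gamma> \<Longrightarrow> F1 x = u x" "continuous_on (closure (inside \<Gamma>)) D1"
     "continuous_on (closure (inside \<Gamma>)) F1" "\<And>x. x \<in> inside \<Gamma> \<Longrightarrow> (u has_derivative blinfun_apply (D1 x)) (at x)"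
    using C1_up_to_boundaryE[OF C1(1) open_inside[OF cl]] by metis
  obtain F2 D2 where 2: "\<And>x. x \<in> outside \<Gamma> \<Longrightarrow> F2 x = u x" "continuous_on (closure (outside \<Gamma>)) D2"
     "continuous_on (closure (outside \<Gamma>)) F2" "\<And>x. x \<in> outside \<Gamma> \<Longrightarrow> (u has_derivative blinfun_apply (D2 x)) (at x)"
    using C1_up_to_boundaryE[OF C1(2) open_outside[OF cl]] by metis
  have cover: "- \<Gamma> = inside \<Gamma> \<union> outside \<Gamma>" using inside_Un_outside[of \<Gamma>] by simp
  define A where "A k x = pd k u x $ k" for k x
  have A1: "A k x = D1 x (axis k 1) $ k" if "x \<in> inside \<Gamma>" for k x
    unfolding A_def using pd_eq[OF 1(4)[OF that]] by simp
  have A2: "A k x = D2 x (axis k 1) $ k" if "x \<in> outside \<Gamma>" for k x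
    unfolding A_def using pd_eq[OF 2(4)[OF that]] by simp
  have du: "\<exists>D. (u has_derivative D) (at x)" if "x \<notin> \<Gamma>" for x
    using that cover 1(4)[of x] 2(4)[of x] by blast
  have vu: "v (emb x) $ up k = u x $ k" if "x \<notin> \<Gamma>" for x k
      using uv that par_nth[of "v (emb x)" k] by simp
  show ?thesis
  proof (rule that[of A])
    show "((\<lambda>t. v (emb (x + t *\<^sub>R axis k 1)) $ up k) has_real_derivative A k x) (at 0)" if x: "x \<notin> \<Gamma>" for k x
    proof -
      obtain D where D: "(u has_derivative D) (at x)" using du[OF x] by blast
      have "((\<lambda>t. u (x + t *\<^sub>R axis k 1) $ k) has_real_derivative A k x) (at 0)"
        unfolding A_def pd_eq[OF D] by (rule line_has_derivative[OF D bounded_linear_vec_nth])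
      moreover have "\<forall>\<^sub>F t in nhds 0. x + t *\<^sub>R axis k 1 \<in> - \<Gamma>"
        by (rule topological_tendstoD) (use x cl in \<open>auto intro!: tendsto_eq_intros filterlim_ident\<close>)
      then have "\<forall>\<^sub>F t in nhds 0. v (emb (x + t *\<^sub>R axis k 1)) $ up k = u (x + t *\<^sub>R axis k 1) $ k"
        by eventually_elim (simp add: vu)
      ultimately show ?thesis by (subst DERIV_cong_ev[OF refl _ refl])
    qed
    have "continuous_on (inside \<Gamma>) (A k)" for k
    proof -
      have "continuous_on (inside \<Gamma>) (\<lambda>x. D1 x (axis k 1) $ k)"
        by (intro continuous_on_component continuous_intros continuous_on_subset[OF 1(2) closure_subset])
      then show ?thesis by (rule continuous_on_cong[THEN iffD1, OF refl, rotated]) (simp add: A1)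
    qed
    moreover have "continuous_on (outside \<Gamma>) (A k)" for k
    proof -
      have "continuous_on (outside \<Gamma>) (\<lambda>x. D2 x (axis k 1) $ k)"
        by (intro continuous_on_component continuous_intros continuous_on_subset[OF 2(2) closure_subset])
      then show ?thesis by (rule continuous_on_cong[THEN iffD1, OF refl, rotated]) (simp add: A2)
    qed
    ultimately show "continuous_on (- \<Gamma>) (A k)" for k
      unfolding cover by (intro continuous_on_open_Un open_inside open_outside cl)
    show "(\<Sum>k\<in>UNIV. A k x) = 0" if "x \<notin> \<Gamma>" for x
      using div that by (simp add: A_def divergence_def)
    show "\<exists>C. \<forall>x. x \<notin> \<Gamma> \<longrightarrow> norm x \<le> R \<longrightarrow> \<bar>v (emb x) $ up k\<bar> \<le> C" for k R
    proof -
      have b: "\<exists>C. \<forall>x\<in>closure U \<inter> cball 0 R. \<bar>F x $ k\<bar> \<le> C" if "continuous_on (closure U) F" for U and F :: "real^2 \<Rightarrow> real^2"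
      proof -
        have "compact (closure U \<inter> cball 0 R)" by (intro closed_Int_compact) auto
        moreover have "continuous_on (closure U \<inter> cball 0 R) (\<lambda>x. F x $ k)"
          by (intro continuous_on_component continuous_on_subset[OF that]) auto
        ultimately show ?thesis using continuous_bounded_on_compact by metis
      qed
      obtain C1 C2 where C: "\<forall>x\<in>closure (inside \<Gamma>) \<inter> cball 0 R. \<bar>F1 x $ k\<bar> \<le> C1"
          "\<forall>x\<in>closure (outside \<Gamma>) \<inter> cball 0 R. \<bar>F2 x $ k\<bar> \<le> C2"
        using b[OF 1(3)] b[OF 2(3)] by metis
      have "\<bar>v (emb x) $ up k\<bar> \<le> max C1 C2" if x: "x \<notin> \<Gamma>" "norm x \<le> R" for x
      proof (cases "x \<in> inside \<Gamma>")
        case True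
        then have "x \<in> closure (inside \<Gamma>) \<inter> cball 0 R" using x subsetD[OF closure_subset] by auto
        from bspec[OF C(1) this] show ?thesis using x 1(1)[OF True] by (simp add: vu le_max_iff_disj)
      next
        case False
        then have o: "x \<in> outside \<Gamma>" using x cover by blast
        then have "x \<in> closure (outside \<Gamma>) \<inter> cball 0 R" using x subsetD[OF closure_subset] by auto
        from bspec[OF C(2) this] show ?thesis using x 2(1)[OF o] by (simp add: vu le_max_iff_disj)
      qed
      then show ?thesis by blast
    qed
  qed
qed

text \<open>The traces in \<open>jump\<close> are \<open>Lim\<close> terms, meaningful only at
  points where the side accumulates; \<open>acc\<close> ensures this, and the limits are then the
  values of the continuous extensions \<open>F1\<close> and \<open>F2\<close>.\<close>

lemma surface_pressure_data:
  fixes p :: "real^2 \<Rightarrow> real"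
  assumes cl: "closed \<Gamma>" and C1: "C1_up_to_boundary (inside \<Gamma>) p" "C1_up_to_boundary (outside \<Gamma>) p"
    and acc: "\<Gamma> \<subseteq> closure (inside \<Gamma>)" "\<Gamma> \<subseteq> closure (outside \<Gamma>)"
  obtains F1 F2 D1 D2 where
    "\<And>x. x \<in> inside \<Gamma> \<Longrightarrow> F1 x = p x" "\<And>x. x \<in> outside \<Gamma> \<Longrightarrow> F2 x = p x"
    "\<And>x. x \<in> closure (inside \<Gamma>) \<Longrightarrow> (F1 has_derivative blinfun_apply (D1 x)) (at x within closure (inside \<Gamma>))"
    "\<And>x. x \<in> closure (outside \<Gamma>) \<Longrightarrow> (F2 has_derivative blinfun_apply (D2 x)) (at x within closure (outside \<Gamma>))"
    "continuous_on (closure (inside \<Gamma>)) D1" "continuous_on (closure (outside \<Gamma>)) D2"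
    "\<And>x. x \<in> \<Gamma> \<Longrightarrow> jump \<Gamma> p x = F1 x - F2 x"
    "\<And>k x. x \<in> inside \<Gamma> \<Longrightarrow> grad p x $ k = D1 x (axis k 1)" "\<And>k x. x \<in> outside \<Gamma> \<Longrightarrow> grad p x $ k = D2 x (axis k 1)"
proof -
  obtain F1 D1 where 1: "\<And>x. x \<in> inside \<Gamma> \<Longrightarrow> F1 x = p x"
     "\<And>x. x \<in> closure (inside \<Gamma>) \<Longrightarrow> (F1 has_derivative blinfun_apply (D1 x)) (at x within closure (inside \<Gamma>))"
     "continuous_on (closure (inside \<Gamma>)) D1"
     "continuous_on (closure (inside \<Gamma>)) F1" "\<And>x. x \<in> inside \<Gamma> \<Longrightarrow> (p has_derivative blinfun_apply (D1 x)) (at x)"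
    using C1_up_to_boundaryE[OF C1(1) open_inside[OF cl]] by metis
  obtain F2 D2 where 2: "\<And>x. x \<in> outside \<Gamma> \<Longrightarrow> F2 x = p x"
     "\<And>x. x \<in> closure (outside \<Gamma>) \<Longrightarrow> (F2 has_derivative blinfun_apply (D2 x)) (at x within closure (outside \<Gamma>))"
     "continuous_on (closure (outside \<Gamma>)) D2"
     "continuous_on (closure (outside \<Gamma>)) F2" "\<And>x. x \<in> outside \<Gamma> \<Longrightarrow> (p has_derivative blinfun_apply (D2 x)) (at x)"
    using C1_up_to_boundaryE[OF C1(2) open_outside[OF cl]] by metis
  have trace: "Lim (at x within U) p = F x"
    if "continuous_on (closure U) F" "\<And>x. x \<in> U \<Longrightarrow> F x = p x" "x \<in> closure U" "x \<notin> U" for F :: "real^2 \<Rightarrow> real" and U x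
  proof (rule tendsto_Lim)
    show "\<not> trivial_limit (at x within U)"
      using that(3,4) by (simp add: trivial_limit_within closure_def)
    have "(F \<longlongrightarrow> F x) (at x within closure U)" using that(1,3) by (simp add: continuous_on_def)
    then have "(F \<longlongrightarrow> F x) (at x within U)" by (rule tendsto_within_subset) (rule closure_subset)
    then show "(p \<longlongrightarrow> F x) (at x within U)"
      by (rule Lim_transform_eventually) (simp add: that(2) eventually_at_filter)
  qed
  show ?thesis
  proof (rule that[of F1 F2 D1 D2])
    show "jump \<Gamma> p x = F1 x - F2 x" if "x \<in> \<Gamma>" for x
    proof -
      have "x \<notin> inside \<Gamma>" "x \<notin> outside \<Gamma>"
        using that inside_no_overlap[of \<Gamma>] outside_no_overlap[of \<Gamma>] by blast+
      moreover have "x \<in> closure (inside \<Gamma>)" "x \<in> closure (outside \<Gamma>)" using that acc by blast+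
      ultimately show ?thesis
        unfolding jump_def using trace[OF 1(4,1), of x] trace[OF 2(4,1), of x] by simp
    qed
    show "grad p x $ k = D1 x (axis k 1)" if "x \<in> inside \<Gamma>" for k x
      using pd_eq[OF 1(5)[OF that]] by (simp add: grad_def)
    show "grad p x $ k = D2 x (axis k 1)" if "x \<in> outside \<Gamma>" for k x
      using pd_eq[OF 2(5)[OF that]] by (simp add: grad_def)
  qed (use 1 2 in auto)
qed

section \<open>Uniqueness\<close>

lemma decays_on_sumE:
  assumes "decays_on S k f" "decays_on S k f'"
  obtains C R where "C > 0" "\<And>x. x \<in> S \<Longrightarrow> norm x \<ge> R \<Longrightarrow> norm (f x) + norm (f' x) \<le> C / norm x ^ k"
proof -
  obtain C R where 1: "C > 0" "\<And>x. x \<in> S \<Longrightarrow> norm x \<ge> R \<Longrightarrow> norm (f x) \<le> C / norm x ^ k"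
    using decays_onE[OF assms(1)] by metis
  obtain C' R' where 2: "C' > 0" "\<And>x. x \<in> S \<Longrightarrow> norm x \<ge> R' \<Longrightarrow> norm (f' x) \<le> C' / norm x ^ k"
    using decays_onE[OF assms(2)] by metis
  show ?thesis
  proof (rule that[of "C + C'" "max R R'"])
    show "norm (f x) + norm (f' x) \<le> (C + C') / norm x ^ k" if "x \<in> S" "norm x \<ge> max R R'" for x
      using 1(2)[of x] 2(2)[of x] that by (simp add: add_divide_distrib)
  qed (use 1 2 in simp)
qed

text \<open>The curve is a differentiable image of an interval in the plane, hence null. The
  derivative is bounded on one period, and \<open>emb\<close> preserves norms, so the embedded curve
  inherits the Lipschitz constant.\<close>

lemma C2_Jordan_param_facts:
  assumes "C2_Jordan_param \<gamma> \<Gamma>"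
  shows "pathfinish \<gamma> = pathstart \<gamma>" "simple_path \<gamma>" "\<Gamma> = path_image \<gamma>" "compact \<Gamma>"
    "AE x in lborel. x \<notin> \<Gamma>" "\<exists>L. L-lipschitz_on {0..1} (\<lambda>t. emb (\<gamma> t))"
proof -
  show sp: "simple_path \<gamma>" and \<Gamma>: "\<Gamma> = path_image \<gamma>" using assms by (auto simp: C2_Jordan_param_def)
  have "\<gamma> (0 + 1) = \<gamma> 0" using assms unfolding C2_Jordan_param_def by blast
  then show "pathfinish \<gamma> = pathstart \<gamma>" by (simp add: pathfinish_def pathstart_def)
  show cpt: "compact \<Gamma>" unfolding \<Gamma> using sp by (rule compact_simple_path_image)
  obtain D D2 where D: "\<And>t. (\<gamma> has_derivative blinfun_apply (D t)) (at t)" and D2: "\<And>t. (D has_derivative blinfun_apply (D2 t)) (at t)"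
    using assms unfolding C2_Jordan_param_def C2_on_def C1_on_def by (metis UNIV_I)
  have Dc: "continuous_on {0..1} D"
    using has_derivative_at_withinI[OF D2] by (intro has_derivative_continuous_on[of _ D "\<lambda>t. blinfun_apply (D2 t)"]) auto
  have dif: "\<gamma> differentiable_on {0..1}"
    using has_derivative_at_withinI[OF D] by (auto simp: differentiable_on_def differentiable_def)
  then have "negligible (\<gamma> ` {0..1})"
    by (rule negligible_differentiable_image_lowdim[rotated]) simp
  then have "\<Gamma> \<in> null_sets lebesgue" unfolding \<Gamma> path_image_def by (simp add: negligible_iff_null_sets)
  moreover have "\<Gamma> \<in> sets lborel" using cpt by (simp add: borel_compact)
  ultimately have "\<Gamma> \<in> null_sets lborel" by (simp add: null_sets_completion_iff)
  then show "AE x in lborel. x \<notin> \<Gamma>" by (rule AE_not_in)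
  have "continuous_on {0..1} (\<lambda>t. norm (D t))" by (intro continuous_intros Dc)
  then obtain L where L: "0 \<le> L" "\<And>t. t \<in> {0..1} \<Longrightarrow> \<bar>norm (D t)\<bar> \<le> L"
    using continuous_bounded_on_compact[of "{0..1}" "\<lambda>t. norm (D t)"] by (metis compact_Icc)
  have "L-lipschitz_on {0..1} \<gamma>"
    by (rule bounded_derivative_imp_lipschitz[OF has_derivative_at_withinI[OF D]])
       (use L(1) L(2)[unfolded norm_blinfun.rep_eq abs_of_nonneg[OF onorm_pos_le[OF blinfun.bounded_linear_right]]] in auto)
  then have "L-lipschitz_on {0..1} (\<lambda>t. emb (\<gamma> t))"
    unfolding lipschitz_on_def dist_norm linear_diff[OF linear_emb, symmetric] norm_emb .
  then show "\<exists>L. L-lipschitz_on {0..1} (\<lambda>t. emb (\<gamma> t))" by blast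
qed

theorem theorem2p3:
  fixes \<Gamma> :: "(real^2) set" and \<gamma> :: "real \<Rightarrow> real^2"
    and \<nu> :: "real^2 \<Rightarrow> real^2" and g :: "real^2 \<Rightarrow> real"
    and v v' :: "real^3 \<Rightarrow> real^3" and q q' :: "real^3 \<Rightarrow> real"
    and u u' :: "real^2 \<Rightarrow> real^2" and p p' :: "real^2 \<Rightarrow> real"
  assumes "C2_Jordan_param \<gamma> \<Gamma>"
    and "outward_unit_normal \<gamma> \<Gamma> \<nu>"
    and "continuous_on \<Gamma> g"
    and "has_curve_integral (\<lambda>x. g x *\<^sub>R \<nu> x) 0 \<gamma>"
    and "classical_solution \<Gamma> \<nu> g v q u p"
    and "classical_solution \<Gamma> \<nu> g v' q' u' p'"
  shows "(\<forall>x\<in>closure lower_half - emb ` \<Gamma>. v x = v' x \<and> q x = q' x) \<and>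
         (\<forall>x\<in>- \<Gamma>. u x = u' x \<and> p x = p' x)"
proof -
  note J = C2_Jordan_param_facts[OF assms(1)]
  note JC = Jordan_curve_plane[OF J(2,1), folded J(3)]
  have \<Gamma>cl: "closed \<Gamma>" using J(4) by (rule compact_imp_closed)
  obtain L where L: "L-lipschitz_on {0..1} (\<lambda>t. emb (\<gamma> t))" using J(6) by blast
  note sol = assms(5)[unfolded classical_solution_def classical_regularity_def classical_decay_def solves_problem_def]
  note sol' = assms(6)[unfolded classical_solution_def classical_regularity_def classical_decay_def solves_problem_def]
  let ?S = "closure lower_half - emb ` \<Gamma>" and ?i = "inside \<Gamma>" and ?o = "outside \<Gamma>"
  have rv: "C2_on lower_half v" "C1_on ?S v" "finite_energy v" "C2_on lower_half v'" "C1_on ?S v'" "finite_energy v'"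
    and rq: "C1_on lower_half q" "finite_energy q" "C1_on lower_half q'" "finite_energy q'"
    and cq: "continuous_on ?S q" "continuous_on ?S q'"
    and ru: "C1_up_to_boundary ?i u" "C1_up_to_boundary ?o u" "C1_up_to_boundary ?i u'" "C1_up_to_boundary ?o u'"
    and rp: "C1_up_to_boundary ?i p" "C1_up_to_boundary ?o p" "C1_up_to_boundary ?i p'" "C1_up_to_boundary ?o p'"
    using sol sol' by auto
  have dec: "decays_on lower_half 2 v" "decays_on lower_half 2 v'"
    "decays_on lower_half 3 (grad_norm v)" "decays_on lower_half 3 (grad_norm v')"
    "decays_on lower_half 3 q" "decays_on lower_half 3 q'"
    "decays_on (- \<Gamma>) 2 u" "decays_on (- \<Gamma>) 2 u'" "decays_on (- \<Gamma>) 2 p" "decays_on (- \<Gamma>) 2 p'"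
    using sol sol' by auto
  have bdry: "\<forall>x\<in>- \<Gamma>. par (v (emb x)) = u x" "\<forall>x\<in>- \<Gamma>. divergence u x = 0"
    "\<forall>x\<in>- \<Gamma>. par (v' (emb x)) = u' x" "\<forall>x\<in>- \<Gamma>. divergence u' x = 0"
    using sol sol' by auto
  then have vu: "par (v (emb x)) = u x" "par (v' (emb x)) = u' x" if "x \<notin> \<Gamma>" for x
    using that by auto
  have cover: "- \<Gamma> = ?i \<union> ?o" using inside_Un_outside[of \<Gamma>] by simp
  have oi: "open ?i" and oo: "open ?o" using \<Gamma>cl by (auto intro: open_inside open_outside)

  \<comment> \<open>Componentwise derivatives of the two solutions\<close>
  obtain W WW where W:
    "\<And>i. continuous_on ?S (\<lambda>x. v x $ i)" "\<And>i j. continuous_on ?S (W i j)" "\<And>i j. continuous_on lower_half (WW i j)"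
    "\<And>i j x. x \<in> lower_half \<Longrightarrow> ((\<lambda>t. v (x + t *\<^sub>R axis j 1) $ i) has_real_derivative W i j x) (at 0)"
    "\<And>i j x. x \<in> lower_half \<Longrightarrow> ((\<lambda>t. W i j (x + t *\<^sub>R axis j 1)) has_real_derivative WW i j x) (at 0)"
    "\<And>i x. x \<in> lower_half \<Longrightarrow> laplacian v x $ i = (\<Sum>j\<in>UNIV. WW i j x)"
    "\<And>x. x \<in> lower_half \<Longrightarrow> divergence v x = (\<Sum>i\<in>UNIV. W i i x)"
    "\<And>i j. set_integrable lborel lower_half (\<lambda>x. (W i j x)\<^sup>2)"
    "\<And>i j x. x \<in> lower_half \<Longrightarrow> \<bar>W i j x\<bar> \<le> grad_norm v x"
    "\<And>k x. x \<notin> \<Gamma> \<Longrightarrow> par (pd3_bdry v x) $ k = W (up k) 3 (emb x)"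
    using that by (rule velocity_data[OF \<Gamma>cl rv(1,2,3)])
  obtain W' WW' where W':
    "\<And>i. continuous_on ?S (\<lambda>x. v' x $ i)" "\<And>i j. continuous_on ?S (W' i j)" "\<And>i j. continuous_on lower_half (WW' i j)"
    "\<And>i j x. x \<in> lower_half \<Longrightarrow> ((\<lambda>t. v' (x + t *\<^sub>R axis j 1) $ i) has_real_derivative W' i j x) (at 0)"
    "\<And>i j x. x \<in> lower_half \<Longrightarrow> ((\<lambda>t. W' i j (x + t *\<^sub>R axis j 1)) has_real_derivative WW' i j x) (at 0)"
    "\<And>i x. x \<in> lower_half \<Longrightarrow> laplacian v' x $ i = (\<Sum>j\<in>UNIV. WW' i j x)"
    "\<And>x. x \<in> lower_half \<Longrightarrow> divergence v' x = (\<Sum>i\<in>UNIV. W' i i x)"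
    "\<And>i j. set_integrable lborel lower_half (\<lambda>x. (W' i j x)\<^sup>2)"
    "\<And>i j x. x \<in> lower_half \<Longrightarrow> \<bar>W' i j x\<bar> \<le> grad_norm v' x"
    "\<And>k x. x \<notin> \<Gamma> \<Longrightarrow> par (pd3_bdry v' x) $ k = W' (up k) 3 (emb x)"
    using that by (rule velocity_data[OF \<Gamma>cl rv(4,5,6)])
  note Q = pressure_data[OF rq(1,2)] and Q' = pressure_data[OF rq(3,4)]
  obtain A where A:
    "\<And>k x. x \<notin> \<Gamma> \<Longrightarrow> ((\<lambda>t. v (emb (x + t *\<^sub>R axis k 1)) $ up k) has_real_derivative A k x) (at 0)"
    "\<And>k. continuous_on (- \<Gamma>) (A k)" "\<And>x. x \<notin> \<Gamma> \<Longrightarrow> (\<Sum>k\<in>UNIV. A k x) = 0"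
    "\<And>k R. \<exists>C. \<forall>x. x \<notin> \<Gamma> \<longrightarrow> norm x \<le> R \<longrightarrow> \<bar>v (emb x) $ up k\<bar> \<le> C"
    using that by (rule surface_velocity_data[OF \<Gamma>cl ru(1,2) bdry(1,2)])
  obtain A' where A':
    "\<And>k x. x \<notin> \<Gamma> \<Longrightarrow> ((\<lambda>t. v' (emb (x + t *\<^sub>R axis k 1)) $ up k) has_real_derivative A' k x) (at 0)"
    "\<And>k. continuous_on (- \<Gamma>) (A' k)" "\<And>x. x \<notin> \<Gamma> \<Longrightarrow> (\<Sum>k\<in>UNIV. A' k x) = 0"
    "\<And>k R. \<exists>C. \<forall>x. x \<notin> \<Gamma> \<longrightarrow> norm x \<le> R \<longrightarrow> \<bar>v' (emb x) $ up k\<bar> \<le> C"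
    using that by (rule surface_velocity_data[OF \<Gamma>cl ru(3,4) bdry(3,4)])
  obtain F1 F2 D1 D2 where P:
    "\<And>x. x \<in> ?i \<Longrightarrow> F1 x = p x" "\<And>x. x \<in> ?o \<Longrightarrow> F2 x = p x"
    "\<And>x. x \<in> closure ?i \<Longrightarrow> (F1 has_derivative blinfun_apply (D1 x)) (at x within closure ?i)"
    "\<And>x. x \<in> closure ?o \<Longrightarrow> (F2 has_derivative blinfun_apply (D2 x)) (at x within closure ?o)"
    "continuous_on (closure ?i) D1" "continuous_on (closure ?o) D2"
    "\<And>x. x \<in> \<Gamma> \<Longrightarrow> jump \<Gamma> p x = F1 x - F2 x"
    "\<And>k x. x \<in> ?i \<Longrightarrow> grad p x $ k = D1 x (axis k 1)" "\<And>k x. x \<in> ?o \<Longrightarrow> grad p x $ k = D2 x (axis k 1)"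
    using that by (rule surface_pressure_data[OF \<Gamma>cl rp(1,2) JC(1,2)])
  obtain F1' F2' D1' D2' where P':
    "\<And>x. x \<in> ?i \<Longrightarrow> F1' x = p' x" "\<And>x. x \<in> ?o \<Longrightarrow> F2' x = p' x"
    "\<And>x. x \<in> closure ?i \<Longrightarrow> (F1' has_derivative blinfun_apply (D1' x)) (at x within closure ?i)"
    "\<And>x. x \<in> closure ?o \<Longrightarrow> (F2' has_derivative blinfun_apply (D2' x)) (at x within closure ?o)"
    "continuous_on (closure ?i) D1'" "continuous_on (closure ?o) D2'"
    "\<And>x. x \<in> \<Gamma> \<Longrightarrow> jump \<Gamma> p' x = F1' x - F2' x"
    "\<And>k x. x \<in> ?i \<Longrightarrow> grad p' x $ k = D1' x (axis k 1)" "\<And>k x. x \<in> ?o \<Longrightarrow> grad p' x $ k = D2' x (axis k 1)"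
    using that by (rule surface_pressure_data[OF \<Gamma>cl rp(3,4) JC(1,2)])

  \<comment> \<open>Gluing the surface pressure difference across the curve\<close>
  define b where "b x = (if x \<in> closure ?i then F1 x - F1' x else F2 x - F2' x)" for x
  define Bd where "Bd k x = grad p x $ k - grad p' x $ k" for k x
  define E1 where "E1 x = D1 x - D1' x" for x
  define E2 where "E2 x = D2 x - D2' x" for x
  have b1: "b x = F1 x - F1' x" if "x \<in> closure ?i" for x using that by (simp add: b_def)
  \<comment> \<open>Where the two closed sides meet, both pressures jump by the same
    \<open>g\<close>, so the extensions of the difference agree and \<open>b\<close> is the
    extension from either side.\<close>
  have b2: "b x = F2 x - F2' x" if "x \<in> closure ?o" for x
  proof (cases "x \<in> closure ?i")
    case True
    then have x: "x \<in> \<Gamma>" using that JC(3) by blast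
    then have "jump \<Gamma> p x = g x" "jump \<Gamma> p' x = g x" using sol sol' by auto
    then show ?thesis using P(7)[OF x] P'(7)[OF x] True by (simp add: b_def)
  qed (simp add: b_def)
  have bp: "b x = p x - p' x" if "x \<notin> \<Gamma>" for x
  proof (cases "x \<in> ?i")
    case True
    then show ?thesis using b1[OF subsetD[OF closure_subset True]] P(1) P'(1) by simp
  next
    case False
    then have "x \<in> ?o" using that cover by blast
    then show ?thesis using b2[OF subsetD[OF closure_subset \<open>x \<in> ?o\<close>]] P(2) P'(2) by simp
  qed
  have d1: "(b has_derivative blinfun_apply (E1 x)) (at x within closure ?i)" if "x \<in> closure ?i" for x
  proof (rule has_derivative_transform[OF that b1])
    have "blinfun_apply (E1 x) = (\<lambda>h. D1 x h - D1' x h)" by (simp add: E1_def fun_eq_iff blinfun.diff_left)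
    then show "((\<lambda>x. F1 x - F1' x) has_derivative blinfun_apply (E1 x)) (at x within closure ?i)"
      using has_derivative_diff[OF P(3)[OF that] P'(3)[OF that]] by simp
  qed
  have d2: "(b has_derivative blinfun_apply (E2 x)) (at x within closure ?o)" if "x \<in> closure ?o" for x
  proof (rule has_derivative_transform[OF that b2])
    have "blinfun_apply (E2 x) = (\<lambda>h. D2 x h - D2' x h)" by (simp add: E2_def fun_eq_iff blinfun.diff_left)
    then show "((\<lambda>x. F2 x - F2' x) has_derivative blinfun_apply (E2 x)) (at x within closure ?o)"
      using has_derivative_diff[OF P(4)[OF that] P'(4)[OF that]] by simp
  qed
  have E1c: "continuous_on (closure ?i) E1" unfolding E1_def by (intro continuous_intros P P')
  have E2c: "continuous_on (closure ?o) E2" unfolding E2_def by (intro continuous_intros P P')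
  have Bd1: "Bd k x = E1 x (axis k 1)" if "x \<in> ?i" for k x
    by (simp add: Bd_def E1_def blinfun.diff_left P(8)[OF that] P'(8)[OF that])
  have Bd2: "Bd k x = E2 x (axis k 1)" if "x \<in> ?o" for k x
    by (simp add: Bd_def E2_def blinfun.diff_left P(9)[OF that] P'(9)[OF that])
  have dat: "(b has_derivative blinfun_apply (E x)) (at x)"
    if "open U" "x \<in> U" "\<And>x. x \<in> closure U \<Longrightarrow> (b has_derivative blinfun_apply (E x)) (at x within closure U)"
    for U E x
    using has_derivative_subset[OF that(3)[OF subsetD[OF closure_subset that(2)]] closure_subset] at_within_open[OF that(2,1)] by simp

  \<comment> \<open>Common decay constants\<close>
  obtain C1 R1 where dv: "C1 > 0" "\<And>x. x \<in> lower_half \<Longrightarrow> norm x \<ge> R1 \<Longrightarrow> norm (v x) + norm (v' x) \<le> C1 / norm x ^ 2"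
    using that by (rule decays_on_sumE[OF dec(1,2)])
  obtain C2 R2 where dg: "C2 > 0" "\<And>x. x \<in> lower_half \<Longrightarrow> norm x \<ge> R2 \<Longrightarrow> norm (grad_norm v x) + norm (grad_norm v' x) \<le> C2 / norm x ^ 3"
    using that by (rule decays_on_sumE[OF dec(3,4)])
  obtain C3 R3 where dq: "C3 > 0" "\<And>x. x \<in> lower_half \<Longrightarrow> norm x \<ge> R3 \<Longrightarrow> norm (q x) + norm (q' x) \<le> C3 / norm x ^ 3"
    using that by (rule decays_on_sumE[OF dec(5,6)])
  obtain C4 R4 where du: "C4 > 0" "\<And>x. x \<in> - \<Gamma> \<Longrightarrow> norm x \<ge> R4 \<Longrightarrow> norm (u x) + norm (u' x) \<le> C4 / norm x ^ 2"
    using that by (rule decays_on_sumE[OF dec(7,8)])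
  obtain C5 R5 where dp: "C5 > 0" "\<And>x. x \<in> - \<Gamma> \<Longrightarrow> norm x \<ge> R5 \<Longrightarrow> norm (p x) + norm (p' x) \<le> C5 / norm x ^ 2"
    using that by (rule decays_on_sumE[OF dec(9,10)])
  obtain R6 where R6: "\<And>x. x \<in> \<Gamma> \<Longrightarrow> norm x \<le> R6"
    using compact_imp_bounded[OF J(4)] by (auto simp: bounded_iff)
  define C0 where "C0 = C1 + C2 + C3 + C4 + C5"
  \<comment> \<open>Besides the five decay radii, \<open>R0\<close> exceeds the norm of every point
    of the curve, so that beyond it \<open>b\<close> is the difference of \<open>p\<close> and
    \<open>p'\<close>.\<close>
  define R0 where "R0 = 1 + \<bar>R1\<bar> + \<bar>R2\<bar> + \<bar>R3\<bar> + \<bar>R4\<bar> + \<bar>R5\<bar> + \<bar>R6\<bar>"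
  have R0: "R0 \<ge> 1" "R0 \<ge> R1" "R0 \<ge> R2" "R0 \<ge> R3" "R0 \<ge> R4" "R0 \<ge> R5" "R0 > R6" unfolding R0_def by linarith+
  have C0: "c / norm x ^ k \<le> C0 / norm x ^ k" if "c \<in> {C1, C2, C3, C4, C5}" for c k and x :: "'a::real_normed_vector"
    using that dv(1) dg(1) dq(1) du(1) dp(1) by (intro divide_right_mono) (auto simp: C0_def)
  have sq_diff: "set_integrable lborel lower_half (\<lambda>x. (h x - k x)\<^sup>2)"
    if "continuous_on lower_half h" "continuous_on lower_half k"
      "set_integrable lborel lower_half (\<lambda>x. (h x)\<^sup>2)" "set_integrable lborel lower_half (\<lambda>x. (k x)\<^sup>2)" for h k :: "real^3 \<Rightarrow> real"
  proof (rule set_integrable_continuous_bound[OF _ lower_half_sets])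
    show "continuous_on lower_half (\<lambda>x. (h x - k x)\<^sup>2)" by (intro continuous_intros that)
    show "set_integrable lborel lower_half (\<lambda>x. 2 * (h x)\<^sup>2 + 2 * (k x)\<^sup>2)"
      by (intro set_integral_add(1) set_integrable_mult_right that)
    show "\<bar>(h x - k x)\<^sup>2\<bar> \<le> 2 * (h x)\<^sup>2 + 2 * (k x)\<^sup>2" for x
      using zero_le_power2[of "h x + k x"] unfolding abs_power2 by (simp add: power2_sum power2_diff)
  qed
  have sub: "lower_half \<subseteq> ?S" using emb_image_disjoint[of \<Gamma>] closure_subset[of lower_half] by auto

  \<comment> \<open>The difference of the two solutions as an instance of
    \<open>stokes_difference\<close>\<close>
  interpret stokes_difference \<gamma> L \<Gamma> "\<lambda>i x. v x $ i - v' x $ i" "\<lambda>i j x. W i j x - W' i j x"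
    "\<lambda>i j x. WW i j x - WW' i j x" "\<lambda>x. q x - q' x" "\<lambda>j x. grad q x $ j - grad q' x $ j"
    "\<lambda>k x. A k x - A' k x" b Bd C0 R0
  proof
    show "L-lipschitz_on {0..1} (\<lambda>t. emb (\<gamma> t))" by (rule L)
    show "\<Gamma> = \<gamma> ` {0..1}" using J(3) by (simp add: path_image_def)
    show "AE x in lborel. x \<notin> \<Gamma>" by (rule J)
    show "closed \<Gamma>" by (rule \<Gamma>cl)
    show "continuous_on ?S (\<lambda>x. v x $ i - v' x $ i)" "continuous_on ?S (\<lambda>x. W i j x - W' i j x)"
      "continuous_on lower_half (\<lambda>x. WW i j x - WW' i j x)" for i j
      by (intro continuous_intros W W')+
    show "((\<lambda>t. v (x + t *\<^sub>R axis j 1) $ i - v' (x + t *\<^sub>R axis j 1) $ i) has_real_derivative W i j x - W' i j x) (at 0)"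
      "((\<lambda>t. W i j (x + t *\<^sub>R axis j 1) - W' i j (x + t *\<^sub>R axis j 1)) has_real_derivative WW i j x - WW' i j x) (at 0)"
      "((\<lambda>t. q (x + t *\<^sub>R axis j 1) - q' (x + t *\<^sub>R axis j 1)) has_real_derivative grad q x $ j - grad q' x $ j) (at 0)"
      if "x \<in> lower_half" for i j x
      using that by (intro DERIV_diff W W' Q Q'; assumption)+
    show "continuous_on ?S (\<lambda>x. q x - q' x)" by (rule continuous_on_diff[OF cq])
    show "continuous_on lower_half (\<lambda>x. grad q x $ j - grad q' x $ j)" for j
      by (intro continuous_on_diff Q Q')
    show "(\<Sum>j\<in>UNIV. WW i j x - WW' i j x) = grad q x $ i - grad q' x $ i" if "x \<in> lower_half" for i x
    proof -
      have "- laplacian v x + grad q x = 0" "- laplacian v' x + grad q' x = 0" using sol sol' that by auto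
      then have "laplacian v x = grad q x" "laplacian v' x = grad q' x" by (auto simp: add_eq_0_iff2)
      then show ?thesis using W(6)[OF that, of i] W'(6)[OF that, of i] by (simp add: sum_subtractf)
    qed
    show "(\<Sum>i\<in>UNIV. W i i x - W' i i x) = 0" if "x \<in> lower_half" for x
    proof -
      have "divergence v x = 0" "divergence v' x = 0" using sol sol' that by auto
      then show ?thesis using W(7)[OF that] W'(7)[OF that] by (simp add: sum_subtractf)
    qed
    show "set_integrable lborel lower_half (\<lambda>x. (W i j x - W' i j x)\<^sup>2)" for i j
      by (intro sq_diff W W' continuous_on_subset[OF W(2) sub] continuous_on_subset[OF W'(2) sub])
    show "set_integrable lborel lower_half (\<lambda>x. (grad q x $ j - grad q' x $ j)\<^sup>2)" for j
      by (intro sq_diff Q Q')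
    show "R0 \<ge> 1" by (rule R0)
    show "\<bar>v x $ i - v' x $ i\<bar> \<le> C0 / norm x ^ 2" if "x \<in> lower_half" "R0 \<le> norm x" for i x
    proof -
      have "\<bar>v x $ i - v' x $ i\<bar> \<le> norm (v x) + norm (v' x)"
        using component_le_norm_cart[of "v x" i] component_le_norm_cart[of "v' x" i] by linarith
      also have "\<dots> \<le> C1 / norm x ^ 2" using that R0 by (intro dv) auto
      also have "\<dots> \<le> C0 / norm x ^ 2" by (rule C0) simp
      finally show ?thesis .
    qed
    show "\<bar>W i j x - W' i j x\<bar> \<le> C0 / norm x ^ 3" if "x \<in> lower_half" "R0 \<le> norm x" for i j x
    proof -
      have "\<bar>W i j x - W' i j x\<bar> \<le> norm (grad_norm v x) + norm (grad_norm v' x)"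
        using W(9)[OF that(1), of i j] W'(9)[OF that(1), of i j] by simp
      also have "\<dots> \<le> C2 / norm x ^ 3" using that R0 by (intro dg) auto
      also have "\<dots> \<le> C0 / norm x ^ 3" by (rule C0) simp
      finally show ?thesis .
    qed
    show "\<bar>q x - q' x\<bar> \<le> C0 / norm x ^ 3" if "x \<in> lower_half" "R0 \<le> norm x" for x
    proof -
      have "\<bar>q x - q' x\<bar> \<le> norm (q x) + norm (q' x)" by simp
      also have "\<dots> \<le> C3 / norm x ^ 3" using that R0 by (intro dq) auto
      also have "\<dots> \<le> C0 / norm x ^ 3" by (rule C0) simp
      finally show ?thesis .
    qed
    show "v (emb x) $ 3 - v' (emb x) $ 3 = 0" if "x \<notin> \<Gamma>" for x using sol sol' that by auto
    show "W (up k) 3 (emb x) - W' (up k) 3 (emb x) = - Bd k x" if "x \<notin> \<Gamma>" for k x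
    proof -
      have "grad p x = - par (pd3_bdry v x)" "grad p' x = - par (pd3_bdry v' x)" using sol sol' that by auto
      then show ?thesis using W(10)[OF that, of k] W'(10)[OF that, of k] by (simp add: Bd_def)
    qed
    show "((\<lambda>t. v (emb (x + t *\<^sub>R axis k 1)) $ up k - v' (emb (x + t *\<^sub>R axis k 1)) $ up k) has_real_derivative A k x - A' k x) (at 0)"
      if "x \<notin> \<Gamma>" for k x using that by (intro DERIV_diff A A')
    show "continuous_on (- \<Gamma>) (\<lambda>x. A k x - A' k x)" for k by (intro continuous_on_diff A A')
    show "(\<Sum>k\<in>UNIV. A k x - A' k x) = 0" if "x \<notin> \<Gamma>" for x
      using A(3)[OF that] A'(3)[OF that] by (simp add: sum_subtractf)
    show "\<exists>C. \<forall>x. x \<notin> \<Gamma> \<longrightarrow> norm x \<le> R \<longrightarrow> \<bar>v (emb x) $ up k - v' (emb x) $ up k\<bar> \<le> C" for k R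
    proof -
      obtain a a' where "\<forall>x. x \<notin> \<Gamma> \<longrightarrow> norm x \<le> R \<longrightarrow> \<bar>v (emb x) $ up k\<bar> \<le> a"
        "\<forall>x. x \<notin> \<Gamma> \<longrightarrow> norm x \<le> R \<longrightarrow> \<bar>v' (emb x) $ up k\<bar> \<le> a'" using A(4) A'(4) by metis
      then show ?thesis by (intro exI[of _ "a + a'"]) (auto intro: order_trans[OF abs_triangle_ineq4 add_mono])
    qed
    show "\<bar>v (emb x) $ up k - v' (emb x) $ up k\<bar> \<le> C0 / norm x ^ 2" if "x \<notin> \<Gamma>" "R0 \<le> norm x" for k x
    proof -
      have e: "v (emb x) $ up k = u x $ k" "v' (emb x) $ up k = u' x $ k"
        using vu[OF that(1)] by (metis par_nth)+
      have "\<bar>u x $ k - u' x $ k\<bar> \<le> norm (u x) + norm (u' x)"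
        using component_le_norm_cart[of "u x" k] component_le_norm_cart[of "u' x" k] by linarith
      also have "\<dots> \<le> C4 / norm x ^ 2" using that R0 by (intro du) auto
      also have "\<dots> \<le> C0 / norm x ^ 2" by (rule C0) simp
      finally show ?thesis unfolding e .
    qed
    show "continuous_on UNIV b"
      unfolding JC(4)[symmetric]
      by (intro continuous_on_closed_Un has_derivative_continuous_on[OF d1] has_derivative_continuous_on[OF d2]) auto
    show "((\<lambda>t. b (x + t *\<^sub>R axis k 1)) has_real_derivative Bd k x) (at 0)" if "x \<notin> \<Gamma>" for k x
    proof (cases "x \<in> ?i")
      case True
      show ?thesis unfolding Bd1[OF True]
        using line_has_derivative[OF dat[OF oi True d1] bounded_linear_ident] by simp
    next
      case False
      then have x: "x \<in> ?o" using that cover by blast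
      show ?thesis unfolding Bd2[OF x]
        using line_has_derivative[OF dat[OF oo x d2] bounded_linear_ident] by simp
    qed
    show "continuous_on (- \<Gamma>) (Bd k)" for k
    proof -
      have "continuous_on ?i (\<lambda>x. E1 x (axis k 1))" "continuous_on ?o (\<lambda>x. E2 x (axis k 1))"
        by (intro continuous_intros continuous_on_subset[OF E1c closure_subset] continuous_on_subset[OF E2c closure_subset])+
      then have "continuous_on ?i (Bd k)" "continuous_on ?o (Bd k)"
        by (auto simp: Bd1 Bd2 cong: continuous_on_cong)
      then show ?thesis unfolding cover by (intro continuous_on_open_Un oi oo)
    qed
    show "\<exists>C. \<forall>x. x \<notin> \<Gamma> \<longrightarrow> norm x \<le> R \<longrightarrow> \<bar>Bd k x\<bar> \<le> C" for k R
    proof -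
      have bd: "\<exists>C. \<forall>x\<in>closure U \<inter> cball 0 R. norm (E x) \<le> C" if "continuous_on (closure U) E"
        for U and E :: "real^2 \<Rightarrow> (real^2) \<Rightarrow>\<^sub>L real"
      proof -
        have "compact (closure U \<inter> cball 0 R)" by (intro closed_Int_compact) auto
        then have "bounded (E ` (closure U \<inter> cball 0 R))"
          by (intro compact_imp_bounded compact_continuous_image continuous_on_subset[OF that]) auto
        then show ?thesis by (auto simp: bounded_iff)
      qed
      obtain a a' where a: "\<forall>x\<in>closure ?i \<inter> cball 0 R. norm (E1 x) \<le> a" "\<forall>x\<in>closure ?o \<inter> cball 0 R. norm (E2 x) \<le> a'"
        using bd[OF E1c] bd[OF E2c] by metis
      have "\<bar>Bd k x\<bar> \<le> max a a'" if "x \<notin> \<Gamma>" "norm x \<le> R" for x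
      proof (cases "x \<in> ?i")
        case True
        have "\<bar>Bd k x\<bar> \<le> norm (E1 x)" unfolding Bd1[OF True] using norm_blinfun[of "E1 x" "axis k 1"] by simp
        also have "\<dots> \<le> a" using a(1) subsetD[OF closure_subset True] that by auto
        finally show ?thesis by simp
      next
        case False
        then have x: "x \<in> ?o" using that cover by blast
        have "\<bar>Bd k x\<bar> \<le> norm (E2 x)" unfolding Bd2[OF x] using norm_blinfun[of "E2 x" "axis k 1"] by simp
        also have "\<dots> \<le> a'" using a(2) subsetD[OF closure_subset x] that by auto
        finally show ?thesis by simp
      qed
      then show ?thesis by blast
    qed
    show "M-lipschitz_on (ball 0 R) b" if M: "0 \<le> M" and B: "\<And>x. x \<notin> \<Gamma> \<Longrightarrow> norm x < R \<Longrightarrow> \<bar>Bd 1 x\<bar> + \<bar>Bd 2 x\<bar> \<le> M" for R M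
    proof -
      \<comment> \<open>Off the curve the two partial derivatives bound the operator norm, since
        each component of a vector is at most its norm. Continuity carries the bound from
        \<open>ball 0 R \<inter> U\<close> to its closure, which contains the points of
        \<open>closure U\<close> in the ball.\<close>
      have n: "norm (E x) \<le> M" if "x \<in> closure U" "x \<in> ball 0 R" "continuous_on (closure U) E" "U \<subseteq> - \<Gamma>"
        and E: "\<And>k x. x \<in> U \<Longrightarrow> Bd k x = E x (axis k 1)" for U x and E :: "real^2 \<Rightarrow> (real^2) \<Rightarrow>\<^sub>L real"
      proof (rule continuous_on_closure_norm_le[where s = "ball 0 R \<inter> U"])
        have "ball 0 R \<inter> closure U \<subseteq> closure (ball 0 R \<inter> U)" by (rule open_Int_closure_subset) simp
        then show "x \<in> closure (ball 0 R \<inter> U)" using that by blast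
        show "continuous_on (closure (ball 0 R \<inter> U)) E"
          using that(3) by (rule continuous_on_subset) (intro closure_mono, auto)
        show "\<forall>y\<in>ball 0 R \<inter> U. norm (E y) \<le> M"
        proof
          fix y assume y: "y \<in> ball 0 R \<inter> U"
          show "norm (E y) \<le> M"
          proof (rule norm_blinfun_bound[OF M])
            fix h :: "real^2"
            have "h = h $ 1 *\<^sub>R axis 1 1 + h $ 2 *\<^sub>R axis 2 1"
              by (simp add: vec_eq_iff forall_2 axis_def)
            then have "E y h = E y (h $ 1 *\<^sub>R axis 1 1 + h $ 2 *\<^sub>R axis 2 1)" by simp
            then have eq: "E y h = h $ 1 * Bd 1 y + h $ 2 * Bd 2 y"
              using y E by (simp add: blinfun.add_right blinfun.scaleR_right)
            have "\<bar>E y h\<bar> \<le> \<bar>h $ 1\<bar> * \<bar>Bd 1 y\<bar> + \<bar>h $ 2\<bar> * \<bar>Bd 2 y\<bar>"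
              unfolding eq using abs_triangle_ineq[of "h $ 1 * Bd 1 y" "h $ 2 * Bd 2 y"] by (simp add: abs_mult)
            also have "\<dots> \<le> norm h * \<bar>Bd 1 y\<bar> + norm h * \<bar>Bd 2 y\<bar>"
              by (intro add_mono mult_right_mono component_le_norm_cart) auto
            also have "\<dots> = (\<bar>Bd 1 y\<bar> + \<bar>Bd 2 y\<bar>) * norm h" by (simp add: algebra_simps)
            also have "\<dots> \<le> M * norm h" using y that(4) by (intro mult_right_mono B) auto
            finally show "norm (E y h) \<le> M * norm h" by simp
          qed
        qed
      qed
      show ?thesis
      proof (rule glued_lipschitz[OF _ _ JC(4) M d1 d2])
        show "norm (E1 x) \<le> M" if "x \<in> closure ?i" "x \<in> ball 0 R" for x
          by (rule n[OF that E1c _ Bd1]) (use cover in blast)+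
        show "norm (E2 x) \<le> M" if "x \<in> closure ?o" "x \<in> ball 0 R" for x
          by (rule n[OF that E2c _ Bd2]) (use cover in blast)+
      qed auto
    qed
    show "\<bar>b x\<bar> \<le> C0 / norm x ^ 2" if "R0 \<le> norm x" for x
    proof -
      have x: "x \<notin> \<Gamma>" using R6[of x] that R0(7) by auto
      have "\<bar>p x - p' x\<bar> \<le> norm (p x) + norm (p' x)" by simp
      also have "\<dots> \<le> C5 / norm x ^ 2" using that R0 x by (intro dp) auto
      also have "\<dots> \<le> C0 / norm x ^ 2" by (rule C0) simp
      finally show ?thesis unfolding bp[OF x] .
    qed
  qed

  \<comment> \<open>Coincidence of the two solutions, in the half-space and on the plane\<close>
  have "v x = v' x \<and> q x = q' x" if "x \<in> ?S" for x
    using w_eq_0[OF that] r_eq_0[OF that] by (simp add: vec_eq_iff)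
  moreover have "u x = u' x \<and> p x = p' x" if "x \<notin> \<Gamma>" for x
  proof -
    have "v (emb x) = v' (emb x)" using w_eq_0[OF emb_off_curve[OF that]] by (simp add: vec_eq_iff)
    then show ?thesis using vu[OF that] b_eq_0[of x] bp[OF that] by simp
  qed
  ultimately show ?thesis by blast
qed

end
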